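(* Let $\chi_{m,n}(\mathcal{A}^1)=\sum_{(\lambda,\mu)\vdash(m,n)}m_{\lambda,\mu}\,\chi_\lambda\otimes\chi_\mu$ be the $(m,n)$-th graded cocharacter of $\mathcal{A}^1$. Then: (1) $m_{\lambda,\emptyset}=1$ if $\lambda=(m)\vdash m$; (2) $m_{\lambda,(1)}=q+1$ if $\lambda=(p+q,p)\vdash m$; (3) $m_{\lambda,\mu}=q+1$ if $\lambda=(p+q,p)\vdash m$ and $\mu\vdash 2$. In all remaining cases $m_{\lambda,\mu}=0$.
   Context: $K$ is a field of characteristic zero, $e_{i,j}$ are the matrix units of $M_3(K)$, and $A = K(e_{1,1}+e_{3,3})\oplus Ke_{2,2}\oplus Ke_{1,2}\oplus Ke_{2,3}\oplus Ke_{1,3}$. $\mathcal{A}^1$ denotes $A$ with the $\mathbb{Z}_2$-grading $A_0=\mathrm{Span}(e_{1,1}+e_{3,3},e_{2,2},e_{1,3})$, $A_1=\mathrm{Span}(e_{1,2},e_{2,3})$. $K\langle Y,Z\rangle$ is the free unital associative algebra on variables $y_1,y_2,\dots$ (degree $0$) and $z_1,z_2,\dots$ (degree $1$). $\mathrm{Id}_{\mathbb{Z}_2}(\mathcal{A}^1)$ is the ideal of polynomials vanishing on $\mathcal{A}^1$ whenever the $y_i$ are replaced by elements of $A_0$ and the $z_j$ by elements of $A_1$. For $m,n\ge 0$, $P_{m,n}$ is the space of multilinear polynomials in $y_1,\dots,y_m,z_1,\dots,z_n$; $S_m\times S_n$ acts on it by $(\omega,\tau)f(y_1,\dots,y_m,z_1,\dots,z_n)=f(y_{\omega(1)},\dots,y_{\omega(m)},z_{\tau(1)},\dots,z_{\tau(n)})$,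 and $P_{m,n}\cap\mathrm{Id}_{\mathbb{Z}_2}(\mathcal{A}^1)$ is a submodule. $\chi_{m,n}(\mathcal{A}^1)$ is the character of the $S_m\times S_n$-module $P_{m,n}/(P_{m,n}\cap\mathrm{Id}_{\mathbb{Z}_2}(\mathcal{A}^1))$. The sum runs over pairs of partitions $\lambda\vdash m$, $\mu\vdash n$; $\chi_\lambda$ is the irreducible character of the symmetric group corresponding to $\lambda$, $\otimes$ is the outer tensor product, and $m_{\lambda,\mu}$ is the multiplicity. Here $p,q\ge 0$ are integers, zero parts of partitions are ignored, and $\emptyset$ is the partition of $0$. *)

theory Defs
  imports "HOL-Analysis.Analysis" "HOL-Library.Poly_Mapping" "HOL-Combinatorics.Permutations"
begin

text \<open>
  For subspaces \<open>U \<subseteq> W\<close> of a vector space with scalar multiplication \<open>smul\<close>, a finite set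
  \<open>B \<subseteq> W\<close> is a basis of \<open>W\<close> modulo \<open>U\<close> if the cosets \<open>b + U\<close> (\<open>b \<in> B\<close>) are pairwise distinct
  and form a basis of \<open>W / U\<close>.
\<close>

definition coords_mod ::
    "('a::field \<Rightarrow> 'b::ab_group_add \<Rightarrow> 'b) \<Rightarrow> 'b set \<Rightarrow> 'b set \<Rightarrow> 'b \<Rightarrow> ('b \<Rightarrow> 'a) \<Rightarrow> bool" where
  "coords_mod smul U B w c \<longleftrightarrow>
     (\<forall>b. b \<notin> B \<longrightarrow> c b = 0) \<and> w - (\<Sum>b\<in>B. smul (c b) b) \<in> U"

definition basis_mod ::
    "('a::field \<Rightarrow> 'b::ab_group_add \<Rightarrow> 'b) \<Rightarrow> 'b set \<Rightarrow> 'b set \<Rightarrow> 'b set \<Rightarrow> bool" where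
  "basis_mod smul W U B \<longleftrightarrow>
     finite B \<and> B \<subseteq> W \<and> (\<forall>w\<in>W. \<exists>!c. coords_mod smul U B w c)"

text \<open>
  The trace of the endomorphism of \<open>W / U\<close> induced by a linear map \<open>f\<close> with \<open>f ` W \<subseteq> W\<close> and
  \<open>f ` U \<subseteq> U\<close>. It is only meaningful if \<open>W / U\<close> is finite-dimensional; it then does not depend on
  the chosen basis.
\<close>

definition trace_mod ::
    "('a::field \<Rightarrow> 'b::ab_group_add \<Rightarrow> 'b) \<Rightarrow> 'b set \<Rightarrow> 'b set \<Rightarrow> ('b \<Rightarrow> 'b) \<Rightarrow> 'a" where
  "trace_mod smul W U f =
     (let B = (SOME B. basis_mod smul W U B)
      in \<Sum>b\<in>B. (THE c. coords_mod smul U B (f b) c) b)"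

definition pscale :: "'a::field \<Rightarrow> ('k \<Rightarrow>\<^sub>0 'a) \<Rightarrow> ('k \<Rightarrow>\<^sub>0 'a)" where
  "pscale c p = Poly_Mapping.map ((*) c) p"

lemma lookup_pscale [simp]:
  "Poly_Mapping.lookup (pscale c p) k = c * Poly_Mapping.lookup p k"
  by (simp add: pscale_def Poly_Mapping.map.rep_eq when_def)

interpretation pscale: vector_space pscale
  by unfold_locales (auto intro!: poly_mapping_eqI simp: lookup_add algebra_simps)

text \<open>A partition of \<open>n\<close> is the list of its positive parts; \<open>[]\<close> is the partition of \<open>0\<close>.\<close>

definition is_partition :: "nat list \<Rightarrow> nat \<Rightarrow> bool" (infix "\<turnstile>" 50) where
  "lam \<turnstile> n \<longleftrightarrow> sorted_wrt (\<ge>) lam \<and> (\<forall>x\<in>set lam. 0 < x) \<and> sum_list lam = n"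

definition drop_zeros :: "nat list \<Rightarrow> nat list" where
  "drop_zeros xs = filter (\<lambda>x. 0 < x) xs"

lemma finite_partitions: "finite {lam. lam \<turnstile> n}"
proof (rule finite_subset)
  have len: "length xs \<le> sum_list xs" if "\<forall>x\<in>set xs. (0::nat) < x" for xs
    using that by (induction xs) auto
  show "{lam. lam \<turnstile> n} \<subseteq> {xs. set xs \<subseteq> {..n} \<and> length xs \<le> n}"
    using len by (auto simp: is_partition_def dest: member_le_sum_list)
  show "finite {xs. set xs \<subseteq> {..n} \<and> length xs \<le> n}"
    by (rule finite_lists_length_le) simp
qed

text \<open>
  The group algebra of the symmetric group on \<open>{1..n}\<close> consists of the finitely supported
  functions on permutations; its product is the bilinear extension of composition.
\<close>

definition group_algebra :: "nat \<Rightarrow> ((nat \<Rightarrow> nat) \<Rightarrow>\<^sub>0 'a::field) set" where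
  "group_algebra n = {x. Poly_Mapping.keys x \<subseteq> {\<sigma>. \<sigma> permutes {1..n}}}"

definition ga_mult ::
    "((nat \<Rightarrow> nat) \<Rightarrow>\<^sub>0 'a::field) \<Rightarrow> ((nat \<Rightarrow> nat) \<Rightarrow>\<^sub>0 'a) \<Rightarrow> ((nat \<Rightarrow> nat) \<Rightarrow>\<^sub>0 'a)" where
  "ga_mult x y = (\<Sum>g\<in>Poly_Mapping.keys x. \<Sum>h\<in>Poly_Mapping.keys y.
     Poly_Mapping.single (g \<circ> h) (Poly_Mapping.lookup x g * Poly_Mapping.lookup y h))"

text \<open>
  The standard tableau of shape \<open>lam\<close> in which \<open>1, 2, \<dots>\<close> are entered row by row; rows and columns
  are numbered from \<open>0\<close>.
\<close>

definition tab_entry :: "nat list \<Rightarrow> nat \<Rightarrow> nat \<Rightarrow> nat" where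
  "tab_entry lam i j = sum_list (take i lam) + j + 1"

definition tab_row :: "nat list \<Rightarrow> nat \<Rightarrow> nat set" where
  "tab_row lam i = {tab_entry lam i j | j. j < lam ! i}"

definition tab_col :: "nat list \<Rightarrow> nat \<Rightarrow> nat set" where
  "tab_col lam j = {tab_entry lam i j | i. i < length lam \<and> j < lam ! i}"

definition row_stabilizer :: "nat list \<Rightarrow> (nat \<Rightarrow> nat) set" where
  "row_stabilizer lam =
     {\<sigma>. \<sigma> permutes {1..sum_list lam} \<and> (\<forall>i<length lam. \<sigma> ` tab_row lam i = tab_row lam i)}"

definition col_stabilizer :: "nat list \<Rightarrow> (nat \<Rightarrow> nat) set" where
  "col_stabilizer lam =
     {\<sigma>. \<sigma> permutes {1..sum_list lam} \<and> (\<forall>j. \<sigma> ` tab_col lam j = tab_col lam j)}"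

definition young_symmetrizer :: "nat list \<Rightarrow> ((nat \<Rightarrow> nat) \<Rightarrow>\<^sub>0 'a::field)" where
  "young_symmetrizer lam =
     ga_mult (\<Sum>\<sigma>\<in>row_stabilizer lam. Poly_Mapping.single \<sigma> 1)
             (\<Sum>\<tau>\<in>col_stabilizer lam. Poly_Mapping.single \<tau> (of_int (sign \<tau>)))"

text \<open>
  In characteristic zero, the left ideal generated by the Young symmetrizer is the irreducible
  module of shape \<open>lam\<close>; \<open>[n]\<close> gives the trivial character.
\<close>

definition irreducible_module :: "nat list \<Rightarrow> ((nat \<Rightarrow> nat) \<Rightarrow>\<^sub>0 'a::field_char_0) set" where
  "irreducible_module lam = {ga_mult x (young_symmetrizer lam) | x. x \<in> group_algebra (sum_list lam)}"

definition irreducible_character :: "nat list \<Rightarrow> (nat \<Rightarrow> nat) \<Rightarrow> 'a::field_char_0" where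
  "irreducible_character lam \<sigma> =
     trace_mod pscale (irreducible_module lam) {0} (ga_mult (Poly_Mapping.single \<sigma> 1))"

text \<open>
  \<open>mul\<close> gives the multiplicities of a character \<open>ch\<close> of \<open>S\<^sub>m \<times> S\<^sub>n\<close>. Values of \<open>mul\<close> outside
  pairs of partitions of \<open>m\<close> and \<open>n\<close> are irrelevant.
\<close>

definition has_multiplicities ::
    "nat \<Rightarrow> nat \<Rightarrow> ((nat \<Rightarrow> nat) \<Rightarrow> (nat \<Rightarrow> nat) \<Rightarrow> 'a::field_char_0) \<Rightarrow>
      (nat list \<Rightarrow> nat list \<Rightarrow> nat) \<Rightarrow> bool" where
  "has_multiplicities m n ch mul \<longleftrightarrow>
     (\<forall>\<omega> \<tau>. \<omega> permutes {1..m} \<and> \<tau> permutes {1..n} \<longrightarrow>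
        ch \<omega> \<tau> = (\<Sum>lam\<in>{lam. lam \<turnstile> m}. \<Sum>mu\<in>{mu. mu \<turnstile> n}.
          of_nat (mul lam mu) * (irreducible_character lam \<omega> * irreducible_character mu \<tau>)))"

datatype gvar = Yvar nat | Zvar nat

text \<open>
  Words form the free monoid, written additively here since the product on
  \<open>\<Rightarrow>\<^sub>0\<close> is induced by the addition of the exponents. Thus \<open>gvar list \<Rightarrow>\<^sub>0 'a\<close>, with its ring
  structure, is the free unital associative algebra.
\<close>

instantiation list :: (type) monoid_add
begin
definition zero_list :: "'a list" where "zero_list = []"
definition plus_list :: "'a list \<Rightarrow> 'a list \<Rightarrow> 'a list" where "plus_list = (@)"
instance by standard (auto simp: zero_list_def plus_list_def)
end

type_synonym 'a free_algebra = "gvar list \<Rightarrow>\<^sub>0 'a"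

definition multilinear :: "nat \<Rightarrow> nat \<Rightarrow> 'a::field free_algebra set" where
  "multilinear m n =
     {f. \<forall>w\<in>Poly_Mapping.keys f. distinct w \<and> set w = Yvar ` {1..m} \<union> Zvar ` {1..n}}"

fun rename_var :: "(nat \<Rightarrow> nat) \<Rightarrow> (nat \<Rightarrow> nat) \<Rightarrow> gvar \<Rightarrow> gvar" where
  "rename_var \<omega> \<tau> (Yvar i) = Yvar (\<omega> i)"
| "rename_var \<omega> \<tau> (Zvar j) = Zvar (\<tau> j)"

definition perm_act ::
    "(nat \<Rightarrow> nat) \<Rightarrow> (nat \<Rightarrow> nat) \<Rightarrow> 'a::field free_algebra \<Rightarrow> 'a free_algebra" where
  "perm_act \<omega> \<tau> f = (\<Sum>w\<in>Poly_Mapping.keys f.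
     Poly_Mapping.single (map (rename_var \<omega> \<tau>) w) (Poly_Mapping.lookup f w))"

text \<open>Matrices are multiplied with \<open>**\<close>; the product \<open>*\<close> on vectors is componentwise.\<close>

definition mscale :: "'a::field \<Rightarrow> 'a^3^3 \<Rightarrow> 'a^3^3" where
  "mscale c M = (\<chi> i j. c * M $ i $ j)"

interpretation mscale: vector_space mscale
  by unfold_locales (auto simp: mscale_def vec_eq_iff algebra_simps)

definition matunit :: "3 \<Rightarrow> 3 \<Rightarrow> 'a::field^3^3" where
  "matunit i j = (\<chi> k l. if k = i \<and> l = j then 1 else 0)"

definition algA :: "('a::field^3^3) set" where
  "algA = mscale.span {matunit 1 1 + matunit 3 3, matunit 2 2, matunit 1 2, matunit 2 3, matunit 1 3}"

definition algA0 :: "('a::field^3^3) set" where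
  "algA0 = mscale.span {matunit 1 1 + matunit 3 3, matunit 2 2, matunit 1 3}"

definition algA1 :: "('a::field^3^3) set" where
  "algA1 = mscale.span {matunit 1 2, matunit 2 3}"

lemma algA0_iff:
  "M \<in> algA0 \<longleftrightarrow> M $ 1 $ 1 = M $ 3 $ 3 \<and> M $ 1 $ 2 = 0 \<and> M $ 2 $ 1 = 0 \<and> M $ 2 $ 3 = 0 \<and>
     M $ 3 $ 1 = 0 \<and> M $ 3 $ 2 = 0"
proof
  assume "M \<in> algA0"
  then show "M $ 1 $ 1 = M $ 3 $ 3 \<and> M $ 1 $ 2 = 0 \<and> M $ 2 $ 1 = 0 \<and> M $ 2 $ 3 = 0 \<and>
     M $ 3 $ 1 = 0 \<and> M $ 3 $ 2 = 0"
    unfolding algA0_def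
    by (induction rule: mscale.span_induct_alt) (auto simp: mscale_def matunit_def)
next
  assume *: "M $ 1 $ 1 = M $ 3 $ 3 \<and> M $ 1 $ 2 = 0 \<and> M $ 2 $ 1 = 0 \<and> M $ 2 $ 3 = 0 \<and>
     M $ 3 $ 1 = 0 \<and> M $ 3 $ 2 = 0"
  have "M = mscale (M $ 1 $ 1) (matunit 1 1 + matunit 3 3) + mscale (M $ 2 $ 2) (matunit 2 2)
      + mscale (M $ 1 $ 3) (matunit 1 3)"
    using * by (simp add: vec_eq_iff forall_3 mscale_def matunit_def)
  also have "\<dots> \<in> algA0"
    unfolding algA0_def
    by (intro mscale.span_add mscale.span_scale mscale.span_base) auto
  finally show "M \<in> algA0" .
qed

lemma algA1_iff:
  "M \<in> algA1 \<longleftrightarrow> (\<forall>i j. (i, j) \<notin> {(1, 2), (2, 3)} \<longrightarrow> M $ i $ j = 0)"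
proof
  assume "M \<in> algA1"
  then show "\<forall>i j. (i, j) \<notin> {(1, 2), (2, 3)} \<longrightarrow> M $ i $ j = 0"
    unfolding algA1_def
    by (induction rule: mscale.span_induct_alt) (auto simp: mscale_def matunit_def)
next
  assume *: "\<forall>i j. (i, j) \<notin> {(1, 2), (2, 3)} \<longrightarrow> M $ i $ j = 0"
  have "M = mscale (M $ 1 $ 2) (matunit 1 2) + mscale (M $ 2 $ 3) (matunit 2 3)"
    using * by (simp add: vec_eq_iff forall_3 mscale_def matunit_def)
  also have "\<dots> \<in> algA1"
    unfolding algA1_def
    by (intro mscale.span_add mscale.span_scale mscale.span_base) auto
  finally show "M \<in> algA1" .
qed

lemma algA_grading:
  "algA = {M + N | M N. M \<in> algA0 \<and> N \<in> algA1}" "algA0 \<inter> algA1 = {0}" "mat 1 \<in> algA0"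
  "M \<in> algA0 \<Longrightarrow> N \<in> algA0 \<Longrightarrow> M ** N \<in> algA0" "M \<in> algA0 \<Longrightarrow> N \<in> algA1 \<Longrightarrow> M ** N \<in> algA1"
  "M \<in> algA1 \<Longrightarrow> N \<in> algA0 \<Longrightarrow> M ** N \<in> algA1" "M \<in> algA1 \<Longrightarrow> N \<in> algA1 \<Longrightarrow> M ** N \<in> algA0"
proof -
  have "algA = mscale.span ({matunit 1 1 + matunit 3 3, matunit 2 2, matunit 1 3} \<union> {matunit 1 2, matunit 2 3})"
    unfolding algA_def by (rule arg_cong[where f = mscale.span]) auto
  then show "algA = {M + N | M N. M \<in> algA0 \<and> N \<in> algA1}"
    unfolding mscale.span_Un algA0_def algA1_def by simp
  show "algA0 \<inter> algA1 = {0}"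
    by (auto simp: algA0_iff algA1_iff vec_eq_iff forall_3)
qed (auto simp: algA0_iff algA1_iff forall_3 matrix_matrix_mult_def sum_3 mat_def)

fun subst_var :: "(nat \<Rightarrow> 'b) \<Rightarrow> (nat \<Rightarrow> 'b) \<Rightarrow> gvar \<Rightarrow> 'b" where
  "subst_var a b (Yvar i) = a i"
| "subst_var a b (Zvar j) = b j"

definition eval_word :: "(nat \<Rightarrow> 'a::field^3^3) \<Rightarrow> (nat \<Rightarrow> 'a^3^3) \<Rightarrow> gvar list \<Rightarrow> 'a^3^3" where
  "eval_word a b w = foldr (\<lambda>x M. subst_var a b x ** M) w (mat 1)"

definition eval_poly :: "(nat \<Rightarrow> 'a::field^3^3) \<Rightarrow> (nat \<Rightarrow> 'a^3^3) \<Rightarrow> 'a free_algebra \<Rightarrow> 'a^3^3" where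
  "eval_poly a b f =
     (\<Sum>w\<in>Poly_Mapping.keys f. mscale (Poly_Mapping.lookup f w) (eval_word a b w))"

lemma eval_word_append: "eval_word a b (v @ w) = eval_word a b v ** eval_word a b w"
  by (induction v) (simp_all add: eval_word_def matrix_mul_assoc)

lemma eval_poly_superset:
  assumes "finite S" "Poly_Mapping.keys f \<subseteq> S"
  shows "eval_poly a b f = (\<Sum>w\<in>S. mscale (Poly_Mapping.lookup f w) (eval_word a b w))"
  unfolding eval_poly_def using assms
  by (intro sum.mono_neutral_left) (auto simp: in_keys_iff)

lemma eval_poly_add: "eval_poly a b (f + g) = eval_poly a b f + eval_poly a b g"
proof -
  let ?S = "Poly_Mapping.keys f \<union> Poly_Mapping.keys g"
  have "Poly_Mapping.keys (f + g) \<subseteq> ?S" by (rule Poly_Mapping.keys_add)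
  then show ?thesis
    by (subst (1 2 3) eval_poly_superset[of ?S])
       (auto simp: lookup_add mscale.scale_left_distrib sum.distrib)
qed

lemma eval_poly_0: "eval_poly a b 0 = 0"
  by (simp add: eval_poly_def)

lemma eval_poly_sum: "eval_poly a b (sum f S) = (\<Sum>s\<in>S. eval_poly a b (f s))"
  by (induction S rule: infinite_finite_induct) (simp_all add: eval_poly_add eval_poly_0)

lemma eval_poly_single: "eval_poly a b (Poly_Mapping.single w c) = mscale c (eval_word a b w)"
  by (cases "c = 0") (simp_all add: eval_poly_def)

lemma eval_poly_one: "eval_poly a b 1 = mat 1"
  unfolding single_one[symmetric] eval_poly_single by (simp add: eval_word_def zero_list_def)

lemma poly_mapping_eq_sum_single:
  "f = (\<Sum>w\<in>Poly_Mapping.keys f. Poly_Mapping.single w (Poly_Mapping.lookup f w))"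
  by (rule poly_mapping_eqI)
     (auto simp: lookup_sum lookup_single when_def in_keys_iff sum.delta)

lemma mscale_matrix_mult: "mscale c M ** mscale d N = mscale (c * d) (M ** N)"
  by (simp add: mscale_def matrix_matrix_mult_def vec_eq_iff sum_distrib_left mult_ac)

lemma matrix_sum_mult:
  fixes M :: "_ \<Rightarrow> 'a::field^3^3"
  shows "sum M S ** N = (\<Sum>s\<in>S. M s ** N)"  "N ** sum M S = (\<Sum>s\<in>S. N ** M s)"
  by (induction S rule: infinite_finite_induct)
     (simp_all add: matrix_matrix_mult_def vec_eq_iff distrib_left distrib_right sum.distrib)

lemma eval_poly_mult: "eval_poly a b (f * g) = eval_poly a b f ** eval_poly a b g"
proof -
  have "f * g = (\<Sum>v\<in>Poly_Mapping.keys f. \<Sum>w\<in>Poly_Mapping.keys g.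
      Poly_Mapping.single (v @ w) (Poly_Mapping.lookup f v * Poly_Mapping.lookup g w))"
    by (subst (1) poly_mapping_eq_sum_single[of f], subst (1) poly_mapping_eq_sum_single[of g])
       (simp add: sum_product mult_single plus_list_def)
  then show ?thesis
    by (simp add: eval_poly_sum eval_poly_single eval_word_append mscale_matrix_mult[symmetric]
        matrix_sum_mult eval_poly_def[of a b f] eval_poly_def[of a b g])
       (rule sum.swap)
qed

definition graded_identities :: "'a::field free_algebra set" where
  "graded_identities =
     {f. \<forall>a b. (\<forall>i. a i \<in> algA0) \<and> (\<forall>j. b j \<in> algA1) \<longrightarrow> eval_poly a b f = 0}"

definition graded_cocharacter :: "nat \<Rightarrow> nat \<Rightarrow> (nat \<Rightarrow> nat) \<Rightarrow> (nat \<Rightarrow> nat) \<Rightarrow> 'a::field_char_0" where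
  "graded_cocharacter m n \<omega> \<tau> =
     trace_mod pscale (multilinear m n) (multilinear m n \<inter> graded_identities) (perm_act \<omega> \<tau>)"

end

theory Submission
  imports Defs "HOL-Combinatorics.Cycles" "HOL-Combinatorics.Multiset_Permutations"
begin

text \<open>
  Write a degree-zero element of the algebra as \<open>a (e11 + e33) + b e22 + c e13\<close> and a degree-one
  element as \<open>u e12 + v e23\<close>. In a product of such elements each \<open>z\<close> moves the matrix index one step
  along \<open>1, 2, 3\<close>. A \<open>y\<close> met at index 1 or 3 contributes its \<open>a\<close>, a \<open>y\<close> met at index 2 its \<open>b\<close>,
  and \<open>c\<close> survives only if there is no \<open>z\<close> at all. Three \<open>z\<close>'s give zero. Without \<open>z\<close> all
  multilinear words agree, since the degree-zero part is commutative. With one or two \<open>z\<close>'s the value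
  of a multilinear word depends only on the order of the \<open>z\<close>'s and on the set \<open>S\<close> of the \<open>y\<close>'s
  preceded by exactly one \<open>z\<close>. Conversely, putting \<open>e22\<close> for the \<open>y\<close>'s in \<open>S\<close>, \<open>e11 + e33\<close> for
  the other ones, \<open>e12\<close> for the first \<open>z\<close> and \<open>e23\<close> for the second one singles out one such pair.
  So the pairs index a basis of the multilinear polynomials modulo the identities, and this basis is
  permuted by the two symmetric groups. The cocharacter is therefore the trivial character for
  \<open>n = 0\<close>; for \<open>n = 1, 2\<close> it is the number of \<open>\<omega>\<close>-invariant subsets of \<open>{1..m}\<close> times the regular
  character of \<open>S_n\<close>; and it is zero for \<open>n > 2\<close> (\<open>graded_cocharacter_eq\<close>,
  \<open>graded_cocharacter_factor\<close>).

  By Young's rule the module spanned by the subsets with \<open>k\<close> elements contains the shape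
  \<open>(p + q, p)\<close> once if \<open>p \<le> k \<le> p + q\<close> and not at all otherwise, and it contains no shape with
  more than two rows. Summing over \<open>k\<close> gives \<open>q + 1\<close>. For \<open>n \<le> 2\<close> all irreducible characters of
  \<open>S_n\<close> have degree one and occur once in the regular character.

  Both the decomposition and its uniqueness come from one duality. If \<open>e\<^sub>\<lambda>\<close> is the Young symmetrizer
  and \<open>\<chi>\<^sub>\<mu>\<close> is extended linearly to the group algebra, then \<open>\<chi>\<^sub>\<mu>(e\<^sub>\<lambda>)\<close> is zero for \<open>\<lambda> \<noteq> \<mu>\<close> and is the
  nonzero scalar \<open>c\<^sub>\<lambda>\<close> with \<open>e\<^sub>\<lambda>\<^sup>2 = c\<^sub>\<lambda> e\<^sub>\<lambda>\<close> for \<open>\<lambda> = \<mu>\<close> (\<open>character_young_symmetrizer\<close>). Hence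
  multiplicities are read off by evaluation at the elements \<open>e\<^sub>\<lambda>\<close> (\<open>has_multiplicities_unique\<close>).
  It also follows that the irreducible characters are linearly independent, and since there are no
  more conjugacy classes than partitions, they span the class functions. So every class function is
  determined by its values at the \<open>e\<^sub>\<lambda>\<close> (\<open>class_function_expansion\<close>), and Young's rule reduces to
  computing the trace of \<open>e\<^sub>\<lambda>\<close> on the span of the \<open>k\<close>-subsets: the image of \<open>e\<^sub>\<lambda>\<close> there is at most a
  line, on which \<open>e\<^sub>\<lambda>\<close> acts as \<open>c\<^sub>\<lambda>\<close> (\<open>fixed_subsets_two_row\<close>).
\<close>

section \<open>Traces on quotients through dual bases\<close>

text \<open>
  A basis of \<open>W / U\<close> is handled through representatives \<open>v i\<close> together with linear forms \<open>\<phi> i\<close> that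
  vanish exactly on \<open>U\<close> and are dual to them. Traces become sums \<open>\<Sum>i. \<phi> i (f (v i))\<close>, with no
  reference to coordinates. The forms live on the whole space, so that they are linear without side
  conditions.
\<close>

locale dual_basis_mod = vector_space scale
  for scale :: "'a::field \<Rightarrow> 'b::ab_group_add \<Rightarrow> 'b" (infixr "\<odot>" 75) +
  fixes W U :: "'b set" and I :: "'i set" and v :: "'i \<Rightarrow> 'b" and \<phi> :: "'i \<Rightarrow> 'b \<Rightarrow> 'a"
  assumes subspace_W: "subspace W" and subspace_U: "subspace U" and U_subset: "U \<subseteq> W"
    and finite_I: "finite I"
    and v_in: "i \<in> I \<Longrightarrow> v i \<in> W"
    and linear_\<phi>: "i \<in> I \<Longrightarrow> Vector_Spaces.linear scale (*) (\<phi> i)"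
    and dual: "i \<in> I \<Longrightarrow> j \<in> I \<Longrightarrow> \<phi> i (v j) = (if i = j then 1 else 0)"
    and in_U_iff: "w \<in> W \<Longrightarrow> w \<in> U \<longleftrightarrow> (\<forall>i\<in>I. \<phi> i w = 0)"
begin

lemma \<phi>_sum: "i \<in> I \<Longrightarrow> \<phi> i (\<Sum>x\<in>X. c x \<odot> g x) = (\<Sum>x\<in>X. c x * \<phi> i (g x))"
proof -
  assume i: "i \<in> I"
  interpret l: Vector_Spaces.linear scale "(*)" "\<phi> i" by (rule linear_\<phi>[OF i])
  show ?thesis by (simp add: l.sum l.scale)
qed

lemma \<phi>_diff: "i \<in> I \<Longrightarrow> \<phi> i (x - y) = \<phi> i x - \<phi> i y"
proof -
  assume i: "i \<in> I"
  interpret l: Vector_Spaces.linear scale "(*)" "\<phi> i" by (rule linear_\<phi>[OF i])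
  show ?thesis by (rule l.diff)
qed

lemma expansion:
  assumes "w \<in> W"
  shows "w - (\<Sum>i\<in>I. \<phi> i w \<odot> v i) \<in> U"
proof -
  have "(\<Sum>i\<in>I. \<phi> i w \<odot> v i) \<in> W"
    by (intro subspace_sum subspace_W subspace_scale v_in)
  then have W: "w - (\<Sum>i\<in>I. \<phi> i w \<odot> v i) \<in> W"
    using assms subspace_W subspace_diff by blast
  have "\<phi> j (w - (\<Sum>i\<in>I. \<phi> i w \<odot> v i)) = 0" if j: "j \<in> I" for j
  proof -
    have "(\<Sum>i\<in>I. \<phi> i w * \<phi> j (v i)) = (\<Sum>i\<in>I. if i = j then \<phi> i w else 0)"
      using j by (intro sum.cong) (auto simp: dual)
    then show ?thesis using j by (simp add: \<phi>_diff \<phi>_sum finite_I)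
  qed
  then show ?thesis using W by (simp add: in_U_iff)
qed

lemma \<phi>_cong:
  assumes "w - w' \<in> U" "i \<in> I"
  shows "\<phi> i w = \<phi> i w'"
proof -
  have "\<phi> i (w - w') = 0" using assms U_subset in_U_iff by blast
  then show ?thesis by (simp add: \<phi>_diff assms(2))
qed

lemma inj_on_v: "inj_on v I"
proof (rule inj_onI)
  fix i j assume "i \<in> I" "j \<in> I" "v i = v j"
  then show "i = j" using dual[of i i] dual[of i j] by (auto split: if_splits)
qed

lemma basis_mod_v: "basis_mod scale W U (v ` I)"
proof -
  have "\<exists>!c. coords_mod scale U (v ` I) w c" if w: "w \<in> W" for w
  proof (rule ex1I)
    let ?c = "\<lambda>b. if b \<in> v ` I then \<phi> (the_inv_into I v b) w else 0"
    show "coords_mod scale U (v ` I) w ?c"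
      using expansion[OF w]
      by (auto simp: coords_mod_def sum.reindex[OF inj_on_v] the_inv_into_f_f[OF inj_on_v])
    fix c assume c: "coords_mod scale U (v ` I) w c"
    have "c (v i) = \<phi> i w" if i: "i \<in> I" for i
    proof -
      have "w - (\<Sum>j\<in>I. c (v j) \<odot> v j) \<in> U"
        using c by (simp add: coords_mod_def sum.reindex[OF inj_on_v])
      then have "\<phi> i w = (\<Sum>j\<in>I. c (v j) * \<phi> i (v j))"
        using \<phi>_cong \<phi>_sum i by metis
      also have "\<dots> = (\<Sum>j\<in>I. if j = i then c (v j) else 0)"
        using i by (intro sum.cong) (auto simp: dual)
      also have "\<dots> = c (v i)" using i finite_I by simp
      finally show ?thesis ..
    qed
    then show "c = ?c"
      using c by (auto simp: coords_mod_def fun_eq_iff the_inv_into_f_f[OF inj_on_v])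
  qed
  then show ?thesis using finite_I v_in by (auto simp: basis_mod_def)
qed

text \<open>
  The definition of the trace uses coordinates \<open>co\<close> for some unknown basis \<open>B\<close>. Expanding \<open>f b\<close> in the
  \<open>v i\<close> modulo \<open>U\<close> turns the trace into \<open>\<Sum>i. \<phi> i (f (\<Sum>b. co (v i) b \<odot> b))\<close>, and the inner sum is
  \<open>v i\<close> modulo \<open>U\<close>.
\<close>

lemma trace_mod_eq:
  assumes f: "Vector_Spaces.linear scale scale f" and fW: "f ` W \<subseteq> W" and fU: "f ` U \<subseteq> U"
  shows "trace_mod scale W U f = (\<Sum>i\<in>I. \<phi> i (f (v i)))"
proof -
  interpret f: Vector_Spaces.linear scale scale f by (rule f)
  define B where "B = (SOME B. basis_mod scale W U B)"
  have B: "basis_mod scale W U B"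
    unfolding B_def by (rule someI[of _ "v ` I"]) (rule basis_mod_v)
  define co where "co w = (THE c. coords_mod scale U B w c)" for w
  have B_W: "b \<in> B \<Longrightarrow> b \<in> W" and fB: "finite B" for b using B by (auto simp: basis_mod_def)
  have ex1: "\<exists>!c. coords_mod scale U B w c" if "w \<in> W" for w
    using B that by (auto simp: basis_mod_def)
  have co: "coords_mod scale U B w (co w)" if "w \<in> W" for w
    unfolding co_def by (rule theI'[OF ex1[OF that]])
  have co_eqI: "co w = c" if "w \<in> W" "coords_mod scale U B w c" for w c
    using ex1[OF that(1)] co[OF that(1)] that(2) by blast
  have co_expand: "co w b = (\<Sum>i\<in>I. \<phi> i w * co (v i) b)" if w: "w \<in> W" for w b
  proof -
    have "w - (\<Sum>b\<in>B. (\<Sum>i\<in>I. \<phi> i w * co (v i) b) \<odot> b)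
        = (w - (\<Sum>i\<in>I. \<phi> i w \<odot> v i)) + (\<Sum>i\<in>I. \<phi> i w \<odot> (v i - (\<Sum>b\<in>B. co (v i) b \<odot> b)))"
      by (simp add: scale_sum_left scale_right_diff_distrib scale_sum_right sum_subtractf
          sum.swap[of _ B I])
    also have "\<dots> \<in> U"
      using co[OF v_in] expansion[OF w]
      by (intro subspace_add subspace_sum subspace_scale subspace_U) (auto simp: coords_mod_def)
    finally have "coords_mod scale U B w (\<lambda>b. \<Sum>i\<in>I. \<phi> i w * co (v i) b)"
      using co[OF v_in] by (auto simp: coords_mod_def)
    from co_eqI[OF w this] show ?thesis by (simp add: fun_eq_iff)
  qed
  have "trace_mod scale W U f = (\<Sum>b\<in>B. co (f b) b)"
    unfolding trace_mod_def Let_def B_def[symmetric] co_def ..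
  also have "\<dots> = (\<Sum>b\<in>B. \<Sum>i\<in>I. co (v i) b * \<phi> i (f b))"
    using B_W fW by (intro sum.cong refl) (subst co_expand, auto simp: mult.commute)
  also have "\<dots> = (\<Sum>i\<in>I. \<phi> i (\<Sum>b\<in>B. co (v i) b \<odot> f b))"
    by (subst sum.swap) (simp add: \<phi>_sum)
  also have "\<dots> = (\<Sum>i\<in>I. \<phi> i (f (v i)))"
  proof (intro sum.cong refl)
    fix i assume i: "i \<in> I"
    have "f (v i) - (\<Sum>b\<in>B. co (v i) b \<odot> f b) = f (v i - (\<Sum>b\<in>B. co (v i) b \<odot> b))"
      by (simp add: f.diff f.sum f.scale)
    also have "\<dots> \<in> U" using co[OF v_in[OF i]] fU by (auto simp: coords_mod_def)
    finally show "\<phi> i (\<Sum>b\<in>B. co (v i) b \<odot> f b) = \<phi> i (f (v i))"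
      using \<phi>_cong i by metis
  qed
  finally show ?thesis .
qed

text \<open>
  The usual \<open>tr (f g) = tr (g f)\<close>: both sides are a double sum symmetric in \<open>f\<close> and \<open>g\<close>.
\<close>

lemma trace_mod_conjugate:
  assumes f: "Vector_Spaces.linear scale scale f" "f ` W \<subseteq> W" "f ` U \<subseteq> U"
    and g: "Vector_Spaces.linear scale scale g" "g ` W \<subseteq> W" "g ` U \<subseteq> U"
  shows "trace_mod scale W U (f \<circ> g) = trace_mod scale W U (g \<circ> f)"
proof -
  have *: "trace_mod scale W U (f \<circ> g) = (\<Sum>i\<in>I. \<Sum>j\<in>I. \<phi> j (g (v i)) * \<phi> i (f (v j)))"
    if f: "Vector_Spaces.linear scale scale f" "f ` W \<subseteq> W" "f ` U \<subseteq> U"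
    and g: "Vector_Spaces.linear scale scale g" "g ` W \<subseteq> W" "g ` U \<subseteq> U" for f g
  proof -
    interpret f: Vector_Spaces.linear scale scale f by (rule f)
    have "Vector_Spaces.linear scale scale (f \<circ> g)" using g(1) f(1) by (rule Vector_Spaces.linear_compose)
    then have "trace_mod scale W U (f \<circ> g) = (\<Sum>i\<in>I. \<phi> i ((f \<circ> g) (v i)))"
      using f g by (intro trace_mod_eq) (simp_all add: image_subset_iff)
    also have "\<dots> = (\<Sum>i\<in>I. \<phi> i (\<Sum>j\<in>I. \<phi> j (g (v i)) \<odot> f (v j)))"
    proof (intro sum.cong refl)
      fix i assume i: "i \<in> I"
      have "f (g (v i)) - (\<Sum>j\<in>I. \<phi> j (g (v i)) \<odot> f (v j)) =
          f (g (v i) - (\<Sum>j\<in>I. \<phi> j (g (v i)) \<odot> v j))"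
        by (simp add: f.diff f.sum f.scale)
      also have "\<dots> \<in> U" using expansion[of "g (v i)"] g f v_in[OF i] by blast
      finally show "\<phi> i ((f \<circ> g) (v i)) = \<phi> i (\<Sum>j\<in>I. \<phi> j (g (v i)) \<odot> f (v j))"
        using \<phi>_cong i by simp
    qed
    finally show ?thesis by (simp add: \<phi>_sum)
  qed
  show ?thesis unfolding *[OF f g] *[OF g f] by (subst sum.swap) (simp add: mult.commute)
qed

end

lemma (in vector_space) ex_dual_basis:
  assumes W: "subspace W" and T: "finite T" "W \<subseteq> span T"
  shows "\<exists>(B :: 'b set) \<phi>. dual_basis_mod scale W {0} B (\<lambda>b. b) \<phi>"
proof -
  obtain B where B: "B \<subseteq> W" "independent B" "W \<subseteq> span B"
    by (rule maximal_independent_subset)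
  have fin: "finite B" using independent_span_bound[OF T(1) B(2)] B T by blast
  (* coordinates with respect to a basis of the whole space are linear everywhere and agree with
     those of B on W *)
  define E where "E = extend_basis B"
  have E: "independent E" "span E = UNIV" "B \<subseteq> E"
    using B(2) unfolding E_def by (auto simp: independent_extend_basis span_extend_basis extend_basis_superset)
  define \<phi> where "\<phi> b w = representation E w b" for b w
  have lin: "Vector_Spaces.linear scale (*) (\<phi> b)" for b
    unfolding \<phi>_def using linear_representation[OF E(1,2)] .
  have rep: "representation E w = representation B w" if "w \<in> W" for w
    using representation_extend[OF E(1) _ E(3)] B that by auto
  have "w = 0" if w: "w \<in> W" "\<forall>b\<in>B. \<phi> b w = 0" for w
  proof -
    have "w = (\<Sum>b\<in>B. scale (representation B w b) b)"
      using sum_representation_eq[OF B(2) _ fin subset_refl, of w] B w by auto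
    also have "\<dots> = 0" using w rep[OF w(1)] by (simp add: \<phi>_def)
    finally show ?thesis .
  qed
  moreover have "\<phi> b 0 = 0" for b
    by (simp add: \<phi>_def representation_zero)
  moreover have "\<phi> i j = (if i = j then 1 else 0)" if "i \<in> B" "j \<in> B" for i j
    using representation_basis[OF E(1), of j] E(3) that by (auto simp: \<phi>_def)
  ultimately have "dual_basis_mod scale W {0} B (\<lambda>b. b) \<phi>"
    using W B fin lin
    by (intro dual_basis_mod.intro vector_space_axioms dual_basis_mod_axioms.intro)
       (auto simp: subspace_0 intro: subspace_single_0)
  then show ?thesis by blast
qed

section \<open>Bilinear and linear extensions of maps on basis elements\<close>

abbreviation lookup where "lookup \<equiv> Poly_Mapping.lookup"
abbreviation single where "single \<equiv> Poly_Mapping.single"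
abbreviation keys where "keys \<equiv> Poly_Mapping.keys"

text \<open>
  The bilinear extension of \<open>\<alpha>\<close>. It covers the product of the group algebra (\<open>\<alpha>\<close> is composition), the
  action of the group algebra on formal sums of subsets (\<open>\<alpha>\<close> is the image) and the renaming of
  variables in polynomials.
\<close>

definition convolve ::
    "('g \<Rightarrow> 's \<Rightarrow> 't) \<Rightarrow> ('g \<Rightarrow>\<^sub>0 'a::field) \<Rightarrow> ('s \<Rightarrow>\<^sub>0 'a) \<Rightarrow> ('t \<Rightarrow>\<^sub>0 'a)" where
  "convolve \<alpha> x v = (\<Sum>g\<in>keys x. \<Sum>s\<in>keys v.
     single (\<alpha> g s) (lookup x g * lookup v s))"

lemma ga_mult_eq_convolve: "ga_mult = convolve (\<circ>)"
  by (simp add: fun_eq_iff ga_mult_def convolve_def)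

lemma convolve_superset:
  assumes "finite G" "finite S" "keys x \<subseteq> G" "keys v \<subseteq> S"
  shows "convolve \<alpha> x v = (\<Sum>g\<in>G. \<Sum>s\<in>S.
     single (\<alpha> g s) (lookup x g * lookup v s))"
proof -
  have "convolve \<alpha> x v = (\<Sum>g\<in>keys x. \<Sum>s\<in>S.
     single (\<alpha> g s) (lookup x g * lookup v s))"
    unfolding convolve_def using assms
    by (intro sum.cong refl sum.mono_neutral_left) (auto simp: in_keys_iff)
  also have "\<dots> = (\<Sum>g\<in>G. \<Sum>s\<in>S.
     single (\<alpha> g s) (lookup x g * lookup v s))"
    using assms by (intro sum.mono_neutral_left) (auto simp: in_keys_iff)
  finally show ?thesis .
qed

lemma convolve_add_left: "convolve \<alpha> (x + y) v = convolve \<alpha> x v + convolve \<alpha> y v"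
proof -
  let ?G = "keys x \<union> keys y"
  have "keys (x + y) \<subseteq> ?G" by (rule Poly_Mapping.keys_add)
  then show ?thesis
    by (subst (1 2 3) convolve_superset[of ?G "keys v"])
       (auto simp: lookup_add distrib_right single_add sum.distrib)
qed

lemma convolve_add_right: "convolve \<alpha> x (v + w) = convolve \<alpha> x v + convolve \<alpha> x w"
proof -
  let ?G = "keys v \<union> keys w"
  have "keys (v + w) \<subseteq> ?G" by (rule Poly_Mapping.keys_add)
  then show ?thesis
    by (subst (1 2 3) convolve_superset[of "keys x" ?G])
       (auto simp: lookup_add distrib_left single_add sum.distrib)
qed

lemma convolve_zero [simp]: "convolve \<alpha> 0 v = 0" "convolve \<alpha> x 0 = 0"
  by (simp_all add: convolve_def)

lemma convolve_sum_left: "convolve \<alpha> (\<Sum>i\<in>I. x i) v = (\<Sum>i\<in>I. convolve \<alpha> (x i) v)"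
  by (induction I rule: infinite_finite_induct) (simp_all add: convolve_add_left)

lemma convolve_sum_right: "convolve \<alpha> x (\<Sum>i\<in>I. v i) = (\<Sum>i\<in>I. convolve \<alpha> x (v i))"
  by (induction I rule: infinite_finite_induct) (simp_all add: convolve_add_right)

lemma pscale_single: "pscale c (single k d) = single k (c * d)"
  by (rule poly_mapping_eqI) (simp add: lookup_single when_def)

lemma keys_pscale: "keys (pscale c x) \<subseteq> keys x"
  by (auto simp: in_keys_iff)

lemma convolve_pscale_left: "convolve \<alpha> (pscale c x) v = pscale c (convolve \<alpha> x v)"
  by (subst convolve_superset[of "keys x" "keys v"])
     (auto simp: keys_pscale convolve_def pscale.scale_sum_right pscale_single mult_ac simp del: keys_pscale
        intro!: sum.cong dest: subsetD[OF keys_pscale])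

lemma convolve_pscale_right: "convolve \<alpha> x (pscale c v) = pscale c (convolve \<alpha> x v)"
  by (subst convolve_superset[of "keys x" "keys v"])
     (auto simp: convolve_def pscale.scale_sum_right pscale_single mult_ac
        intro!: sum.cong dest: subsetD[OF keys_pscale])

lemma convolve_single:
  "convolve \<alpha> (single g c) (single s d) = single (\<alpha> g s) (c * d)"
  by (subst convolve_superset[of "{g}" "{s}"]) auto

lemma poly_mapping_induct_linear [case_names single add]:
  assumes "\<And>k c. P (single k c)" "\<And>x y. P x \<Longrightarrow> P y \<Longrightarrow> P (x + y)"
  shows "P (x :: 'k \<Rightarrow>\<^sub>0 'a::field)"
proof -
  have "P (\<Sum>k\<in>K. single k (lookup x k))" for K
    using assms(1)[of undefined 0] assms by (induction K rule: infinite_finite_induct) auto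
  then show ?thesis by (subst poly_mapping_eq_sum_single)
qed

lemma convolve_assoc:
  assumes "\<And>g h s. \<alpha> g (\<beta> h s) = \<gamma> (\<delta> g h) s"
  shows "convolve \<alpha> x (convolve \<beta> y v) = convolve \<gamma> (convolve \<delta> x y) v"
proof (induction x rule: poly_mapping_induct_linear)
  case (single g c)
  show ?case
  proof (induction y rule: poly_mapping_induct_linear)
    case (single h d)
    show ?case
      by (induction v rule: poly_mapping_induct_linear)
         (simp_all add: convolve_add_right convolve_single assms mult_ac)
  qed (simp add: convolve_add_right convolve_add_left)
qed (simp add: convolve_add_left)

lemma linear_convolve_right: "Vector_Spaces.linear pscale pscale (convolve \<alpha> x)"
  by (simp add: Vector_Spaces.linear_iff pscale.vector_space_axioms convolve_add_right convolve_pscale_right)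

lemma lookup_convolve:
  assumes "finite G" "finite S" "keys x \<subseteq> G" "keys v \<subseteq> S"
  shows "lookup (convolve \<alpha> x v) t =
     (\<Sum>g\<in>G. \<Sum>s\<in>S. if \<alpha> g s = t then lookup x g * lookup v s else 0)"
  by (simp add: convolve_superset[OF assms] lookup_sum lookup_single when_def)

definition linear_extension :: "('g \<Rightarrow> 'a::field) \<Rightarrow> ('g \<Rightarrow>\<^sub>0 'a) \<Rightarrow> 'a" where
  "linear_extension f x = (\<Sum>g\<in>keys x. lookup x g * f g)"

lemma linear_extension_superset:
  assumes "finite G" "keys x \<subseteq> G"
  shows "linear_extension f x = (\<Sum>g\<in>G. lookup x g * f g)"
  unfolding linear_extension_def using assms by (intro sum.mono_neutral_left) (auto simp: in_keys_iff)

lemma linear_extension_single: "linear_extension f (single g c) = c * f g"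
  by (subst linear_extension_superset[of "{g}"]) auto

lemma linear_extension_add: "linear_extension f (x + y) = linear_extension f x + linear_extension f y"
proof -
  let ?G = "keys x \<union> keys y"
  have "keys (x + y) \<subseteq> ?G" by (rule Poly_Mapping.keys_add)
  then show ?thesis
    by (subst (1 2 3) linear_extension_superset[of ?G])
       (auto simp: lookup_add distrib_right sum.distrib)
qed

lemma linear_extension_pscale: "linear_extension f (pscale c x) = c * linear_extension f x"
  by (subst linear_extension_superset[of "keys x"])
     (auto simp: linear_extension_def sum_distrib_left mult_ac dest: subsetD[OF keys_pscale])

lemma linear_extension_sum: "linear_extension f (\<Sum>i\<in>I. x i) = (\<Sum>i\<in>I. linear_extension f (x i))"
  by (induction I rule: infinite_finite_induct)
     (simp_all add: linear_extension_add linear_extension_def[of f 0])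

lemma linear_extension_sum_fun:
  "linear_extension (\<lambda>g. \<Sum>i\<in>I. c i * f i g) x = (\<Sum>i\<in>I. c i * linear_extension (f i) x)"
  by (simp add: linear_extension_def sum_distrib_left sum.swap[of _ _ I] mult_ac)

section \<open>Tableaux and the dominance order\<close>

text \<open>
  The Young diagram of a partition.
\<close>

definition cells :: "nat list \<Rightarrow> (nat \<times> nat) set" where
  "cells lam = {(i, j). i < length lam \<and> j < lam ! i}"

lemma cells_Nil [simp]: "cells [] = {}"
  by (simp add: cells_def)

lemma cells_Cons: "cells (a # lam) = {0} \<times> {..<a} \<union> (\<lambda>(i, j). (Suc i, j)) ` cells lam"
proof (rule set_eqI)
  fix p :: "nat \<times> nat"
  obtain i j where p: "p = (i, j)" by (cases p)
  show "p \<in> cells (a # lam) \<longleftrightarrow> p \<in> {0} \<times> {..<a} \<union> (\<lambda>(i, j). (Suc i, j)) ` cells lam"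
    unfolding p by (cases i) (auto simp: cells_def image_iff)
qed

lemma finite_cells: "finite (cells lam)"
  by (induction lam) (simp_all add: cells_Cons)

lemma card_cells: "card (cells lam) = sum_list lam"
proof (induction lam)
  case (Cons a lam)
  have "card (cells (a # lam)) = card ({0::nat} \<times> {..<a}) + card ((\<lambda>(i, j). (Suc i, j)) ` cells lam)"
    unfolding cells_Cons by (intro card_Un_disjoint) (auto simp: finite_cells)
  also have "card ((\<lambda>(i, j). (Suc i, j)) ` cells lam) = card (cells lam)"
    by (rule card_image) (auto simp: inj_on_def)
  finally show ?case using Cons by simp
qed simp

lemma image_tab_entry: "(\<lambda>(i, j). tab_entry lam i j) ` cells lam = {1..sum_list lam}"
proof (induction lam)
  case (Cons a lam)
  have "(\<lambda>(i, j). tab_entry (a # lam) i j) ` cells (a # lam) =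
      (\<lambda>j. j + 1) ` {..<a} \<union> (\<lambda>x. x + a) ` ((\<lambda>(i, j). tab_entry lam i j) ` cells lam)"
    unfolding cells_Cons image_Un
  proof (intro arg_cong2[where f = "(\<union>)"])
    show "(\<lambda>(i, j). tab_entry (a # lam) i j) ` (\<lambda>(i, j). (Suc i, j)) ` cells lam =
        (\<lambda>x. x + a) ` (\<lambda>(i, j). tab_entry lam i j) ` cells lam"
      unfolding image_image by (intro image_cong) (auto simp: tab_entry_def)
    show "(\<lambda>(i, j). tab_entry (a # lam) i j) ` ({0} \<times> {..<a}) = (\<lambda>j. j + 1) ` {..<a}"
      by (force simp: tab_entry_def image_iff)
  qed
  also have "\<dots> = {1..a} \<union> {1 + a..sum_list lam + a}"
    unfolding Cons.IH image_add_atLeastAtMost' lessThan_atLeast0 image_add_atLeastLessThan'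
    by auto
  also have "\<dots> = {1..sum_list (a # lam)}" by auto
  finally show ?case .
qed simp

lemma bij_betw_tab_entry: "bij_betw (\<lambda>(i, j). tab_entry lam i j) (cells lam) {1..sum_list lam}"
  unfolding bij_betw_def
  by (intro conjI image_tab_entry eq_card_imp_inj_on finite_cells)
     (simp only: image_tab_entry card_cells card_atLeastAtMost diff_Suc_1)

definition cell_of :: "nat list \<Rightarrow> nat \<Rightarrow> nat \<times> nat" where
  "cell_of lam = the_inv_into (cells lam) (\<lambda>(i, j). tab_entry lam i j)"

definition row_of :: "nat list \<Rightarrow> nat \<Rightarrow> nat" where "row_of lam x = fst (cell_of lam x)"
definition col_of :: "nat list \<Rightarrow> nat \<Rightarrow> nat" where "col_of lam x = snd (cell_of lam x)"

lemma bij_betw_cell_of: "bij_betw (cell_of lam) {1..sum_list lam} (cells lam)"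
  unfolding cell_of_def by (rule bij_betw_the_inv_into[OF bij_betw_tab_entry])

lemma row_col_in_cells: "x \<in> {1..sum_list lam} \<Longrightarrow> (row_of lam x, col_of lam x) \<in> cells lam"
  using bij_betw_cell_of[of lam] unfolding row_of_def col_of_def by (auto simp: bij_betw_def)

lemma row_col_tab_entry:
  assumes "(i, j) \<in> cells lam"
  shows "tab_entry lam i j \<in> {1..sum_list lam}" "row_of lam (tab_entry lam i j) = i"
    "col_of lam (tab_entry lam i j) = j"
  using assms the_inv_into_f_f[OF bij_betw_imp_inj_on[OF bij_betw_tab_entry], OF assms]
    image_tab_entry[of lam]
  by (auto simp: row_of_def col_of_def cell_of_def)

lemma tab_entry_row_col: "x \<in> {1..sum_list lam} \<Longrightarrow> tab_entry lam (row_of lam x) (col_of lam x) = x"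
  using f_the_inv_into_f_bij_betw[OF bij_betw_tab_entry, of lam x]
  unfolding row_of_def col_of_def cell_of_def by (auto simp: split_beta)

lemma row_col_inj:
  assumes "x \<in> {1..sum_list lam}" "y \<in> {1..sum_list lam}" "row_of lam x = row_of lam y" "col_of lam x = col_of lam y"
  shows "x = y"
  using tab_entry_row_col assms by metis

lemma tab_row_eq: "i < length lam \<Longrightarrow> tab_row lam i = {x \<in> {1..sum_list lam}. row_of lam x = i}"
proof (intro set_eqI iffI)
  fix x assume "i < length lam" "x \<in> tab_row lam i"
  then show "x \<in> {x \<in> {1..sum_list lam}. row_of lam x = i}"
    using row_col_tab_entry[of i _ lam] by (auto simp: tab_row_def cells_def)
next
  fix x assume "i < length lam" "x \<in> {x \<in> {1..sum_list lam}. row_of lam x = i}"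
  then show "x \<in> tab_row lam i"
    using row_col_in_cells[of x lam] tab_entry_row_col[of x lam] unfolding tab_row_def cells_def by force
qed

lemma tab_col_eq: "tab_col lam j = {x \<in> {1..sum_list lam}. col_of lam x = j}"
proof (intro set_eqI iffI)
  fix x assume "x \<in> tab_col lam j"
  then show "x \<in> {x \<in> {1..sum_list lam}. col_of lam x = j}"
    using row_col_tab_entry[of _ j lam] by (auto simp: tab_col_def cells_def)
next
  fix x assume "x \<in> {x \<in> {1..sum_list lam}. col_of lam x = j}"
  then show "x \<in> tab_col lam j"
    using row_col_in_cells[of x lam] tab_entry_row_col[of x lam] unfolding tab_col_def cells_def by force
qed

text \<open>
  Turns the description of the row and column stabilizers by invariant sets into one by the functions
  \<open>row_of\<close> and \<open>col_of\<close>.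
\<close>

lemma permutes_image_fibre_iff:
  assumes \<sigma>: "\<sigma> permutes X" "finite X" and J: "f ` X \<subseteq> J"
  shows "(\<forall>j\<in>J. \<sigma> ` {x \<in> X. f x = j} = {x \<in> X. f x = j}) \<longleftrightarrow> (\<forall>x\<in>X. f (\<sigma> x) = f x)"
proof
  assume *: "\<forall>j\<in>J. \<sigma> ` {x \<in> X. f x = j} = {x \<in> X. f x = j}"
  show "\<forall>x\<in>X. f (\<sigma> x) = f x"
  proof
    fix x assume x: "x \<in> X"
    then have "\<sigma> ` {y \<in> X. f y = f x} = {y \<in> X. f y = f x}" using * J by blast
    then show "f (\<sigma> x) = f x" using x by blast
  qed
next
  assume *: "\<forall>x\<in>X. f (\<sigma> x) = f x"
  show "\<forall>j\<in>J. \<sigma> ` {x \<in> X. f x = j} = {x \<in> X. f x = j}"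
  proof
    fix j
    show "\<sigma> ` {x \<in> X. f x = j} = {x \<in> X. f x = j}"
      using * \<sigma> permutes_in_image[OF \<sigma>(1)] permutes_inj[OF \<sigma>(1)]
      by (intro endo_inj_surj) (auto intro: inj_on_subset)
  qed
qed

lemma row_stabilizer_iff:
  "\<sigma> \<in> row_stabilizer lam \<longleftrightarrow> \<sigma> permutes {1..sum_list lam} \<and>
     (\<forall>x\<in>{1..sum_list lam}. row_of lam (\<sigma> x) = row_of lam x)"
proof (cases "\<sigma> permutes {1..sum_list lam}")
  case True
  have "row_of lam ` {1..sum_list lam} \<subseteq> {..<length lam}"
    using row_col_in_cells by (auto simp: cells_def)
  from permutes_image_fibre_iff[OF True _ this] True show ?thesis
    by (auto simp: row_stabilizer_def tab_row_eq)
qed (auto simp: row_stabilizer_def)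

lemma col_stabilizer_iff:
  "\<sigma> \<in> col_stabilizer lam \<longleftrightarrow> \<sigma> permutes {1..sum_list lam} \<and>
     (\<forall>x\<in>{1..sum_list lam}. col_of lam (\<sigma> x) = col_of lam x)"
proof (cases "\<sigma> permutes {1..sum_list lam}")
  case True
  from permutes_image_fibre_iff[OF True, of "col_of lam" UNIV] True show ?thesis
    by (auto simp: col_stabilizer_def tab_col_eq)
qed (auto simp: col_stabilizer_def)

lemma row_col_stabilizer_Int:
  assumes "\<sigma> \<in> row_stabilizer lam" "\<sigma> \<in> col_stabilizer lam"
  shows "\<sigma> = id"
proof (rule ext)
  fix x
  have p: "\<sigma> permutes {1..sum_list lam}" using assms row_stabilizer_iff by blast
  show "\<sigma> x = id x"
  proof (cases "x \<in> {1..sum_list lam}")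
    case True
    then show ?thesis
      using assms permutes_in_image[OF p, of x] row_col_inj[of "\<sigma> x" lam x]
      by (auto simp: row_stabilizer_iff col_stabilizer_iff)
  qed (use permutes_not_in[OF p] in auto)
qed

lemma stabilizer_subset:
  "row_stabilizer lam \<subseteq> {\<sigma>. \<sigma> permutes {1..sum_list lam}}"
  "col_stabilizer lam \<subseteq> {\<sigma>. \<sigma> permutes {1..sum_list lam}}"
  by (auto simp: row_stabilizer_def col_stabilizer_def)

lemma finite_stabilizer: "finite (row_stabilizer lam)" "finite (col_stabilizer lam)"
  using stabilizer_subset finite_permutations[of "{1..sum_list lam}"]
  by (meson finite_atLeastAtMost finite_subset)+

lemma id_in_stabilizer: "id \<in> row_stabilizer lam" "id \<in> col_stabilizer lam"
  by (auto simp: row_stabilizer_iff col_stabilizer_iff permutes_id)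

lemma comp_in_stabilizer:
  "\<sigma> \<in> row_stabilizer lam \<Longrightarrow> \<tau> \<in> row_stabilizer lam \<Longrightarrow> \<sigma> \<circ> \<tau> \<in> row_stabilizer lam"
  "\<sigma> \<in> col_stabilizer lam \<Longrightarrow> \<tau> \<in> col_stabilizer lam \<Longrightarrow> \<sigma> \<circ> \<tau> \<in> col_stabilizer lam"
  using permutes_in_image[of \<tau> "{1..sum_list lam}"]
  by (simp_all add: row_stabilizer_iff col_stabilizer_iff permutes_compose)

lemma inv_in_stabilizer:
  "\<sigma> \<in> row_stabilizer lam \<Longrightarrow> inv \<sigma> \<in> row_stabilizer lam"
  "\<sigma> \<in> col_stabilizer lam \<Longrightarrow> inv \<sigma> \<in> col_stabilizer lam"
proof -
  have *: "f (inv \<sigma> x) = f x"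
    if "\<sigma> permutes X" "\<forall>x\<in>X. f (\<sigma> x) = f x" "x \<in> X" for f :: "nat \<Rightarrow> nat" and X x
  proof -
    have "inv \<sigma> x \<in> X" using permutes_in_image[OF permutes_inv[OF that(1)]] that(3) by simp
    then have "f (\<sigma> (inv \<sigma> x)) = f (inv \<sigma> x)" using that(2) by blast
    then show ?thesis by (simp add: permutes_inverses(1)[OF that(1)])
  qed
  show "\<sigma> \<in> row_stabilizer lam \<Longrightarrow> inv \<sigma> \<in> row_stabilizer lam"
    "\<sigma> \<in> col_stabilizer lam \<Longrightarrow> inv \<sigma> \<in> col_stabilizer lam"
    using *[where X = "{1..sum_list lam}" and f = "row_of lam"] *[where X = "{1..sum_list lam}" and f = "col_of lam"]
    unfolding row_stabilizer_iff col_stabilizer_iff by (simp_all add: permutes_inv)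
qed

lemma transpose_in_stabilizer:
  assumes "x \<in> {1..sum_list lam}" "y \<in> {1..sum_list lam}"
  shows "row_of lam x = row_of lam y \<Longrightarrow> Transposition.transpose x y \<in> row_stabilizer lam"
    "col_of lam x = col_of lam y \<Longrightarrow> Transposition.transpose x y \<in> col_stabilizer lam"
proof -
  have *: "Transposition.transpose x y permutes {1..sum_list lam}"
    using assms by (rule permutes_swap_id)
  have **: "f (Transposition.transpose x y z) = f z" if "f x = f y" for f :: "nat \<Rightarrow> nat" and z
    using that by (cases "z = x"; cases "z = y") simp_all
  show "row_of lam x = row_of lam y \<Longrightarrow> Transposition.transpose x y \<in> row_stabilizer lam"
    "col_of lam x = col_of lam y \<Longrightarrow> Transposition.transpose x y \<in> col_stabilizer lam"
    using * ** unfolding row_stabilizer_iff col_stabilizer_iff by blast+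
qed

lemma cells_downward:
  assumes "lam \<turnstile> n" "(k, j) \<in> cells lam" "i \<le> k"
  shows "(i, j) \<in> cells lam"
proof (cases "i = k")
  case False
  then have "lam ! i \<ge> lam ! k"
    using assms sorted_wrt_nth_less[of "(\<ge>)" lam i k] by (simp add: is_partition_def cells_def)
  then show ?thesis using assms by (auto simp: cells_def)
qed (use assms in simp)

text \<open>
  The partial sums that occur in the dominance order are numbers of entries in the first rows.
\<close>

lemma card_rows_above: "card {x \<in> {1..sum_list lam}. row_of lam x < i} = sum_list (take i lam)"
proof -
  have "bij_betw (cell_of lam) {x \<in> {1..sum_list lam}. row_of lam x < i} (cells (take i lam))"
  proof (rule bij_betw_subset[OF bij_betw_cell_of])
    show "cell_of lam ` {x \<in> {1..sum_list lam}. row_of lam x < i} = cells (take i lam)"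
    proof (intro set_eqI iffI)
      fix p assume "p \<in> cell_of lam ` {x \<in> {1..sum_list lam}. row_of lam x < i}"
      then obtain x where "x \<in> {1..sum_list lam}" "row_of lam x < i" "p = (row_of lam x, col_of lam x)"
        by (auto simp: row_of_def col_of_def)
      then show "p \<in> cells (take i lam)"
        using row_col_in_cells[of x lam] by (auto simp: cells_def)
    next
      fix p assume p: "p \<in> cells (take i lam)"
      obtain k l where kl: "p = (k, l)" by (cases p)
      have "(k, l) \<in> cells lam" "k < i" using p by (auto simp: kl cells_def)
      with row_col_tab_entry[OF this(1)]
      show "p \<in> cell_of lam ` {x \<in> {1..sum_list lam}. row_of lam x < i}"
        by (intro image_eqI[where x = "tab_entry lam k l"])
           (auto simp: kl row_of_def col_of_def prod_eq_iff)
    qed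
  qed auto
  from bij_betw_same_card[OF this] show ?thesis by (simp add: card_cells)
qed

lemma partition_eqI:
  assumes "\<forall>x\<in>set lam. 0 < x" "\<forall>x\<in>set mu. (0::nat) < x"
    and "\<And>i. sum_list (take i lam) = sum_list (take i mu)"
  shows "lam = mu"
  using assms
proof (induction lam arbitrary: mu)
  case Nil
  then show ?case using Nil(3)[of 1] by (cases mu) auto
next
  case (Cons a lam)
  obtain b mu' where mu: "mu = b # mu'" using Cons.prems(1) Cons.prems(3)[of 1] by (cases mu) auto
  have ab: "a = b" using Cons.prems(3)[of 1] by (simp add: mu)
  have "lam = mu'"
    using Cons.prems(1,2) Cons.prems(3)[of "Suc _"] by (intro Cons.IH) (auto simp: mu ab)
  then show ?case by (simp add: mu ab)
qed

text \<open>
  The assumption \<open>inj\<close> says that no two entries in the same column of the tableau of shape \<open>mu\<close> are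
  moved by \<open>g\<close> into the same row of the tableau of shape \<open>lam\<close>. Its failure makes a product of a
  row symmetrizer and a column antisymmetrizer vanish; its consequences are drawn here.
\<close>

context
  fixes lam mu :: "nat list" and n :: nat and g :: "nat \<Rightarrow> nat"
  assumes lam: "lam \<turnstile> n" and mu: "mu \<turnstile> n" and g: "g permutes {1..n}"
    and inj: "inj_on (\<lambda>y. (row_of lam (g y), col_of mu y)) {1..n}"
begin

text \<open>
  At most \<open>i\<close> entries of a column of \<open>mu\<close> go to the first \<open>i\<close> rows of \<open>lam\<close>, and of course no more than
  the column has. Since columns are filled from the top, the smaller of these numbers is the number of
  entries of the column in its own first \<open>i\<close> rows.
\<close>

lemma card_column_le:
  "card {y \<in> {1..n}. col_of mu y = j \<and> row_of lam (g y) < i}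
     \<le> card {y \<in> {1..n}. col_of mu y = j \<and> row_of mu y < i}" (is "card ?A \<le> card ?B")
proof (cases "(i, j) \<in> cells mu")
  case True
  have n: "sum_list mu = n" using mu by (simp add: is_partition_def)
  have "inj_on (\<lambda>y. row_of lam (g y)) ?A"
    by (intro inj_onI inj_onD[OF inj]) auto
  then have "card ?A \<le> card {..<i}" by (rule card_inj_on_le) auto
  also have "card ((\<lambda>k. tab_entry mu k j) ` {..<i}) = card {..<i}"
  proof (rule card_image, rule inj_onI)
    fix k l assume "k \<in> {..<i}" "l \<in> {..<i}" and eq: "tab_entry mu k j = tab_entry mu l j"
    then have "(k, j) \<in> cells mu" "(l, j) \<in> cells mu"
      using cells_downward[OF mu True] by auto
    from this[THEN row_col_tab_entry(2)] show "k = l" unfolding eq by simp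
  qed
  then have "card {..<i} = card ((\<lambda>k. tab_entry mu k j) ` {..<i})" ..
  also have "\<dots> \<le> card ?B"
  proof (rule card_mono)
    show "(\<lambda>k. tab_entry mu k j) ` {..<i} \<subseteq> ?B"
      using row_col_tab_entry[OF cells_downward[OF mu True]] by (auto simp: n)
  qed auto
  finally show ?thesis .
next
  case False
  have n: "sum_list mu = n" using mu by (simp add: is_partition_def)
  have "row_of mu y < i" if "y \<in> {1..n}" "col_of mu y = j" for y
    using row_col_in_cells[of y mu] cells_downward[OF mu, of "row_of mu y" j i] False that n
    by (metis not_le)
  then show ?thesis by (intro card_mono) auto
qed

lemma rows_above_eq_sum_columns:
  fixes P :: "nat \<Rightarrow> bool"
  shows "card {y \<in> {1..n}. P y} = (\<Sum>j\<in>col_of mu ` {1..n}. card {y \<in> {1..n}. col_of mu y = j \<and> P y})"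
proof -
  have "{y \<in> {1..n}. P y} = (\<Union>j\<in>col_of mu ` {1..n}. {y \<in> {1..n}. col_of mu y = j \<and> P y})"
    by auto
  also have "card \<dots> = (\<Sum>j\<in>col_of mu ` {1..n}. card {y \<in> {1..n}. col_of mu y = j \<and> P y})"
    by (rule card_UN_disjoint) auto
  finally show ?thesis .
qed

lemma card_rows_permuted: "card {y \<in> {1..n}. row_of lam (g y) < i} = sum_list (take i lam)"
proof -
  have n: "sum_list lam = n" using lam by (simp add: is_partition_def)
  have "bij_betw g {y \<in> {1..n}. row_of lam (g y) < i} {y \<in> {1..n}. row_of lam y < i}"
  proof (rule bij_betw_subset[OF permutes_imp_bij[OF g]])
    show "g ` {y \<in> {1..n}. row_of lam (g y) < i} = {y \<in> {1..n}. row_of lam y < i}"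
    proof (intro set_eqI iffI)
      fix x assume x: "x \<in> {y \<in> {1..n}. row_of lam y < i}"
      then have "inv g x \<in> {1..n}" "g (inv g x) = x"
        using permutes_in_image[OF permutes_inv[OF g]] permutes_inverses(1)[OF g] by auto
      then show "x \<in> g ` {y \<in> {1..n}. row_of lam (g y) < i}" using x by (intro image_eqI[where x = "inv g x"]) auto
    qed (use permutes_in_image[OF g] in auto)
  qed auto
  from bij_betw_same_card[OF this] show ?thesis using card_rows_above[of lam i] n by simp
qed

text \<open>
  Sum the column-wise inequality over all columns.
\<close>

lemma dominance: "sum_list (take i lam) \<le> sum_list (take i mu)"
proof -
  have n: "sum_list mu = n" using mu by (simp add: is_partition_def)
  have "sum_list (take i lam) \<le> card {y \<in> {1..n}. row_of mu y < i}"
    unfolding card_rows_permuted[symmetric] rows_above_eq_sum_columns[of "\<lambda>y. row_of mu y < i"]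
      rows_above_eq_sum_columns[of "\<lambda>y. row_of lam (g y) < i"]
    by (intro sum_mono card_column_le)
  then show ?thesis using card_rows_above[of mu i] n by simp
qed

text \<open>
  For equal shapes the column-wise inequalities add up to an equality, so each of them is an equality.
  If an entry \<open>y\<close> were moved to a row \<open>i\<close> below the end of its column, then the inequality for this
  column and this \<open>i\<close> would be strict, because all of the column lies above row \<open>i\<close>.
\<close>

lemma row_in_column:
  assumes eq: "lam = mu" and y: "y \<in> {1..n}"
  shows "(row_of mu (g y), col_of mu y) \<in> cells mu"
proof (rule ccontr)
  have n: "sum_list mu = n" using mu by (simp add: is_partition_def)
  define i where "i = row_of mu (g y)"
  let ?J = "col_of mu ` {1..n}"
  let ?A = "\<lambda>j. {y \<in> {1..n}. col_of mu y = j \<and> row_of lam (g y) < i}"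
  let ?B = "\<lambda>j. {y \<in> {1..n}. col_of mu y = j \<and> row_of mu y < i}"
  let ?j = "col_of mu y"
  assume "(row_of mu (g y), col_of mu y) \<notin> cells mu"
  then have "(i, ?j) \<notin> cells mu" by (simp add: i_def)
  then have "row_of mu z < i" if "z \<in> {1..n}" "col_of mu z = ?j" for z
    using row_col_in_cells[of z mu] cells_downward[OF mu, of "row_of mu z" ?j i] that n
    by (metis not_le)
  then have "?A ?j \<subset> ?B ?j" using y by (auto simp: eq i_def)
  then have "card (?A ?j) < card (?B ?j)" by (intro psubset_card_mono) auto
  then have "(\<Sum>j\<in>?J. card (?A j)) < (\<Sum>j\<in>?J. card (?B j))"
    using y card_column_le by (intro sum_strict_mono_ex1) auto
  moreover have "(\<Sum>j\<in>?J. card (?A j)) = (\<Sum>j\<in>?J. card (?B j))"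
    unfolding rows_above_eq_sum_columns[of "\<lambda>y. row_of mu y < i", symmetric]
      rows_above_eq_sum_columns[of "\<lambda>y. row_of lam (g y) < i", symmetric] card_rows_permuted
    using card_rows_above[of mu i] n eq by simp
  ultimately show False by simp
qed

text \<open>
  The column permutation \<open>c\<close> moves \<open>y\<close> within its column to the row in which \<open>g y\<close> lies; what remains
  of \<open>g\<close> preserves rows.
\<close>

lemma factor_row_col:
  assumes eq: "lam = mu"
  shows "\<exists>r\<in>row_stabilizer mu. \<exists>c\<in>col_stabilizer mu. g = r \<circ> c"
proof -
  have n: "sum_list mu = n" using mu by (simp add: is_partition_def)
  define c where "c y = (if y \<in> {1..n} then tab_entry mu (row_of mu (g y)) (col_of mu y) else y)" for y
  have c: "c y \<in> {1..n}" "row_of mu (c y) = row_of mu (g y)" "col_of mu (c y) = col_of mu y" if "y \<in> {1..n}" for y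
    using row_col_tab_entry[OF row_in_column[OF eq that]] that by (simp_all add: c_def n)
  have "inj_on c {1..n}"
  proof (rule inj_onI)
    fix x y assume xy: "x \<in> {1..n}" "y \<in> {1..n}" "c x = c y"
    then have "row_of mu (g x) = row_of mu (g y)" "col_of mu x = col_of mu y" using c by metis+
    then show "x = y" using xy by (intro inj_onD[OF inj]) (simp_all add: eq)
  qed
  then have "c ` {1..n} = {1..n}" using c(1) by (intro endo_inj_surj) auto
  with \<open>inj_on c {1..n}\<close> have cp: "c permutes {1..n}"
    by (intro bij_imp_permutes) (auto simp: bij_betw_def c_def)
  have C: "c \<in> col_stabilizer mu" using c cp by (simp add: col_stabilizer_iff n)
  have "row_of mu (g (inv c x)) = row_of mu x" if "x \<in> {1..n}" for x
    using c(2)[of "inv c x"] permutes_in_image[OF permutes_inv[OF cp], of x] permutes_inverses(1)[OF cp, of x] that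
    by simp
  then have "g \<circ> inv c \<in> row_stabilizer mu"
    using permutes_compose[OF permutes_inv[OF cp] g] by (simp add: row_stabilizer_iff n)
  moreover have "g = (g \<circ> inv c) \<circ> c" using permutes_inv_o[OF cp] by (simp add: o_assoc[symmetric])
  ultimately show ?thesis using C by blast
qed

end

section \<open>Young symmetrizers\<close>

notation ga_mult (infixl "\<star>" 70)

abbreviation perm_basis :: "(nat \<Rightarrow> nat) \<Rightarrow> ((nat \<Rightarrow> nat) \<Rightarrow>\<^sub>0 'a::field)" where
  "perm_basis g \<equiv> single g 1"

lemma ga_mult_assoc: "x \<star> (y \<star> z) = (x \<star> y) \<star> z"
  unfolding ga_mult_eq_convolve by (rule convolve_assoc) (rule o_assoc)

lemma ga_mult_single: "single g c \<star> single h d = single (g \<circ> h) (c * d)"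
  by (simp add: ga_mult_eq_convolve convolve_single)

lemma ga_mult_add: "(x + y) \<star> z = x \<star> z + y \<star> z" "x \<star> (y + z) = x \<star> y + x \<star> z"
  by (simp_all add: ga_mult_eq_convolve convolve_add_left convolve_add_right)

lemma ga_mult_sum_left: "(\<Sum>i\<in>I. f i) \<star> z = (\<Sum>i\<in>I. f i \<star> z)"
  by (simp add: ga_mult_eq_convolve convolve_sum_left)

lemma ga_mult_sum_right: "z \<star> (\<Sum>i\<in>I. f i) = (\<Sum>i\<in>I. z \<star> f i)"
  by (simp add: ga_mult_eq_convolve convolve_sum_right)

lemma ga_mult_pscale: "pscale c x \<star> y = pscale c (x \<star> y)" "x \<star> pscale c y = pscale c (x \<star> y)"
  by (simp_all add: ga_mult_eq_convolve convolve_pscale_left convolve_pscale_right)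

lemma ga_mult_zero: "0 \<star> x = 0" "x \<star> 0 = 0"
  by (simp_all add: ga_mult_eq_convolve)

lemma linear_ga_mult: "Vector_Spaces.linear pscale pscale ((\<star>) x)"
  unfolding ga_mult_eq_convolve by (rule linear_convolve_right)

lemma ga_mult_id [simp]: "perm_basis id \<star> x = x" "x \<star> perm_basis id = x"
proof -
  show "perm_basis id \<star> x = x"
    by (induction x rule: poly_mapping_induct_linear) (simp_all add: ga_mult_single ga_mult_add o_def)
  show "x \<star> perm_basis id = x"
    by (induction x rule: poly_mapping_induct_linear) (simp_all add: ga_mult_single ga_mult_add o_def)
qed

lemma subspace_group_algebra: "pscale.subspace (group_algebra n)"
  by (auto simp: pscale.subspace_def group_algebra_def dest: subsetD[OF Poly_Mapping.keys_add] subsetD[OF keys_pscale])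

lemma single_in_group_algebra: "g permutes {1..n} \<Longrightarrow> single g c \<in> group_algebra n"
  by (auto simp: group_algebra_def)

lemma ga_mult_in_group_algebra:
  "x \<in> group_algebra n \<Longrightarrow> y \<in> group_algebra n \<Longrightarrow> x \<star> y \<in> group_algebra n"
  unfolding ga_mult_def
  by (intro pscale.subspace_sum subspace_group_algebra single_in_group_algebra permutes_compose)
     (auto simp: group_algebra_def)

lemma group_algebra_induct [consumes 1, case_names single add]:
  assumes "x \<in> group_algebra n"
    "\<And>g c. g permutes {1..n} \<Longrightarrow> P (single g c)" "\<And>x y. P x \<Longrightarrow> P y \<Longrightarrow> P (x + y)"
  shows "P (x :: (nat \<Rightarrow> nat) \<Rightarrow>\<^sub>0 'a::field)"
proof -
  have "P (\<Sum>k\<in>K. single k (lookup x k))" if "finite K" "K \<subseteq> {g. g permutes {1..n}}" for K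
    using that
  proof (induction K)
    case empty
    then show ?case using assms(2)[of id 0] by (simp add: permutes_id)
  qed (use assms in auto)
  then show ?thesis
    using assms(1) by (subst poly_mapping_eq_sum_single) (simp add: group_algebra_def)
qed

lemma group_algebra_subset_span:
  "group_algebra n \<subseteq> pscale.span ((perm_basis :: _ \<Rightarrow> _ \<Rightarrow>\<^sub>0 'a::field) ` {g. g permutes {1..n}})"
proof
  fix x :: "(nat \<Rightarrow> nat) \<Rightarrow>\<^sub>0 'a"
  assume "x \<in> group_algebra n"
  then show "x \<in> pscale.span (perm_basis ` {g. g permutes {1..n}})"
  proof (induction rule: group_algebra_induct)
    case (single g c)
    have "single g c = pscale c (perm_basis g)" by (simp add: pscale_single)
    then show ?case using single by (auto intro: pscale.span_scale pscale.span_base)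
  qed (rule pscale.span_add)
qed

text \<open>
  The coefficient of the identity in a product is a sum of products of coefficients at inverse
  elements, so for \<open>x\<close> invariant under inversion the square \<open>x \<star> x\<close> has a sum of squares there.
\<close>

lemma lookup_ga_mult_id:
  assumes x: "x \<in> group_algebra n" and y: "y \<in> group_algebra n"
  shows "lookup (x \<star> y) id =
    (\<Sum>g | g permutes {1..n}. lookup x g * lookup y (inv g))"
proof -
  let ?P = "{g. g permutes {1..n}}"
  have fin: "finite ?P" by (simp add: finite_permutations)
  have "lookup (x \<star> y) id =
      (\<Sum>g\<in>?P. \<Sum>h\<in>?P. if g \<circ> h = id then lookup x g * lookup y h else 0)"
    unfolding ga_mult_eq_convolve using x y fin
    by (intro lookup_convolve) (auto simp: group_algebra_def)
  also have "\<dots> = (\<Sum>g\<in>?P. lookup x g * lookup y (inv g))"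
  proof (intro sum.cong refl)
    fix g assume g: "g \<in> ?P"
    have "g \<circ> h = id \<longleftrightarrow> h = inv g" if "h \<in> ?P" for h
      using g that by (auto simp: permutes_inv_o inv_unique_comp intro: sym dest: permutes_inv_o)
        (metis comp_id fun.map_id id_comp o_assoc permutes_inv_o(2))
    then have "(\<Sum>h\<in>?P. if g \<circ> h = id then lookup x g * lookup y h else 0) =
        (\<Sum>h\<in>?P. if h = inv g then lookup x g * lookup y h else 0)"
      by (intro sum.cong) auto
    also have "\<dots> = lookup x g * lookup y (inv g)"
      using g fin by (simp add: permutes_inv)
    finally show "(\<Sum>h\<in>?P. if g \<circ> h = id then lookup x g * lookup y h else 0) =
        lookup x g * lookup y (inv g)" .
  qed
  finally show ?thesis .
qed

definition row_symmetrizer :: "nat list \<Rightarrow> ((nat \<Rightarrow> nat) \<Rightarrow>\<^sub>0 'a::field)" where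
  "row_symmetrizer lam = (\<Sum>\<sigma>\<in>row_stabilizer lam. perm_basis \<sigma>)"

definition col_antisymmetrizer :: "nat list \<Rightarrow> ((nat \<Rightarrow> nat) \<Rightarrow>\<^sub>0 'a::field)" where
  "col_antisymmetrizer lam = (\<Sum>\<tau>\<in>col_stabilizer lam. single \<tau> (of_int (sign \<tau>)))"

lemma young_symmetrizer_eq: "young_symmetrizer lam = row_symmetrizer lam \<star> col_antisymmetrizer lam"
  by (simp add: young_symmetrizer_def row_symmetrizer_def col_antisymmetrizer_def)

lemma symmetrizers_in_group_algebra:
  assumes "lam \<turnstile> n"
  shows "row_symmetrizer lam \<in> group_algebra n" "col_antisymmetrizer lam \<in> group_algebra n"
    "young_symmetrizer lam \<in> group_algebra n"
proof -
  have n: "sum_list lam = n" using assms by (simp add: is_partition_def)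
  show *: "row_symmetrizer lam \<in> group_algebra n" "col_antisymmetrizer lam \<in> group_algebra n"
    unfolding row_symmetrizer_def col_antisymmetrizer_def
    using stabilizer_subset[of lam] n
    by (auto intro!: pscale.subspace_sum[OF subspace_group_algebra] single_in_group_algebra)
  show "young_symmetrizer lam \<in> group_algebra n"
    unfolding young_symmetrizer_eq by (intro ga_mult_in_group_algebra *)
qed

lemma bij_betw_comp_group:
  assumes "g \<in> G" "\<And>x. x \<in> G \<Longrightarrow> x permutes S"
    "\<And>x y. x \<in> G \<Longrightarrow> y \<in> G \<Longrightarrow> x \<circ> y \<in> G" "\<And>x. x \<in> G \<Longrightarrow> inv x \<in> G"
  shows "bij_betw (\<lambda>x. g \<circ> x) G G" "bij_betw (\<lambda>x. x \<circ> g) G G" "bij_betw inv G G"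
proof -
  have g: "g \<circ> inv g = id" "inv g \<circ> g = id" using permutes_inv_o assms by blast+
  show "bij_betw (\<lambda>x. g \<circ> x) G G"
    using assms g by (intro bij_betwI[where g = "\<lambda>x. inv g \<circ> x"]) (auto simp: o_assoc)
  show "bij_betw (\<lambda>x. x \<circ> g) G G"
    using assms g by (intro bij_betwI[where g = "\<lambda>x. x \<circ> inv g"]) (auto simp: o_assoc[symmetric])
  have "inv (inv x) = x" if "x \<in> G" for x
    using that assms(2) by (meson inv_inv_eq permutes_bij)
  then show "bij_betw inv G G"
    using assms by (intro bij_betwI[where g = inv]) auto
qed

lemma bij_betw_row_stabilizer:
  assumes "g \<in> row_stabilizer lam"
  shows "bij_betw (\<lambda>x. g \<circ> x) (row_stabilizer lam) (row_stabilizer lam)"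
    "bij_betw (\<lambda>x. x \<circ> g) (row_stabilizer lam) (row_stabilizer lam)"
    "bij_betw inv (row_stabilizer lam) (row_stabilizer lam)"
  by (rule bij_betw_comp_group[OF assms, where S = "{1..sum_list lam}"];
      simp add: comp_in_stabilizer inv_in_stabilizer; simp add: row_stabilizer_iff)+

lemma bij_betw_col_stabilizer:
  assumes "g \<in> col_stabilizer lam"
  shows "bij_betw (\<lambda>x. g \<circ> x) (col_stabilizer lam) (col_stabilizer lam)"
    "bij_betw (\<lambda>x. x \<circ> g) (col_stabilizer lam) (col_stabilizer lam)"
    "bij_betw inv (col_stabilizer lam) (col_stabilizer lam)"
  by (rule bij_betw_comp_group[OF assms, where S = "{1..sum_list lam}"];
      simp add: comp_in_stabilizer inv_in_stabilizer; simp add: col_stabilizer_iff)+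

lemma col_stabilizer_permutation: "c \<in> col_stabilizer lam \<Longrightarrow> permutation c"
  unfolding permutation_permutes col_stabilizer_iff by blast

lemma row_symmetrizer_absorb:
  assumes "r \<in> row_stabilizer lam"
  shows "perm_basis r \<star> row_symmetrizer lam = row_symmetrizer lam"
    "row_symmetrizer lam \<star> perm_basis r = row_symmetrizer lam"
  unfolding row_symmetrizer_def ga_mult_sum_left ga_mult_sum_right ga_mult_single
  using sum.reindex_bij_betw[OF bij_betw_row_stabilizer(1)[OF assms], where g = perm_basis]
    sum.reindex_bij_betw[OF bij_betw_row_stabilizer(2)[OF assms], where g = perm_basis] by simp_all

lemma col_antisymmetrizer_absorb:
  assumes c: "c \<in> col_stabilizer lam"
  shows "perm_basis c \<star> col_antisymmetrizer lam = pscale (of_int (sign c) :: 'a::field) (col_antisymmetrizer lam)"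
    "col_antisymmetrizer lam \<star> perm_basis c = pscale (of_int (sign c) :: 'a) (col_antisymmetrizer lam)"
proof -
  let ?s = "\<lambda>\<tau>. single \<tau> (of_int (sign \<tau>) :: 'a)"
  let ?C = "col_stabilizer lam"
  have sgn: "of_int (sign \<tau>) = (of_int (sign c) :: 'a) * of_int (sign (c \<circ> \<tau>))"
    "of_int (sign \<tau>) = (of_int (sign c) :: 'a) * of_int (sign (\<tau> \<circ> c))" if "\<tau> \<in> ?C" for \<tau>
  proof -
    have "sign (c \<circ> \<tau>) = sign c * sign \<tau>" "sign (\<tau> \<circ> c) = sign c * sign \<tau>"
      using c that by (simp_all add: sign_compose col_stabilizer_permutation)
    then show "of_int (sign \<tau>) = (of_int (sign c) :: 'a) * of_int (sign (c \<circ> \<tau>))"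
      "of_int (sign \<tau>) = (of_int (sign c) :: 'a) * of_int (sign (\<tau> \<circ> c))"
      by (simp_all add: sign_def)
  qed
  have "perm_basis c \<star> col_antisymmetrizer lam = (\<Sum>\<tau>\<in>?C. single (c \<circ> \<tau>) (of_int (sign \<tau>) :: 'a))"
    by (simp add: col_antisymmetrizer_def ga_mult_sum_right ga_mult_single)
  also have "\<dots> = (\<Sum>\<tau>\<in>?C. pscale (of_int (sign c)) (?s (c \<circ> \<tau>)))"
    by (intro sum.cong refl) (simp add: pscale_single sgn(1))
  also have "\<dots> = pscale (of_int (sign c)) (\<Sum>\<tau>\<in>?C. ?s \<tau>)"
    by (subst sum.reindex_bij_betw[OF bij_betw_col_stabilizer(1)[OF c], symmetric])
       (simp add: pscale.scale_sum_right)
  finally show "perm_basis c \<star> col_antisymmetrizer lam = pscale (of_int (sign c) :: 'a) (col_antisymmetrizer lam)"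
    by (simp add: col_antisymmetrizer_def)
  have "col_antisymmetrizer lam \<star> perm_basis c = (\<Sum>\<tau>\<in>?C. single (\<tau> \<circ> c) (of_int (sign \<tau>) :: 'a))"
    by (simp add: col_antisymmetrizer_def ga_mult_sum_left ga_mult_single)
  also have "\<dots> = (\<Sum>\<tau>\<in>?C. pscale (of_int (sign c)) (?s (\<tau> \<circ> c)))"
    by (intro sum.cong refl) (simp add: pscale_single sgn(2))
  also have "\<dots> = pscale (of_int (sign c)) (\<Sum>\<tau>\<in>?C. ?s \<tau>)"
    by (subst sum.reindex_bij_betw[OF bij_betw_col_stabilizer(2)[OF c], symmetric])
       (simp add: pscale.scale_sum_right)
  finally show "col_antisymmetrizer lam \<star> perm_basis c = pscale (of_int (sign c) :: 'a) (col_antisymmetrizer lam)"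
    by (simp add: col_antisymmetrizer_def)
qed

lemma poly_mapping_eq_uminus_imp_0:
  fixes x :: "'k \<Rightarrow>\<^sub>0 'a::field_char_0"
  assumes "x = pscale (- 1) x"
  shows "x = 0"
proof (rule poly_mapping_eqI)
  fix k
  have "lookup x k = - lookup x k"
    by (subst assms) simp
  then have "2 * lookup x k = 0" by (simp only: eq_neg_iff_add_eq_0 mult_2)
  then show "lookup x k = lookup 0 k" by simp
qed

lemma transpose_conjugate:
  assumes "g permutes S"
  shows "Transposition.transpose (g y) (g y') \<circ> g = g \<circ> Transposition.transpose y y'"
  using permutes_inj[OF assms] by (auto simp: fun_eq_iff Transposition.transpose_def inj_eq)

text \<open>
  If two entries \<open>y\<close>, \<open>y'\<close> share a column of \<open>mu\<close> and their images under \<open>g\<close> share a row of \<open>lam\<close>, then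
  the transposition of \<open>y\<close> and \<open>y'\<close> is absorbed with sign \<open>-1\<close> on the side of the columns and, carried
  across \<open>g\<close>, with sign \<open>1\<close> on the side of the rows.
\<close>

lemma sandwich_eq_0:
  fixes lam mu :: "nat list"
  assumes lam: "lam \<turnstile> n" and mu: "mu \<turnstile> n" and g: "g permutes {1..n}"
    and "\<not> inj_on (\<lambda>y. (row_of lam (g y), col_of mu y)) {1..n}"
  shows "row_symmetrizer lam \<star> single g d \<star> col_antisymmetrizer mu = (0 :: _ \<Rightarrow>\<^sub>0 'a::field_char_0)"
    "col_antisymmetrizer mu \<star> single (inv g) d \<star> row_symmetrizer lam = (0 :: _ \<Rightarrow>\<^sub>0 'a::field_char_0)"
proof -
  have n: "sum_list lam = n" "sum_list mu = n" using lam mu by (simp_all add: is_partition_def)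
  obtain y y' where y: "y \<in> {1..n}" "y' \<in> {1..n}" "y \<noteq> y'" "row_of lam (g y) = row_of lam (g y')"
    "col_of mu y = col_of mu y'"
    using assms(4) by (auto simp: inj_on_def)
  define t where "t = Transposition.transpose y y'"
  define s where "s = Transposition.transpose (g y) (g y')"
  have t: "t \<in> col_stabilizer mu" "sign t = -1"
    using y transpose_in_stabilizer(2)[of y mu y'] n by (auto simp: t_def sign_swap_id)
  have s: "s \<in> row_stabilizer lam"
    using y transpose_in_stabilizer(1)[of "g y" lam "g y'"] permutes_in_image[OF g] n by (auto simp: s_def)
  have st: "s \<circ> g = g \<circ> t" unfolding s_def t_def by (rule transpose_conjugate[OF g])
  let ?a = "row_symmetrizer lam :: _ \<Rightarrow>\<^sub>0 'a" and ?b = "col_antisymmetrizer mu :: _ \<Rightarrow>\<^sub>0 'a"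
  let ?g = "single g d" and ?h = "single (inv g) d"
  have "?a \<star> ?g \<star> ?b = ?a \<star> perm_basis s \<star> ?g \<star> ?b"
    by (simp add: row_symmetrizer_absorb(2)[OF s])
  also have "\<dots> = ?a \<star> (perm_basis s \<star> ?g) \<star> ?b"
    by (simp add: ga_mult_assoc)
  also have "perm_basis s \<star> ?g = ?g \<star> perm_basis t"
    by (simp add: ga_mult_single st)
  also have "?a \<star> (?g \<star> perm_basis t) \<star> ?b = ?a \<star> ?g \<star> (perm_basis t \<star> ?b)"
    by (simp add: ga_mult_assoc)
  also have "\<dots> = pscale (-1) (?a \<star> ?g \<star> ?b)"
    unfolding col_antisymmetrizer_absorb(1)[OF t(1)] t(2) ga_mult_pscale by (simp only: of_int_minus of_int_1)
  finally show "?a \<star> ?g \<star> ?b = 0" by (rule poly_mapping_eq_uminus_imp_0)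
  have g': "g \<circ> inv g = id" "inv g \<circ> g = id" using permutes_inv_o[OF g] by auto
  have "inv g \<circ> s = inv g \<circ> (s \<circ> g) \<circ> inv g" by (simp add: o_assoc[symmetric] g')
  also have "\<dots> = t \<circ> inv g" by (simp add: st o_assoc g')
  finally have ts: "inv g \<circ> s = t \<circ> inv g" .
  have "?b \<star> ?h \<star> ?a = ?b \<star> ?h \<star> (perm_basis s \<star> ?a)"
    by (simp add: row_symmetrizer_absorb(1)[OF s])
  also have "\<dots> = ?b \<star> (?h \<star> perm_basis s) \<star> ?a"
    by (simp add: ga_mult_assoc)
  also have "?h \<star> perm_basis s = perm_basis t \<star> ?h"
    by (simp add: ga_mult_single ts)
  also have "?b \<star> (perm_basis t \<star> ?h) \<star> ?a = ?b \<star> perm_basis t \<star> ?h \<star> ?a"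
    by (simp add: ga_mult_assoc)
  also have "\<dots> = pscale (-1) (?b \<star> ?h \<star> ?a)"
    unfolding col_antisymmetrizer_absorb(2)[OF t(1)] t(2) ga_mult_pscale by (simp only: of_int_minus of_int_1)
  finally show "?b \<star> ?h \<star> ?a = 0" by (rule poly_mapping_eq_uminus_imp_0)
qed

text \<open>
  A group element either is killed by the two symmetrizers or factors into a row and a column
  permutation, which are absorbed.
\<close>

lemma sandwich_multiple:
  fixes x :: "_ \<Rightarrow>\<^sub>0 'a::field_char_0"
  assumes lam: "lam \<turnstile> n" and x: "x \<in> group_algebra n"
  shows "\<exists>k. row_symmetrizer lam \<star> x \<star> col_antisymmetrizer lam = pscale k (young_symmetrizer lam)"
  using x
proof (induction rule: group_algebra_induct)
  case (single g d)
  show ?case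
  proof (cases "inj_on (\<lambda>y. (row_of lam (g y), col_of lam y)) {1..n}")
    case True
    obtain r c where rc: "r \<in> row_stabilizer lam" "c \<in> col_stabilizer lam" "g = r \<circ> c"
      using factor_row_col[OF lam lam single True] by auto
    have "single g d = perm_basis r \<star> pscale d (perm_basis c)"
      by (simp add: rc pscale_single ga_mult_single)
    then have "row_symmetrizer lam \<star> single g d \<star> col_antisymmetrizer lam =
      pscale d ((row_symmetrizer lam \<star> perm_basis r) \<star> (perm_basis c \<star> col_antisymmetrizer lam))"
      by (simp add: ga_mult_assoc ga_mult_pscale)
    also have "\<dots> = pscale (d * of_int (sign c)) (young_symmetrizer lam)"
      by (simp add: row_symmetrizer_absorb(2)[OF rc(1)] col_antisymmetrizer_absorb(1)[OF rc(2)]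
          ga_mult_pscale young_symmetrizer_eq)
    finally show ?thesis by blast
  next
    case False
    show ?thesis
      using sandwich_eq_0(1)[OF lam lam single False] by (intro exI[of _ 0]) simp
  qed
next
  case (add x y)
  then obtain k l where "row_symmetrizer lam \<star> x \<star> col_antisymmetrizer lam = pscale k (young_symmetrizer lam)"
    "row_symmetrizer lam \<star> y \<star> col_antisymmetrizer lam = pscale l (young_symmetrizer lam)" by blast
  then have "row_symmetrizer lam \<star> (x + y) \<star> col_antisymmetrizer lam = pscale (k + l) (young_symmetrizer lam)"
    by (simp add: ga_mult_add pscale.scale_left_distrib)
  then show ?case by blast
qed

lemma young_symmetrizer_corner:
  fixes x :: "_ \<Rightarrow>\<^sub>0 'a::field_char_0"
  assumes lam: "lam \<turnstile> n" and x: "x \<in> group_algebra n"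
  shows "\<exists>k. young_symmetrizer lam \<star> x \<star> young_symmetrizer lam = pscale k (young_symmetrizer lam)"
proof -
  have "col_antisymmetrizer lam \<star> x \<star> row_symmetrizer lam \<in> group_algebra n"
    by (intro ga_mult_in_group_algebra symmetrizers_in_group_algebra[OF lam] x)
  from sandwich_multiple[OF lam this] show ?thesis by (simp add: young_symmetrizer_eq ga_mult_assoc)
qed

text \<open>
  The product is \<open>a\<^sub>\<lambda> b\<^sub>\<lambda> x a\<^sub>\<mu> b\<^sub>\<mu>\<close>. Different partitions cannot dominate each other both ways, so one
  of the sandwiches \<open>a\<^sub>\<lambda> (\<dots>) b\<^sub>\<mu>\<close> and \<open>b\<^sub>\<lambda> (\<dots>) a\<^sub>\<mu>\<close> vanishes identically.
\<close>

lemma young_symmetrizer_orthogonal: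
  fixes x :: "_ \<Rightarrow>\<^sub>0 'a::field_char_0"
  assumes lam: "lam \<turnstile> n" and mu: "mu \<turnstile> n" and "lam \<noteq> mu" and x: "x \<in> group_algebra n"
  shows "young_symmetrizer lam \<star> x \<star> young_symmetrizer mu = 0"
proof -
  let ?a = row_symmetrizer and ?b = col_antisymmetrizer
  obtain i where "sum_list (take i lam) \<noteq> sum_list (take i mu)"
    using partition_eqI[of lam mu] lam mu \<open>lam \<noteq> mu\<close> by (auto simp: is_partition_def)
  then consider "\<not> sum_list (take i lam) \<le> sum_list (take i mu)" | "\<not> sum_list (take i mu) \<le> sum_list (take i lam)"
    by linarith
  then have "?a lam \<star> (?b lam \<star> x \<star> ?a mu) \<star> ?b mu = 0"
  proof cases
    case 1
    have "?b lam \<star> x \<star> ?a mu \<in> group_algebra n"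
      by (intro ga_mult_in_group_algebra symmetrizers_in_group_algebra lam mu x)
    then show ?thesis
    proof (induction rule: group_algebra_induct)
      case (single g c)
      show ?case using 1 dominance[OF lam mu single] by (intro sandwich_eq_0[OF lam mu single]) blast
    qed (simp add: ga_mult_add)
  next
    case 2
    from x have "?b lam \<star> x \<star> ?a mu = 0"
    proof (induction rule: group_algebra_induct)
      case (single g c)
      have g: "inv g permutes {1..n}" "inv (inv g) = g"
        using permutes_inv[OF single] inv_inv_eq[OF permutes_bij[OF single]] by auto
      show ?case
        using 2 dominance[OF mu lam g(1)] sandwich_eq_0(2)[OF mu lam g(1), unfolded g(2)] by blast
    qed (simp add: ga_mult_add)
    then show ?thesis by (simp add: ga_mult_zero)
  qed
  then show ?thesis by (simp add: young_symmetrizer_eq ga_mult_assoc)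
qed

lemma young_symmetrizer_expand:
  "young_symmetrizer lam = (\<Sum>r\<in>row_stabilizer lam. \<Sum>c\<in>col_stabilizer lam. single (r \<circ> c) (of_int (sign c)))"
  by (simp add: young_symmetrizer_eq row_symmetrizer_def col_antisymmetrizer_def ga_mult_sum_left ga_mult_sum_right ga_mult_single)
    (rule sum.swap)

lemma lookup_young_symmetrizer_id: "lookup (young_symmetrizer lam) id = 1"
proof -
  have "r \<circ> c = id \<longleftrightarrow> r = id \<and> c = id" if "r \<in> row_stabilizer lam" "c \<in> col_stabilizer lam" for r c
  proof
    assume rc: "r \<circ> c = id"
    have p: "r permutes {1..sum_list lam}" using that(1) by (simp add: row_stabilizer_iff)
    have "c = inv r \<circ> (r \<circ> c)" using permutes_inv_o(2)[OF p] by (simp add: o_assoc)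
    then have "c = inv r" using rc by simp
    then have "c = id" using row_col_stabilizer_Int[of c lam] that inv_in_stabilizer by blast
    then show "r = id \<and> c = id" using rc by simp
  qed simp
  then have "lookup (young_symmetrizer lam) id =
    (\<Sum>r\<in>row_stabilizer lam. \<Sum>c\<in>col_stabilizer lam. if r = id \<and> c = id then 1 else 0)"
    unfolding young_symmetrizer_expand lookup_sum lookup_single
    by (intro sum.cong refl) (auto simp: when_def sign_id)
  also have "\<dots> = (\<Sum>r\<in>row_stabilizer lam. if r = id then 1 else 0)"
    by (intro sum.cong refl) (simp add: finite_stabilizer id_in_stabilizer)
  also have "\<dots> = 1" by (simp add: finite_stabilizer id_in_stabilizer)
  finally show ?thesis .
qed

lemma young_symmetrizer_nonzero: "young_symmetrizer lam \<noteq> (0 :: _ \<Rightarrow>\<^sub>0 'a::field)"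
  using lookup_young_symmetrizer_id[of lam, where 'a = 'a] by auto

lemma row_symmetrizer_square: "row_symmetrizer lam \<star> row_symmetrizer lam = pscale (of_nat (card (row_stabilizer lam))) (row_symmetrizer lam)"
proof -
  have "row_symmetrizer lam \<star> row_symmetrizer lam = (\<Sum>r\<in>row_stabilizer lam. perm_basis r \<star> row_symmetrizer lam)"
    by (subst row_symmetrizer_def) (simp add: ga_mult_sum_left)
  also have "\<dots> = (\<Sum>r\<in>row_stabilizer lam. row_symmetrizer lam)"
    by (intro sum.cong refl row_symmetrizer_absorb)
  also have "\<dots> = pscale (of_nat (card (row_stabilizer lam))) (row_symmetrizer lam)"
    by (rule poly_mapping_eqI) (simp add: lookup_sum)
  finally show ?thesis .
qed

text \<open>
  Let \<open>z = a b a\<close> with the row symmetrizer \<open>a\<close> and the column antisymmetrizer \<open>b\<close>. Its coefficients are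
  integers invariant under inversion of the group element, and the coefficient at the identity is
  positive. So the coefficient of \<open>z \<star> z\<close> at the identity is a nonzero sum of squares of integers,
  which is nonzero in characteristic zero. But \<open>z \<star> z\<close> is a multiple of \<open>(a b) (a b) a\<close>, which would
  vanish together with the square of \<open>a b\<close>.
\<close>

lemma young_symmetrizer_square_nonzero:
  fixes k :: "'a::field_char_0"
  assumes lam: "lam \<turnstile> n" and sq: "young_symmetrizer lam \<star> young_symmetrizer lam = pscale k (young_symmetrizer lam)"
  shows "k \<noteq> 0"
proof
  assume k: "k = 0"
  have n: "sum_list lam = n" using lam by (simp add: is_partition_def)
  let ?R = "row_stabilizer lam" and ?C = "col_stabilizer lam"
  let ?a = "row_symmetrizer lam :: _ \<Rightarrow>\<^sub>0 'a" and ?b = "col_antisymmetrizer lam :: _ \<Rightarrow>\<^sub>0 'a"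
  define z where "z = ?a \<star> ?b \<star> ?a"
  have zG: "z \<in> group_algebra n"
    unfolding z_def by (intro ga_mult_in_group_algebra symmetrizers_in_group_algebra[OF lam])
  define m where "m g = (\<Sum>r\<in>?R. \<Sum>c\<in>?C. \<Sum>r'\<in>?R. if r \<circ> c \<circ> r' = g then sign c else 0)" for g
  have z_lookup: "lookup z g = of_int (m g)" for g
  proof -
    have "z = (\<Sum>r\<in>?R. \<Sum>c\<in>?C. \<Sum>r'\<in>?R. single (r \<circ> c \<circ> r') (of_int (sign c)))"
      unfolding z_def young_symmetrizer_eq[symmetric] young_symmetrizer_expand ga_mult_sum_left
      unfolding row_symmetrizer_def ga_mult_sum_right ga_mult_single by simp
    then show ?thesis unfolding m_def by (auto simp: lookup_sum lookup_single when_def intro!: sum.cong)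
  qed
  have m_inv: "m (inv g) = m g" if g: "g permutes {1..n}" for g
  proof -
    let ?f = "\<lambda>r c r'. if r \<circ> c \<circ> r' = inv g then sign c else 0"
    have R: "sum f ?R = (\<Sum>r\<in>?R. f (inv r))" for f :: "_ \<Rightarrow> int"
      by (rule sum.reindex_bij_betw[OF bij_betw_row_stabilizer(3)[OF id_in_stabilizer(1)], symmetric])
    have C: "sum f ?C = (\<Sum>c\<in>?C. f (inv c))" for f :: "_ \<Rightarrow> int"
      by (rule sum.reindex_bij_betw[OF bij_betw_col_stabilizer(3)[OF id_in_stabilizer(2)], symmetric])
    have "m (inv g) = (\<Sum>r\<in>?R. \<Sum>c\<in>?C. \<Sum>r'\<in>?R. ?f (inv r) c r')"
      unfolding m_def by (rule R)
    also have "\<dots> = (\<Sum>r\<in>?R. \<Sum>c\<in>?C. \<Sum>r'\<in>?R. ?f (inv r) (inv c) r')"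
      by (intro sum.cong refl C)
    also have "\<dots> = (\<Sum>r\<in>?R. \<Sum>c\<in>?C. \<Sum>r'\<in>?R. ?f (inv r) (inv c) (inv r'))"
      by (intro sum.cong refl R)
    also have "\<dots> = (\<Sum>r\<in>?R. \<Sum>c\<in>?C. \<Sum>r'\<in>?R. if r' \<circ> c \<circ> r = g then sign c else 0)"
    proof (intro sum.cong refl)
      fix r c r' assume *: "r \<in> ?R" "c \<in> ?C" "r' \<in> ?R"
      then have bij: "bij r" "bij c" "bij r'" "bij g"
        using permutes_bij g by (auto simp: row_stabilizer_iff col_stabilizer_iff)
      have "inv r \<circ> inv c \<circ> inv r' = inv (r' \<circ> c \<circ> r)"
        using bij by (simp add: o_inv_distrib bij_comp o_assoc)
      moreover have "inv (r' \<circ> c \<circ> r) = inv g \<longleftrightarrow> r' \<circ> c \<circ> r = g"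
        using bij by (metis bij_comp inv_inv_eq)
      ultimately show "(if inv r \<circ> inv c \<circ> inv r' = inv g then sign (inv c) else 0) = (if r' \<circ> c \<circ> r = g then sign c else 0)"
        using col_stabilizer_permutation[OF *(2)] by (simp add: sign_inverse)
    qed
    also have "\<dots> = (\<Sum>r\<in>?R. \<Sum>r'\<in>?R. \<Sum>c\<in>?C. if r' \<circ> c \<circ> r = g then sign c else 0)"
      by (intro sum.cong refl sum.swap)
    also have "\<dots> = (\<Sum>r'\<in>?R. \<Sum>r\<in>?R. \<Sum>c\<in>?C. if r' \<circ> c \<circ> r = g then sign c else 0)"
      by (rule sum.swap)
    also have "\<dots> = m g"
      unfolding m_def by (intro sum.cong refl sum.swap)
    finally show ?thesis .
  qed
  have "z \<star> z = pscale (of_nat (card ?R)) (young_symmetrizer lam \<star> young_symmetrizer lam \<star> ?a)"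
    using row_symmetrizer_square[of lam, where 'a = 'a]
    by (simp add: z_def young_symmetrizer_eq ga_mult_assoc)
       (simp add: ga_mult_assoc[symmetric] ga_mult_pscale)
  then have "z \<star> z = 0" using sq k by (simp add: ga_mult_zero)
  then have "0 = (\<Sum>g | g permutes {1..n}. lookup z g * lookup z (inv g))"
    using lookup_ga_mult_id[OF zG zG] by simp
  also have "\<dots> = of_int (\<Sum>g | g permutes {1..n}. (m g)\<^sup>2)"
    by (auto simp: z_lookup m_inv power2_eq_square intro!: sum.cong)
  finally have "(\<Sum>g | g permutes {1..n}. (m g)\<^sup>2) = 0" by (metis of_int_eq_0_iff)
  then have "\<forall>g\<in>{g. g permutes {1..n}}. (m g)\<^sup>2 = 0"
    by (subst (asm) sum_nonneg_eq_0_iff) (auto simp: finite_permutations)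
  then have "m id = 0" by (auto simp: permutes_id)
  moreover have "m id > 0"
  proof -
    define F where "F r c r' = (if r \<circ> c \<circ> r' = id then sign c else 0)" for r c r' :: "nat \<Rightarrow> nat"
    (* a triple with product id has its column permutation in both stabilizers, so it is the
       identity *)
    have nonneg: "0 \<le> F r c r'" if "r \<in> ?R" "c \<in> ?C" "r' \<in> ?R" for r c r'
    proof (cases "r \<circ> c \<circ> r' = id")
      case True
      have p: "r permutes {1..n}" "r' permutes {1..n}" using that n by (auto simp: row_stabilizer_iff)
      have "c = inv r \<circ> (r \<circ> c \<circ> r') \<circ> inv r'"
        using permutes_inv_o(1)[OF p(2)] permutes_inv_o(2)[OF p(1)]
        by (metis comp_id fun.map_comp id_comp)
      then have "c = inv r \<circ> inv r'" using True by simp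
      then have "c \<in> ?R" using that by (simp add: comp_in_stabilizer inv_in_stabilizer)
      then have "c = id" using row_col_stabilizer_Int that by blast
      then show ?thesis by (simp add: F_def sign_id)
    qed (simp add: F_def)
    have "1 = F id id id" by (simp add: F_def sign_id)
    also have "\<dots> \<le> (\<Sum>r'\<in>?R. F id id r')"
      by (rule member_le_sum[OF id_in_stabilizer(1)]) (blast intro: nonneg id_in_stabilizer finite_stabilizer)+
    also have "\<dots> \<le> (\<Sum>c\<in>?C. \<Sum>r'\<in>?R. F id c r')"
      by (rule member_le_sum[OF id_in_stabilizer(2), where f = "\<lambda>c. \<Sum>r'\<in>?R. F id c r'"])
         (blast intro: sum_nonneg nonneg id_in_stabilizer finite_stabilizer)+
    also have "\<dots> \<le> (\<Sum>r\<in>?R. \<Sum>c\<in>?C. \<Sum>r'\<in>?R. F r c r')"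
      by (rule member_le_sum[OF id_in_stabilizer(1), where f = "\<lambda>r. \<Sum>c\<in>?C. \<Sum>r'\<in>?R. F r c r'"])
         (blast intro: sum_nonneg nonneg id_in_stabilizer finite_stabilizer)+
    also have "\<dots> = m id" by (simp add: m_def F_def)
    finally show ?thesis by simp
  qed
  ultimately show False by simp
qed

text \<open>
  This is \<open>n!\<close> divided by the degree of the irreducible character.
\<close>

definition symmetrizer_scalar :: "nat list \<Rightarrow> 'a::field_char_0" where
  "symmetrizer_scalar lam = (THE k. young_symmetrizer lam \<star> young_symmetrizer lam = pscale k (young_symmetrizer lam))"

lemma pscale_cancel_young: "pscale k (young_symmetrizer lam) = pscale l (young_symmetrizer lam) \<Longrightarrow> k = l"
  using young_symmetrizer_nonzero pscale.scale_cancel_right by blast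

lemma young_symmetrizer_square:
  assumes lam: "lam \<turnstile> n"
  shows "young_symmetrizer lam \<star> young_symmetrizer lam = pscale (symmetrizer_scalar lam :: 'a::field_char_0) (young_symmetrizer lam)"
    (is "?e \<star> ?e = _")
    "symmetrizer_scalar lam \<noteq> (0 :: 'a)"
proof -
  have "\<exists>k. ?e \<star> perm_basis id \<star> ?e = pscale k ?e"
    by (rule young_symmetrizer_corner[OF lam]) (rule single_in_group_algebra[OF permutes_id])
  then obtain k where k: "?e \<star> ?e = pscale k ?e" by auto
  then have "symmetrizer_scalar lam = k"
    unfolding symmetrizer_scalar_def by (intro the_equality) (auto intro: pscale_cancel_young)
  then show "?e \<star> ?e = pscale (symmetrizer_scalar lam) ?e" using k by simp
  then show "symmetrizer_scalar lam \<noteq> (0 :: 'a)" by (rule young_symmetrizer_square_nonzero[OF lam])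
qed

lemma symmetrizer_scalar_eqI:
  "young_symmetrizer lam \<star> young_symmetrizer lam = pscale k (young_symmetrizer lam) \<Longrightarrow> symmetrizer_scalar lam = k"
  unfolding symmetrizer_scalar_def by (intro the_equality) (auto intro: pscale_cancel_young)

section \<open>Irreducible characters are dual to Young symmetrizers\<close>

lemma irreducible_module_subset:
  assumes "lam \<turnstile> n"
  shows "irreducible_module lam \<subseteq> group_algebra n"
proof -
  have "sum_list lam = n" using assms by (simp add: is_partition_def)
  then show ?thesis
    unfolding irreducible_module_def using ga_mult_in_group_algebra symmetrizers_in_group_algebra(3)[OF assms] by auto
qed

lemma subspace_irreducible_module: "pscale.subspace (irreducible_module lam)"
proof -
  let ?n = "sum_list lam"
  have "irreducible_module lam = (\<lambda>x. x \<star> young_symmetrizer lam) ` group_algebra ?n"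
    by (auto simp: irreducible_module_def)
  moreover have "Vector_Spaces.linear pscale pscale (\<lambda>x :: _ \<Rightarrow>\<^sub>0 'a. x \<star> young_symmetrizer lam)"
    by (simp add: Vector_Spaces.linear_iff pscale.vector_space_axioms ga_mult_add ga_mult_pscale)
  then interpret l: Vector_Spaces.linear pscale pscale "\<lambda>x :: _ \<Rightarrow>\<^sub>0 'a. x \<star> young_symmetrizer lam" .
  show ?thesis using l.subspace_image[OF subspace_group_algebra] calculation by metis
qed

lemma ga_mult_irreducible_module:
  assumes "lam \<turnstile> n" "x \<in> group_algebra n" "w \<in> irreducible_module lam"
  shows "x \<star> w \<in> irreducible_module lam"
proof -
  have n: "sum_list lam = n" using assms by (simp add: is_partition_def)
  obtain y where "y \<in> group_algebra n" "w = y \<star> young_symmetrizer lam"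
    using assms n by (auto simp: irreducible_module_def)
  then show ?thesis
    using ga_mult_in_group_algebra[OF assms(2)] unfolding irreducible_module_def n
    by (auto simp: ga_mult_assoc)
qed

lemma young_symmetrizer_in_irreducible_module: "young_symmetrizer lam \<in> irreducible_module lam"
  unfolding irreducible_module_def
  using ga_mult_id(1) single_in_group_algebra[OF permutes_id] by (metis (mono_tags, lifting) mem_Collect_eq)

lemma ex_dual_basis_irreducible_module:
  assumes "lam \<turnstile> n"
  shows "\<exists>(B :: (_ \<Rightarrow>\<^sub>0 'a::field_char_0) set) \<phi>. dual_basis_mod pscale (irreducible_module lam) {0} B (\<lambda>b. b) \<phi>"
proof (rule pscale.ex_dual_basis[OF subspace_irreducible_module])
  show "finite ((perm_basis :: _ \<Rightarrow> _ \<Rightarrow>\<^sub>0 'a) ` {g. g permutes {1..n}})"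
    by (simp add: finite_permutations)
  show "irreducible_module lam \<subseteq> pscale.span ((perm_basis :: _ \<Rightarrow> _ \<Rightarrow>\<^sub>0 'a) ` {g. g permutes {1..n}})"
    using irreducible_module_subset[OF assms] group_algebra_subset_span by blast
qed

text \<open>
  The trace of the action of an arbitrary element of the group algebra, not only of a permutation.
\<close>

lemma linear_extension_character:
  fixes B :: "((nat \<Rightarrow> nat) \<Rightarrow>\<^sub>0 'a::field_char_0) set"
  assumes lam: "lam \<turnstile> n" and D: "dual_basis_mod pscale (irreducible_module lam) {0} B (\<lambda>b. b) \<phi>"
    and x: "x \<in> group_algebra n"
  shows "linear_extension (irreducible_character lam) x = (\<Sum>b\<in>B. \<phi> b (x \<star> b))"
proof -
  interpret D: dual_basis_mod pscale "irreducible_module lam" "{0}" B "\<lambda>b. b" \<phi> by (rule D)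
  from x show ?thesis
  proof (induction rule: group_algebra_induct)
    case (single g c)
    have "irreducible_character lam g = (\<Sum>b\<in>B. \<phi> b (perm_basis g \<star> b))"
      unfolding irreducible_character_def
      using ga_mult_irreducible_module[OF lam single_in_group_algebra[OF single]]
      by (intro D.trace_mod_eq linear_ga_mult) (auto simp: ga_mult_zero)
    moreover have "\<phi> b (single g c \<star> b) = c * \<phi> b (perm_basis g \<star> b)" if "b \<in> B" for b
    proof -
      interpret l: Vector_Spaces.linear pscale "(*)" "\<phi> b" by (rule D.linear_\<phi>[OF that])
      have "single g c \<star> b = pscale c (perm_basis g \<star> b)"
        by (simp add: ga_mult_pscale(1)[symmetric] pscale_single)
      then show ?thesis by (simp add: l.scale)
    qed
    ultimately show ?case by (simp add: linear_extension_single sum_distrib_left)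
  next
    case (add x y)
    have "\<phi> b ((x + y) \<star> b) = \<phi> b (x \<star> b) + \<phi> b (y \<star> b)" if "b \<in> B" for b
    proof -
      interpret l: Vector_Spaces.linear pscale "(*)" "\<phi> b" by (rule D.linear_\<phi>[OF that])
      show ?thesis by (simp add: ga_mult_add l.add)
    qed
    then show ?case using add by (simp add: linear_extension_add sum.distrib)
  qed
qed

text \<open>
  On the left ideal generated by \<open>e\<^sub>\<mu>\<close> the element \<open>e\<^sub>\<lambda>\<close> acts as zero if \<open>\<lambda> \<noteq> \<mu>\<close>. If \<open>\<lambda> = \<mu>\<close> it acts as
  \<open>w \<mapsto> \<psi>(w) e\<^sub>\<lambda>\<close>, which has rank one and trace \<open>\<psi>(e\<^sub>\<lambda>)\<close>, the scalar in \<open>e\<^sub>\<lambda>\<^sup>2 = c\<^sub>\<lambda> e\<^sub>\<lambda>\<close>.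
\<close>

lemma character_young_symmetrizer:
  assumes lam: "lam \<turnstile> n" and mu: "mu \<turnstile> n"
  shows "linear_extension (irreducible_character mu) (young_symmetrizer lam) =
    (if lam = mu then symmetrizer_scalar lam else (0 :: 'a::field_char_0))"
proof -
  obtain B :: "((nat \<Rightarrow> nat) \<Rightarrow>\<^sub>0 'a) set" and \<phi>
    where D: "dual_basis_mod pscale (irreducible_module mu) {0} B (\<lambda>b. b) \<phi>"
    using ex_dual_basis_irreducible_module[OF mu] by blast
  interpret D: dual_basis_mod pscale "irreducible_module mu" "{0}" B "\<lambda>b. b" \<phi> by (rule D)
  have n: "sum_list mu = n" using mu by (simp add: is_partition_def)
  let ?e = "young_symmetrizer lam :: _ \<Rightarrow>\<^sub>0 'a"
  have *: "linear_extension (irreducible_character mu) ?e = (\<Sum>b\<in>B. \<phi> b (?e \<star> b))"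
    by (rule linear_extension_character[OF mu D]) (rule symmetrizers_in_group_algebra[OF lam])
  show ?thesis
  proof (cases "lam = mu")
    case False
    have "?e \<star> b = 0" if b: "b \<in> B" for b
    proof -
      obtain x where "x \<in> group_algebra n" "b = x \<star> young_symmetrizer mu"
        using D.v_in[OF b] by (auto simp: irreducible_module_def n)
      then show ?thesis using young_symmetrizer_orthogonal[OF lam mu False] by (simp add: ga_mult_assoc)
    qed
    moreover have "\<phi> b 0 = 0" if "b \<in> B" for b
      using D.in_U_iff[of 0] D.subspace_W pscale.subspace_0 that by blast
    ultimately show ?thesis using False * by simp
  next
    case True
    have "\<exists>k. ?e \<star> w = pscale k ?e" if w: "w \<in> irreducible_module mu" for w
    proof -
      obtain x where x: "x \<in> group_algebra n" "w = x \<star> ?e"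
        using w by (auto simp: irreducible_module_def n True)
      then show ?thesis using young_symmetrizer_corner[OF lam x(1)] by (simp add: ga_mult_assoc)
    qed
    then obtain \<psi> where \<psi>: "?e \<star> w = pscale (\<psi> w) ?e" if "w \<in> irreducible_module mu" for w by metis
    have eW: "?e \<in> irreducible_module mu" using young_symmetrizer_in_irreducible_module True by blast
    have "(\<Sum>b\<in>B. \<phi> b (?e \<star> b)) = (\<Sum>b\<in>B. \<psi> b * \<phi> b ?e)"
    proof (intro sum.cong refl)
      fix b assume b: "b \<in> B"
      interpret l: Vector_Spaces.linear pscale "(*)" "\<phi> b" by (rule D.linear_\<phi>[OF b])
      show "\<phi> b (?e \<star> b) = \<psi> b * \<phi> b ?e" using \<psi>[OF D.v_in[OF b]] by (simp add: l.scale)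
    qed
    also have "\<dots> = symmetrizer_scalar lam"
    proof (rule pscale_cancel_young)
      have "?e = (\<Sum>b\<in>B. pscale (\<phi> b ?e) b)" using D.expansion[OF eW] by simp
      then have "?e \<star> ?e = (\<Sum>b\<in>B. pscale (\<phi> b ?e) (?e \<star> b))"
        by (metis (mono_tags, lifting) ga_mult_pscale(2) ga_mult_sum_right sum.cong)
      also have "\<dots> = pscale (\<Sum>b\<in>B. \<psi> b * \<phi> b ?e) ?e"
        using \<psi>[OF D.v_in] by (simp add: pscale.scale_sum_left mult.commute)
      finally show "pscale (\<Sum>b\<in>B. \<psi> b * \<phi> b ?e) ?e = pscale (symmetrizer_scalar lam) ?e"
        using young_symmetrizer_square(1)[OF lam, where 'a = 'a] by (rule trans[OF sym])
    qed
    finally show ?thesis using * True by simp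
  qed
qed

definition class_function :: "nat \<Rightarrow> ((nat \<Rightarrow> nat) \<Rightarrow> 'a) \<Rightarrow> bool" where
  "class_function n f \<longleftrightarrow> (\<forall>\<sigma> \<tau>. \<sigma> permutes {1..n} \<longrightarrow> \<tau> permutes {1..n} \<longrightarrow> f (\<tau> \<circ> \<sigma> \<circ> inv \<tau>) = f \<sigma>)"

lemma class_function_irreducible_character:
  assumes lam: "lam \<turnstile> n"
  shows "class_function n (irreducible_character lam :: _ \<Rightarrow> 'a::field_char_0)"
  unfolding class_function_def
proof (intro allI impI)
  fix \<sigma> \<tau> assume \<sigma>: "\<sigma> permutes {1..n}" and \<tau>: "\<tau> permutes {1..n}"
  obtain B :: "((nat \<Rightarrow> nat) \<Rightarrow>\<^sub>0 'a) set" and \<phi>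
    where D: "dual_basis_mod pscale (irreducible_module lam) {0} B (\<lambda>b. b) \<phi>"
    using ex_dual_basis_irreducible_module[OF lam] by blast
  interpret D: dual_basis_mod pscale "irreducible_module lam" "{0}" B "\<lambda>b. b" \<phi> by (rule D)
  define f where "f = ga_mult (perm_basis (\<tau> \<circ> \<sigma>) :: _ \<Rightarrow>\<^sub>0 'a)"
  define g where "g = ga_mult (perm_basis (inv \<tau>) :: _ \<Rightarrow>\<^sub>0 'a)"
  have inv: "inv \<tau> \<circ> \<tau> = id" using permutes_inv_o[OF \<tau>] by simp
  have fg: "f \<circ> g = ga_mult (perm_basis (\<tau> \<circ> \<sigma> \<circ> inv \<tau>))"
    by (simp add: f_def g_def fun_eq_iff ga_mult_assoc ga_mult_single)
  have gf: "g \<circ> f = ga_mult (perm_basis \<sigma>)"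
    by (simp add: f_def g_def fun_eq_iff ga_mult_assoc ga_mult_single o_assoc inv)
  have stable: "ga_mult (perm_basis \<rho>) ` irreducible_module lam \<subseteq> (irreducible_module lam :: (_ \<Rightarrow>\<^sub>0 'a) set)"
    if "\<rho> permutes {1..n}" for \<rho>
    using ga_mult_irreducible_module[OF lam single_in_group_algebra[OF that]] by blast
  have "trace_mod pscale (irreducible_module lam) {0} (f \<circ> g) = trace_mod pscale (irreducible_module lam) {0} (g \<circ> f)"
    unfolding f_def g_def
    by (intro D.trace_mod_conjugate linear_ga_mult stable permutes_inv[OF \<tau>] permutes_compose[OF \<sigma> \<tau>])
       (simp_all add: ga_mult_zero)
  then show "irreducible_character lam (\<tau> \<circ> \<sigma> \<circ> inv \<tau>) = (irreducible_character lam \<sigma> :: 'a)"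
    unfolding irreducible_character_def fg gf .
qed

section \<open>Irreducible characters span the class functions\<close>

text \<open>
  All cycles are listed, fixed points included, so that the lengths form a partition of the number of
  points.
\<close>

definition cycle_notation :: "(nat \<Rightarrow> nat) \<Rightarrow> nat list list \<Rightarrow> bool" where
  "cycle_notation \<sigma> css \<longleftrightarrow> distinct (concat css) \<and> [] \<notin> set css \<and>
     (\<forall>c\<in>set css. \<forall>i<length c. \<sigma> (c ! i) = c ! (Suc i mod length c))"

lemma cycle_decomp_notation:
  assumes "cycle_decomp I p"
  shows "p permutes I \<and> (\<exists>css. set (concat css) = I \<and> cycle_notation p css)"
  using assms
proof induction
  case empty
  show ?case by (intro conjI exI[of _ "[]"] permutes_id) (simp_all add: cycle_notation_def)
next
  case (comp I p cs)
  then obtain css where css: "set (concat css) = I" "cycle_notation p css" and p: "p permutes I" by blast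
  have perm: "(cycle_of_list cs \<circ> p) permutes (set cs \<union> I)"
    by (rule permutes_compose[OF permutes_subset[OF p] permutes_subset[OF cycle_permutes]]) auto
  show ?case
  proof (cases "cs = []")
    case True
    then show ?thesis using css p by auto
  next
    case False
    have "(cycle_of_list cs \<circ> p) (c ! i) = c ! (Suc i mod length c)"
      if c: "c \<in> set (cs # css)" and i: "i < length c" for c i
    proof (cases "c = cs")
      case True
      have "p (cs ! i) = cs ! i"
        using comp(3) i True by (intro permutes_not_in[OF p]) (auto dest: nth_mem)
      moreover have "map (cycle_of_list cs) cs = rotate1 cs"
        using cyclic_rotation[OF comp(2), of 1] by simp
      then have "cycle_of_list cs (cs ! i) = rotate1 cs ! i" using i True by (metis nth_map)
      ultimately show ?thesis using i True by (simp add: nth_rotate1)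
    next
      case False
      then have c': "c \<in> set css" using c by simp
      then have "p (c ! i) = c ! (Suc i mod length c)" using css(2) i by (simp add: cycle_notation_def)
      moreover have "c ! (Suc i mod length c) \<in> set c" using i by (intro nth_mem) (auto intro: mod_less_divisor)
      then have "c ! (Suc i mod length c) \<notin> set cs" using comp(3) css(1) c' by auto
      ultimately show ?thesis by (simp add: id_outside_supp)
    qed
    then have "cycle_notation (cycle_of_list cs \<circ> p) (cs # css)"
      using css comp(2,3) False by (auto simp: cycle_notation_def)
    moreover have "set (concat (cs # css)) = set cs \<union> I" using css by simp
    ultimately show ?thesis using perm by blast
  qed
qed

definition has_cycle_type :: "nat \<Rightarrow> (nat \<Rightarrow> nat) \<Rightarrow> nat list \<Rightarrow> bool" where
  "has_cycle_type n \<sigma> lam \<longleftrightarrow> (\<exists>css. cycle_notation \<sigma> css \<and> set (concat css) = {1..n} \<and> lam = map length css)"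

lemma ex_cycle_type:
  assumes "\<sigma> permutes {1..n}"
  shows "\<exists>lam. lam \<turnstile> n \<and> has_cycle_type n \<sigma> lam"
proof -
  obtain css where css: "set (concat css) = {1..n}" "cycle_notation \<sigma> css"
    using cycle_decomp_notation[OF cycle_decomposition[OF assms]] by auto
  define css' where "css' = rev (sort_key length css)"
  have mset: "mset css' = mset css" by (simp add: css'_def)
  then have set: "set css' = set css" by (metis set_mset_mset)
  have "mset (concat css') = mset (concat css)"
    unfolding mset_concat by (metis mset mset_map sum_mset_sum_list)
  then have "distinct (concat css') \<longleftrightarrow> distinct (concat css)" by (rule mset_eq_imp_distinct_iff)
  then have not': "cycle_notation \<sigma> css'" using css(2) set by (simp add: cycle_notation_def)
  have set': "set (concat css') = {1..n}" using css(1) set by simp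
  have "sum_list (map length css') = length (concat css')" by (simp add: length_concat)
  also have "\<dots> = card {1..n}"
    using not' set' distinct_card by (metis cycle_notation_def)
  finally have "sum_list (map length css') = n" by simp
  moreover have "sorted_wrt (\<ge>) (map length css')"
    unfolding css'_def rev_map[symmetric] sorted_wrt_rev by simp
  ultimately have "map length css' \<turnstile> n"
    using not' by (auto simp: is_partition_def cycle_notation_def)
  then show ?thesis using not' set' by (auto simp: has_cycle_type_def)
qed

text \<open>
  Position \<open>i\<close> of the \<open>a\<close>-th list sits at the same place of the concatenation for all families of lists
  with the same lengths.
\<close>

lemma nth_concat_same_lengths:
  assumes "map length xss = map length yss" "a < length xss" "i < length (xss ! a)"
  shows "\<exists>k<length (concat xss). concat xss ! k = xss ! a ! i \<and> concat yss ! k = yss ! a ! i"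
  using assms
proof (induction xss arbitrary: yss a)
  case (Cons xs xss)
  then obtain ys yss' where yss: "yss = ys # yss'" "length xs = length ys" "map length xss = map length yss'"
    by (cases yss) auto
  show ?case
  proof (cases a)
    case 0
    then show ?thesis using Cons.prems yss by (intro exI[of _ i]) (auto simp: nth_append)
  next
    case (Suc b)
    then obtain k where "k < length (concat xss)" "concat xss ! k = xss ! b ! i" "concat yss' ! k = yss' ! b ! i"
      using Cons.IH[OF yss(3), of b] Cons.prems by auto
    then show ?thesis using Suc yss by (intro exI[of _ "length xs + k"]) (auto simp: nth_append)
  qed
qed simp

text \<open>
  Writing the cycle notations of the two permutations below each other gives the conjugating
  permutation.
\<close>

lemma same_cycle_type_conjugate:
  assumes \<sigma>: "\<sigma> permutes {1..n}" "has_cycle_type n \<sigma> lam" and \<sigma>': "\<sigma>' permutes {1..n}" "has_cycle_type n \<sigma>' lam"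
  shows "\<exists>\<pi>. \<pi> permutes {1..n} \<and> \<sigma>' = \<pi> \<circ> \<sigma> \<circ> inv \<pi>"
proof -
  obtain css where css: "cycle_notation \<sigma> css" "set (concat css) = {1..n}" "lam = map length css"
    using \<sigma>(2) by (auto simp: has_cycle_type_def)
  obtain css' where css': "cycle_notation \<sigma>' css'" "set (concat css') = {1..n}" "lam = map length css'"
    using \<sigma>'(2) by (auto simp: has_cycle_type_def)
  let ?L = "concat css" and ?L' = "concat css'"
  have len: "length ?L = n" "length ?L' = n"
    using css css' distinct_card unfolding cycle_notation_def by (metis card_atLeastAtMost diff_Suc_1)+
  have bij: "bij_betw ((!) ?L) {..<n} {1..n}" "bij_betw ((!) ?L') {..<n} {1..n}"
    using bij_betw_nth[of ?L "{..<n}" "{1..n}"] bij_betw_nth[of ?L' "{..<n}" "{1..n}"] css css' len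
    by (auto simp: cycle_notation_def)
  define \<pi> where "\<pi> x = (if x \<in> {1..n} then ?L' ! the_inv_into {..<n} ((!) ?L) x else x)" for x
  have "bij_betw ((!) ?L' \<circ> the_inv_into {..<n} ((!) ?L)) {1..n} {1..n}"
    using bij_betw_trans[OF bij_betw_the_inv_into[OF bij(1)] bij(2)] .
  then have "bij_betw \<pi> {1..n} {1..n}"
    by (rule iffD1[OF bij_betw_cong, rotated]) (simp add: \<pi>_def)
  then have \<pi>: "\<pi> permutes {1..n}" by (rule bij_imp_permutes) (auto simp: \<pi>_def)
  have \<pi>_L: "\<pi> (?L ! k) = ?L' ! k" if "k < n" for k
    using that bij_betwE[OF bij(1)] the_inv_into_f_f[OF bij_betw_imp_inj_on[OF bij(1)], of k] by (simp add: \<pi>_def)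
  have \<pi>_css: "\<pi> (css ! a ! i) = css' ! a ! i" if "a < length css" "i < length (css ! a)" for a i
    using nth_concat_same_lengths[of css css' a i] css(3) css'(3) that \<pi>_L len by metis
  have "\<pi> (\<sigma> x) = \<sigma>' (\<pi> x)" for x
  proof (cases "x \<in> {1..n}")
    case True
    then obtain a i where ai: "a < length css" "i < length (css ! a)" "x = css ! a ! i"
      unfolding css(2)[symmetric] by (auto simp: in_set_conv_nth)
    have len_eq: "length css = length css'" "length (css ! a) = length (css' ! a)"
      using css(3) css'(3) ai(1) by (metis length_map, metis length_map nth_map)
    have "Suc i mod length (css ! a) < length (css ! a)" using ai by (intro mod_less_divisor) auto
    then show ?thesis
      using ai css(1) css'(1) len_eq by (simp add: cycle_notation_def \<pi>_css)
  next
    case False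
    then show ?thesis using permutes_not_in[OF \<sigma>(1)] permutes_not_in[OF \<sigma>'(1)] permutes_not_in[OF \<pi>] by simp
  qed
  then have eq: "\<pi> \<circ> \<sigma> = \<sigma>' \<circ> \<pi>" by (simp add: fun_eq_iff)
  have "\<pi> \<circ> \<sigma> \<circ> inv \<pi> = \<sigma>'" unfolding eq using permutes_inv_o(1)[OF \<pi>] by (simp add: o_assoc[symmetric])
  then show ?thesis using \<pi> by blast
qed

text \<open>
  Independent vectors in a span of no more generators than vectors already generate it.
\<close>

lemma (in vector_space) span_subset_of_card_le:
  assumes "independent S" "finite T" "S \<subseteq> span T" "card T \<le> card S"
  shows "span T \<subseteq> span S"
proof (rule span_minimal)
  show "T \<subseteq> span S"
  proof (rule ccontr)
    assume "\<not> T \<subseteq> span S"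
    then obtain x where x: "x \<in> T" "x \<notin> span S" by blast
    then have "independent (insert x S)" using assms(1) by (simp add: independent_insert)
    moreover have "insert x S \<subseteq> span T" using assms(3) x(1) span_base by blast
    ultimately have "finite (insert x S) \<and> card (insert x S) \<le> card T"
      by (rule independent_span_bound[OF assms(2)])
    moreover have "x \<notin> S" using x(2) span_base by blast
    ultimately show False using assms(4) by auto
  qed
qed (rule subspace_span)

text \<open>
  A function on permutations as a vector. Functions that agree on the symmetric group give the same
  vector, whatever their values at other maps.
\<close>

definition perm_vector :: "nat \<Rightarrow> ((nat \<Rightarrow> nat) \<Rightarrow> 'a::field) \<Rightarrow> ((nat \<Rightarrow> nat) \<Rightarrow>\<^sub>0 'a)" where
  "perm_vector n f = (\<Sum>\<sigma> | \<sigma> permutes {1..n}. single \<sigma> (f \<sigma>))"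

lemma lookup_perm_vector: "lookup (perm_vector n f) \<sigma> = (if \<sigma> permutes {1..n} then f \<sigma> else 0)"
  by (auto simp: perm_vector_def lookup_sum lookup_single when_def finite_permutations)

lemma linear_extension_perm_vector:
  assumes "x \<in> group_algebra n"
  shows "linear_extension (lookup x) (perm_vector n f) = linear_extension f x"
proof -
  let ?P = "{\<sigma>. \<sigma> permutes {1..n}}"
  have fin: "finite ?P" by (simp add: finite_permutations)
  have "keys (perm_vector n f) \<subseteq> ?P"
    by (auto simp: in_keys_iff lookup_perm_vector split: if_splits)
  then have "linear_extension (lookup x) (perm_vector n f) = (\<Sum>\<sigma>\<in>?P. f \<sigma> * lookup x \<sigma>)"
    by (subst linear_extension_superset[OF fin]) (auto simp: lookup_perm_vector)
  also have "\<dots> = linear_extension f x"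
    using assms by (subst linear_extension_superset[OF fin]) (auto simp: group_algebra_def mult.commute)
  finally show ?thesis .
qed

text \<open>
  The indicators of the cycle types (the set \<open>T\<close>) span the class functions. By duality with the Young
  symmetrizers the irreducible characters are linearly independent, and there are at least as many of
  them as elements of \<open>T\<close>; so they span the class functions too. Evaluation at the Young symmetrizers
  (the forms \<open>L\<close>) gives the coefficients.
\<close>

theorem class_function_expansion:
  fixes f :: "(nat \<Rightarrow> nat) \<Rightarrow> 'a::field_char_0"
  assumes f: "class_function n f" and \<sigma>: "\<sigma> permutes {1..n}"
  shows "f \<sigma> = (\<Sum>lam | lam \<turnstile> n.
    linear_extension f (young_symmetrizer lam) / symmetrizer_scalar lam * irreducible_character lam \<sigma>)"
proof -
  let ?P = "{lam. lam \<turnstile> n}"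
  define ctype where "ctype \<sigma> = (SOME lam. lam \<turnstile> n \<and> has_cycle_type n \<sigma> lam)" for \<sigma>
  have ctype: "ctype \<sigma> \<turnstile> n" "has_cycle_type n \<sigma> (ctype \<sigma>)" if "\<sigma> permutes {1..n}" for \<sigma>
    using someI_ex[OF ex_cycle_type[OF that]] by (simp_all add: ctype_def)
  define T where "T = (\<lambda>lam. perm_vector n (\<lambda>\<sigma>. if ctype \<sigma> = lam then 1 else 0 :: 'a)) ` ?P"
  define chi where "chi lam = perm_vector n (irreducible_character lam :: _ \<Rightarrow> 'a)" for lam
  define L where "L lam = linear_extension (lookup (young_symmetrizer lam :: _ \<Rightarrow>\<^sub>0 'a))" for lam
  have L_chi: "L lam (chi mu) = (if lam = mu then symmetrizer_scalar lam else 0)" if "lam \<turnstile> n" "mu \<turnstile> n" for lam mu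
    unfolding L_def chi_def
    by (simp add: linear_extension_perm_vector[OF symmetrizers_in_group_algebra(3)[OF that(1)]]
        character_young_symmetrizer[OF that])
  have L_sum: "L lam (\<Sum>x\<in>X. pscale (c x) (g x)) = (\<Sum>x\<in>X. c x * L lam (g x))" for lam X c and g :: "'x \<Rightarrow> _"
    by (simp add: L_def linear_extension_sum linear_extension_pscale)
  have fin: "finite ?P" by (rule finite_partitions)
  have finT: "finite T" unfolding T_def using fin by simp
  have inj: "inj_on chi ?P"
  proof (rule inj_onI)
    fix lam mu assume *: "lam \<in> ?P" "mu \<in> ?P" "chi lam = chi mu"
    then have "L lam (chi mu) = symmetrizer_scalar lam" using L_chi[of lam lam] by simp
    then show "lam = mu" using * L_chi[of lam mu] young_symmetrizer_square(2)[of lam n, where 'a = 'a] by (auto split: if_splits)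
  qed
  have ind: "pscale.independent (chi ` ?P)"
  proof (rule pscale.independent_if_scalars_zero)
    fix a x assume sum: "(\<Sum>y\<in>chi ` ?P. pscale (a y) y) = 0" and "x \<in> chi ` ?P"
    then obtain mu where mu: "mu \<turnstile> n" "x = chi mu" by blast
    have "0 = L mu (\<Sum>lam\<in>?P. pscale (a (chi lam)) (chi lam))"
      using sum by (simp add: sum.reindex[OF inj] L_def linear_extension_def)
    also have "\<dots> = (\<Sum>lam\<in>?P. if lam = mu then a (chi lam) * symmetrizer_scalar lam else 0)"
      unfolding L_sum using mu(1) by (intro sum.cong refl) (auto simp: L_chi)
    also have "\<dots> = a x * symmetrizer_scalar mu" using mu fin by simp
    finally show "a x = 0" using young_symmetrizer_square(2)[OF mu(1), where 'a = 'a] by simp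
  qed (use fin in simp)
  have span_T: "perm_vector n g \<in> pscale.span T" if g: "class_function n g" for g :: "_ \<Rightarrow> 'a"
  proof -
    define r where "r lam = (SOME \<sigma>. \<sigma> permutes {1..n} \<and> ctype \<sigma> = lam)" for lam
    have g_r: "g \<sigma> = g (r (ctype \<sigma>))" if \<sigma>: "\<sigma> permutes {1..n}" for \<sigma>
    proof -
      have r: "r (ctype \<sigma>) permutes {1..n}" "ctype (r (ctype \<sigma>)) = ctype \<sigma>"
        using someI[of "\<lambda>\<tau>. \<tau> permutes {1..n} \<and> ctype \<tau> = ctype \<sigma>" \<sigma>] \<sigma> by (simp_all add: r_def)
      then obtain \<pi> where "\<pi> permutes {1..n}" "\<sigma> = \<pi> \<circ> r (ctype \<sigma>) \<circ> inv \<pi>"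
        using same_cycle_type_conjugate[OF r(1) _ \<sigma> ctype(2)[OF \<sigma>]] ctype(2)[OF r(1)] by auto
      then show ?thesis using g r(1) unfolding class_function_def by metis
    qed
    have "perm_vector n g = (\<Sum>lam\<in>?P. pscale (g (r lam)) (perm_vector n (\<lambda>\<sigma>. if ctype \<sigma> = lam then 1 else 0)))"
    proof (rule poly_mapping_eqI)
      fix \<sigma>
      show "lookup (perm_vector n g) \<sigma> = lookup
          (\<Sum>lam\<in>?P. pscale (g (r lam)) (perm_vector n (\<lambda>\<sigma>. if ctype \<sigma> = lam then 1 else 0))) \<sigma>"
      proof (cases "\<sigma> permutes {1..n}")
        case True
        have "(\<Sum>lam\<in>?P. g (r lam) * (if ctype \<sigma> = lam then 1 else 0)) = (\<Sum>lam\<in>?P. if lam = ctype \<sigma> then g (r lam) else 0)"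
          by (intro sum.cong) auto
        also have "\<dots> = g \<sigma>" using fin ctype(1)[OF True] g_r[OF True] by simp
        finally show ?thesis using True by (simp add: lookup_sum lookup_perm_vector)
      qed (simp add: lookup_sum lookup_perm_vector)
    qed
    also have "\<dots> \<in> pscale.span T"
      by (intro pscale.span_sum pscale.span_scale pscale.span_base) (auto simp: T_def)
    finally show ?thesis .
  qed
  have "chi ` ?P \<subseteq> pscale.span T"
    using span_T class_function_irreducible_character by (auto simp: chi_def)
  moreover have "card T \<le> card (chi ` ?P)"
    unfolding T_def card_image[OF inj] by (rule card_image_le[OF fin])
  ultimately have "perm_vector n f \<in> pscale.span (chi ` ?P)"
    using pscale.span_subset_of_card_le[OF ind finT] span_T[OF f] by blast
  then obtain u where u: "perm_vector n f = (\<Sum>lam\<in>?P. pscale (u (chi lam)) (chi lam))"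
    using pscale.span_finite[of "chi ` ?P"] fin by (auto simp: sum.reindex[OF inj])
  have coeff: "linear_extension f (young_symmetrizer mu) = u (chi mu) * symmetrizer_scalar mu" if mu: "mu \<turnstile> n" for mu
  proof -
    have "linear_extension f (young_symmetrizer mu) = L mu (perm_vector n f)"
      by (simp add: L_def linear_extension_perm_vector[OF symmetrizers_in_group_algebra(3)[OF mu]])
    also have "\<dots> = (\<Sum>lam\<in>?P. if lam = mu then u (chi lam) * symmetrizer_scalar lam else 0)"
      unfolding u L_sum using mu by (intro sum.cong refl) (auto simp: L_chi)
    also have "\<dots> = u (chi mu) * symmetrizer_scalar mu" using mu fin by simp
    finally show ?thesis .
  qed
  have "f \<sigma> = lookup (perm_vector n f) \<sigma>" using \<sigma> by (simp add: lookup_perm_vector)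
  also have "\<dots> = (\<Sum>lam\<in>?P. u (chi lam) * irreducible_character lam \<sigma>)"
    unfolding u using \<sigma> by (simp add: lookup_sum) (simp add: chi_def lookup_perm_vector)
  also have "\<dots> = (\<Sum>lam | lam \<turnstile> n.
    linear_extension f (young_symmetrizer lam) / symmetrizer_scalar lam * irreducible_character lam \<sigma>)"
    using young_symmetrizer_square(2)[where 'a = 'a] by (intro sum.cong refl) (simp add: coeff)
  finally show ?thesis .
qed

section \<open>The graded cocharacter as a permutation character\<close>

fun zseq :: "gvar list \<Rightarrow> nat list" where
  "zseq [] = []"
| "zseq (Yvar i # w) = zseq w"
| "zseq (Zvar j # w) = j # zseq w"

text \<open>
  The indices of the \<open>y\<close>'s that stand after an odd number of \<open>z\<close>'s, that is, at matrix index 2 when the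
  word is evaluated along \<open>1, 2, 3\<close>. The flag tells whether an odd number of \<open>z\<close>'s has already been
  read.
\<close>

fun odd_ys :: "bool \<Rightarrow> gvar list \<Rightarrow> nat set" where
  "odd_ys b [] = {}"
| "odd_ys b (Yvar i # w) = (if b then insert i (odd_ys b w) else odd_ys b w)"
| "odd_ys b (Zvar j # w) = odd_ys (\<not> b) w"

text \<open>
  The invariant on which the value of a multilinear word depends.
\<close>

definition word_class :: "gvar list \<Rightarrow> nat set \<times> nat list" where
  "word_class w = (odd_ys False w, zseq w)"

lemma zseq_append [simp]: "zseq (u @ v) = zseq u @ zseq v"
  by (induction u rule: zseq.induct) auto

lemma zseq_map_Yvar [simp]: "zseq (map Yvar is) = []"
  by (induction "is") auto

lemma zseq_map_Zvar [simp]: "zseq (map Zvar js) = js"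
  by (induction js) auto

lemma odd_ys_append_Y [simp]: "odd_ys b (map Yvar is @ w) = (if b then set is else {}) \<union> odd_ys b w"
  by (induction "is") auto

lemma odd_ys_map_Y [simp]: "odd_ys b (map Yvar is) = (if b then set is else {})"
  by (induction "is") auto

lemma word_class_rename:
  "word_class (map (rename_var \<omega> \<tau>) w) = ((`) \<omega> (fst (word_class w)), map \<tau> (snd (word_class w)))"
proof -
  have "odd_ys b (map (rename_var \<omega> \<tau>) w) = \<omega> ` odd_ys b w" for b
    by (induction b w rule: odd_ys.induct) auto
  moreover have "zseq (map (rename_var \<omega> \<tau>) w) = map \<tau> (zseq w)"
    by (induction w rule: zseq.induct) auto
  ultimately show ?thesis by (simp add: word_class_def)
qed

lemma set_zseq: "set (zseq w) = {j. Zvar j \<in> set w}"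
  by (induction w rule: zseq.induct) auto

lemma distinct_zseq: "distinct w \<Longrightarrow> distinct (zseq w)"
  by (induction w rule: zseq.induct) (auto simp: set_zseq)

lemma zseq_Nil: "zseq w = [] \<Longrightarrow> \<exists>is. w = map Yvar is"
proof (induction w rule: zseq.induct)
  case (2 i w)
  then obtain "is" where "w = map Yvar is" by auto
  then have "Yvar i # w = map Yvar (i # is)" by simp
  then show ?case by (rule exI)
qed auto

lemma zseq_Cons: "zseq w = j # js \<Longrightarrow> \<exists>is v. w = map Yvar is @ Zvar j # v \<and> zseq v = js"
proof (induction w rule: zseq.induct)
  case (2 i w)
  then obtain "is" v where "w = map Yvar is @ Zvar j # v" "zseq v = js" by auto
  then have "Yvar i # w = map Yvar (i # is) @ Zvar j # v \<and> zseq v = js" by simp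
  then show ?case by (intro exI)
next
  case (3 k w)
  then have "Zvar k # w = map Yvar [] @ Zvar j # w \<and> zseq w = js" by simp
  then show ?case by (intro exI)
qed simp

abbreviation multilinear_word :: "nat \<Rightarrow> nat \<Rightarrow> gvar list \<Rightarrow> bool" where
  "multilinear_word m n w \<equiv> distinct w \<and> set w = Yvar ` {1..m} \<union> Zvar ` {1..n}"

lemma zseq_multilinear:
  assumes "multilinear_word m n w"
  shows "distinct (zseq w)" "set (zseq w) = {1..n}" "length (zseq w) = n"
proof -
  show 1: "distinct (zseq w)" using assms distinct_zseq by blast
  show 2: "set (zseq w) = {1..n}" using assms by (auto simp: set_zseq)
  show "length (zseq w) = n" using distinct_card[OF 1] 2 by simp
qed

lemma set_map_Yvar_inj: "Yvar ` A = Yvar ` B \<longleftrightarrow> A = B"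
  by (rule inj_image_eq_iff) (simp add: inj_on_def)

lemma multilinear_word_0:
  assumes "multilinear_word m 0 w"
  obtains ls where "w = map Yvar ls" "distinct ls" "set ls = {1..m}" "word_class w = ({}, [])"
proof -
  have "zseq w = []" using zseq_multilinear(3)[OF assms] by simp
  then obtain ls where ls: "w = map Yvar ls" using zseq_Nil by blast
  moreover have "distinct ls" "set ls = {1..m}"
    using assms by (auto simp: ls distinct_map set_map_Yvar_inj)
  ultimately show thesis by (intro that) (auto simp: word_class_def)
qed

lemma multilinear_word_1:
  assumes "multilinear_word m 1 w"
  obtains ls rs where "w = map Yvar ls @ Zvar 1 # map Yvar rs" "distinct ls" "distinct rs"
    "set rs \<subseteq> {1..m}" "set ls = {1..m} - set rs" "word_class w = (set rs, [1])"
proof -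
  obtain j where "zseq w = [j]" using zseq_multilinear(3)[OF assms] by (cases "zseq w") auto
  then have z: "zseq w = [1]" using zseq_multilinear(2)[OF assms] by auto
  then obtain ls v where v: "w = map Yvar ls @ Zvar 1 # v" "zseq v = []" using zseq_Cons by blast
  then obtain rs where rs: "v = map Yvar rs" using zseq_Nil by blast
  have d: "distinct ls" "distinct rs" "set ls \<inter> set rs = {}"
    using assms by (auto simp: v rs distinct_map)
  have "Yvar -` set w = set ls \<union> set rs" by (auto simp: v rs)
  moreover have "Yvar -` set w = {1..m}" using assms by auto
  ultimately have "set ls \<union> set rs = {1..m}" by simp
  with d show thesis by (intro that[of ls rs]) (auto simp: v rs word_class_def)
qed

lemma multilinear_word_2:
  assumes "multilinear_word m 2 w"
  obtains j k ls rs ts where "w = map Yvar ls @ Zvar j # map Yvar rs @ Zvar k # map Yvar ts"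
    "distinct ls" "distinct rs" "distinct ts"
    "set rs \<subseteq> {1..m}" "set ls \<union> set ts = {1..m} - set rs" "set ls \<inter> set ts = {}" "word_class w = (set rs, [j, k])" "j \<noteq> k"
proof -
  obtain j k where z: "zseq w = [j, k]" using zseq_multilinear(3)[OF assms]
    by (auto simp: numeral_2_eq_2 length_Suc_conv)
  then obtain ls v where v: "w = map Yvar ls @ Zvar j # v" "zseq v = [k]" using zseq_Cons by blast
  then obtain rs u where u: "v = map Yvar rs @ Zvar k # u" "zseq u = []" using zseq_Cons by blast
  then obtain ts where ts: "u = map Yvar ts" using zseq_Nil by blast
  have d: "distinct ls" "distinct rs" "distinct ts" "set ls \<inter> set rs = {}" "set ls \<inter> set ts = {}" "set rs \<inter> set ts = {}" "j \<noteq> k"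
    using assms by (auto simp: v u ts distinct_map)
  have "Yvar -` set w = set ls \<union> set rs \<union> set ts" by (auto simp: v u ts)
  moreover have "Yvar -` set w = {1..m}" using assms by auto
  ultimately have "set ls \<union> set rs \<union> set ts = {1..m}" by simp
  with d show thesis by (intro that[of ls j rs k ts]) (auto simp: v u ts word_class_def)
qed

lemma eval_word_Nil [simp]: "eval_word a b [] = mat 1"
  by (simp add: eval_word_def)

lemma eval_word_Cons [simp]: "eval_word a b (x # w) = subst_var a b x ** eval_word a b w"
  by (simp add: eval_word_def)

text \<open>
  The formulas are symmetric in the \<open>y\<close>'s. The \<open>e13\<close> entry is a sum because \<open>e13\<close> can be taken from
  exactly one of the factors.
\<close>

lemma eval_word_map_Yvar:
  assumes a: "\<And>i. a i \<in> algA0" and "distinct ls"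
  shows "eval_word a b (map Yvar ls) $ 1 $ 1 = (\<Prod>i\<in>set ls. a i $ 1 $ 1)"
    "eval_word a b (map Yvar ls) $ 3 $ 3 = (\<Prod>i\<in>set ls. a i $ 1 $ 1)"
    "eval_word a b (map Yvar ls) $ 2 $ 2 = (\<Prod>i\<in>set ls. a i $ 2 $ 2)"
    "eval_word a b (map Yvar ls) $ 1 $ 3 = (\<Sum>i\<in>set ls. a i $ 1 $ 3 * (\<Prod>k\<in>set ls - {i}. a k $ 1 $ 1))"
    "eval_word a b (map Yvar ls) $ 1 $ 2 = 0" "eval_word a b (map Yvar ls) $ 2 $ 1 = 0"
    "eval_word a b (map Yvar ls) $ 2 $ 3 = 0" "eval_word a b (map Yvar ls) $ 3 $ 1 = 0"
    "eval_word a b (map Yvar ls) $ 3 $ 2 = 0"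
proof -
  let ?M = "\<lambda>ls. eval_word a b (map Yvar ls)"
  have A0: "a i $ 1 $ 2 = 0" "a i $ 2 $ 1 = 0" "a i $ 2 $ 3 = 0" "a i $ 3 $ 1 = 0" "a i $ 3 $ 2 = 0"
    "a i $ 3 $ 3 = a i $ 1 $ 1" for i using a[of i] by (simp_all add: algA0_iff)
  have "?M ls $ 1 $ 1 = (\<Prod>i\<in>set ls. a i $ 1 $ 1) \<and> ?M ls $ 3 $ 3 = (\<Prod>i\<in>set ls. a i $ 1 $ 1) \<and>
    ?M ls $ 2 $ 2 = (\<Prod>i\<in>set ls. a i $ 2 $ 2) \<and>
    ?M ls $ 1 $ 3 = (\<Sum>i\<in>set ls. a i $ 1 $ 3 * (\<Prod>k\<in>set ls - {i}. a k $ 1 $ 1)) \<and>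
    ?M ls $ 1 $ 2 = 0 \<and> ?M ls $ 2 $ 1 = 0 \<and> ?M ls $ 2 $ 3 = 0 \<and> ?M ls $ 3 $ 1 = 0 \<and> ?M ls $ 3 $ 2 = 0"
    using assms(2)
  proof (induction ls)
    case (Cons x ls)
    have "(\<Sum>i\<in>set ls. a i $ 1 $ 3 * (\<Prod>k\<in>insert x (set ls) - {i}. a k $ 1 $ 1)) =
        (\<Sum>i\<in>set ls. a x $ 1 $ 1 * (a i $ 1 $ 3 * (\<Prod>k\<in>set ls - {i}. a k $ 1 $ 1)))"
    proof (intro sum.cong refl)
      fix i assume "i \<in> set ls"
      then have "insert x (set ls) - {i} = insert x (set ls - {i})" "x \<notin> set ls - {i}" using Cons.prems by auto
      then show "a i $ 1 $ 3 * (\<Prod>k\<in>insert x (set ls) - {i}. a k $ 1 $ 1) =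
          a x $ 1 $ 1 * (a i $ 1 $ 3 * (\<Prod>k\<in>set ls - {i}. a k $ 1 $ 1))" by simp
    qed
    then show ?case
      using Cons by (simp add: matrix_matrix_mult_def sum_3 A0 sum_distrib_left)
  qed (simp add: mat_def)
  then show "?M ls $ 1 $ 1 = (\<Prod>i\<in>set ls. a i $ 1 $ 1)" "?M ls $ 3 $ 3 = (\<Prod>i\<in>set ls. a i $ 1 $ 1)"
    "?M ls $ 2 $ 2 = (\<Prod>i\<in>set ls. a i $ 2 $ 2)"
    "?M ls $ 1 $ 3 = (\<Sum>i\<in>set ls. a i $ 1 $ 3 * (\<Prod>k\<in>set ls - {i}. a k $ 1 $ 1))"
    "?M ls $ 1 $ 2 = 0" "?M ls $ 2 $ 1 = 0" "?M ls $ 2 $ 3 = 0" "?M ls $ 3 $ 1 = 0" "?M ls $ 3 $ 2 = 0"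
    by blast+
qed

lemma algA1_entries:
  assumes "M \<in> algA1"
  shows "M $ 1 $ 1 = 0" "M $ 1 $ 3 = 0" "M $ 2 $ 1 = 0" "M $ 2 $ 2 = 0" "M $ 3 $ 1 = 0" "M $ 3 $ 2 = 0" "M $ 3 $ 3 = 0"
  using assms by (simp_all add: algA1_iff)

lemma eval_word_one_z:
  assumes a: "\<And>i. a i \<in> algA0" and b: "\<And>j. b j \<in> algA1" and d: "distinct ls" "distinct rs"
  shows "eval_word a b (map Yvar ls @ Zvar j # map Yvar rs) =
    mscale ((\<Prod>i\<in>set ls. a i $ 1 $ 1) * b j $ 1 $ 2 * (\<Prod>i\<in>set rs. a i $ 2 $ 2)) (matunit 1 2) +
    mscale ((\<Prod>i\<in>set ls. a i $ 2 $ 2) * b j $ 2 $ 3 * (\<Prod>i\<in>set rs. a i $ 1 $ 1)) (matunit 2 3)"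
  by (simp add: vec_eq_iff forall_3 eval_word_append matrix_matrix_mult_def sum_3 mscale_def matunit_def
      eval_word_map_Yvar[OF a d(1)] eval_word_map_Yvar[OF a d(2)] algA1_entries[OF b])

lemma eval_word_two_z:
  assumes a: "\<And>i. a i \<in> algA0" and b: "\<And>j. b j \<in> algA1" and d: "distinct ls" "distinct rs" "distinct ts"
  shows "eval_word a b (map Yvar ls @ Zvar j # map Yvar rs @ Zvar k # map Yvar ts) =
    mscale ((\<Prod>i\<in>set ls. a i $ 1 $ 1) * b j $ 1 $ 2 * (\<Prod>i\<in>set rs. a i $ 2 $ 2) * b k $ 2 $ 3 *
      (\<Prod>i\<in>set ts. a i $ 1 $ 1)) (matunit 1 3)"
  unfolding eval_word_append[of a b "map Yvar ls"] eval_word_Cons eval_word_one_z[OF a b d(2,3)]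
  by (simp add: vec_eq_iff forall_3 matrix_matrix_mult_def sum_3 mscale_def matunit_def
      eval_word_map_Yvar[OF a d(1)] algA1_entries[OF b])

text \<open>
  Going through the word from the right, the value has degree zero, then degree one, then is a multiple
  of \<open>e13\<close>, and then is zero.
\<close>

lemma eval_word_many_z:
  fixes a b :: "nat \<Rightarrow> 'a::field^3^3"
  assumes a: "\<And>i. a i \<in> algA0" and b: "\<And>j. b j \<in> algA1" and "2 < length (zseq w)"
  shows "eval_word a b w = 0"
proof -
  have A0: "a i $ 1 $ 2 = 0" "a i $ 2 $ 1 = 0" "a i $ 2 $ 3 = 0" "a i $ 3 $ 1 = 0" "a i $ 3 $ 2 = 0"
    for i using a[of i] by (simp_all add: algA0_iff)
  have zero: "(\<chi> i j. 0) = (0 :: 'a^3^3)" by (simp add: vec_eq_iff)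
  note entries = vec_eq_iff forall_3 matrix_matrix_mult_def sum_3 A0 algA1_entries[OF b]
  have "(length (zseq w) = 0 \<longrightarrow> eval_word a b w \<in> algA0) \<and> (length (zseq w) = 1 \<longrightarrow> eval_word a b w \<in> algA1) \<and>
    (length (zseq w) = 2 \<longrightarrow> (\<forall>i j. (i, j) \<noteq> (1, 3) \<longrightarrow> eval_word a b w $ i $ j = 0)) \<and>
    (2 < length (zseq w) \<longrightarrow> eval_word a b w = 0)"
  proof (induction w rule: zseq.induct)
    case 1
    then show ?case using algA_grading(3) by simp
  next
    case (2 i w)
    then show ?case
      using algA_grading(4)[OF a, of "eval_word a b w" i] algA_grading(5)[OF a, of "eval_word a b w" i]
      by (auto simp: forall_3 matrix_matrix_mult_def sum_3 A0 zero)
  next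
    case (3 j w)
    consider "length (zseq w) = 0" | "length (zseq w) = 1" | "length (zseq w) = 2" | "length (zseq w) > 2" by linarith
    then show ?case
    proof cases
      case 1
      then show ?thesis using 3 algA_grading(6)[OF b, of "eval_word a b w" j] by simp
    next
      case 2
      then have "eval_word a b w \<in> algA1" using 3 by simp
      from algA1_entries[OF this] show ?thesis using 2 by (simp add: forall_3 matrix_matrix_mult_def sum_3 algA1_entries[OF b])
    next
      case 3
      then have "\<forall>i j. (i, j) \<noteq> (1, 3) \<longrightarrow> eval_word a b w $ i $ j = 0" using "3.IH" by simp
      then show ?thesis using 3 by (simp add: entries)
    next
      case 4
      then have "eval_word a b w = 0" using 3 by blast
      then show ?thesis using 4 by (auto simp: matrix_matrix_mult_def zero)
    qed
  qed
  then show ?thesis using assms(3) by blast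
qed

text \<open>
  Both words have the same explicit value. With two \<open>z\<close>'s the \<open>y\<close>'s before the first and after the
  second one may be distributed differently, but all of them contribute through the same entry.
\<close>

lemma eval_word_cong:
  assumes a: "\<And>i. a i \<in> algA0" and b: "\<And>j. b j \<in> algA1"
    and w: "multilinear_word m n w" and w': "multilinear_word m n w'" and eq: "word_class w = word_class w'"
  shows "eval_word a b w = eval_word a b w'"
proof -
  consider "n = 0" | "n = 1" | "n = 2" | "2 < n" by linarith
  then show ?thesis
  proof cases
    case 1
    obtain ls where ls: "w = map Yvar ls" "distinct ls" "set ls = {1..m}"
      using multilinear_word_0 w unfolding 1 by metis
    obtain ls' where ls': "w' = map Yvar ls'" "distinct ls'" "set ls' = {1..m}"
      using multilinear_word_0 w' unfolding 1 by metis
    show ?thesis unfolding ls(1) ls'(1)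
      by (simp add: vec_eq_iff forall_3 eval_word_map_Yvar[OF a ls(2)] eval_word_map_Yvar[OF a ls'(2)] ls(3) ls'(3))
  next
    case 2
    obtain ls rs where l: "w = map Yvar ls @ Zvar 1 # map Yvar rs" "distinct ls" "distinct rs"
      "set ls = {1..m} - set rs" "word_class w = (set rs, [1])"
      using multilinear_word_1 w unfolding 2 by metis
    obtain ls' rs' where l': "w' = map Yvar ls' @ Zvar 1 # map Yvar rs'" "distinct ls'" "distinct rs'"
      "set ls' = {1..m} - set rs'" "word_class w' = (set rs', [1])"
      using multilinear_word_1 w' unfolding 2 by metis
    have "set rs = set rs'" using eq l(5) l'(5) by simp
    then show ?thesis
      unfolding l(1) l'(1) eval_word_one_z[OF a b l(2,3)] eval_word_one_z[OF a b l'(2,3)] l(4) l'(4) by simp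
  next
    case 3
    obtain j k ls rs ts where l: "w = map Yvar ls @ Zvar j # map Yvar rs @ Zvar k # map Yvar ts"
      "distinct ls" "distinct rs" "distinct ts" "set ls \<union> set ts = {1..m} - set rs" "set ls \<inter> set ts = {}"
      "word_class w = (set rs, [j, k])"
      using multilinear_word_2 w unfolding 3 by metis
    obtain j' k' ls' rs' ts' where l': "w' = map Yvar ls' @ Zvar j' # map Yvar rs' @ Zvar k' # map Yvar ts'"
      "distinct ls'" "distinct rs'" "distinct ts'" "set ls' \<union> set ts' = {1..m} - set rs'" "set ls' \<inter> set ts' = {}"
      "word_class w' = (set rs', [j', k'])"
      using multilinear_word_2 w' unfolding 3 by metis
    have eqs: "set rs = set rs'" "j = j'" "k = k'" using eq l(7) l'(7) by simp_all
    have "(\<Prod>i\<in>set ls. a i $ 1 $ 1) * (\<Prod>i\<in>set ts. a i $ 1 $ 1) = (\<Prod>i\<in>{1..m} - set rs. a i $ 1 $ 1)"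
      using prod.union_disjoint[OF _ _ l(6), of "\<lambda>i. a i $ 1 $ 1"] l(5) by simp
    moreover have "(\<Prod>i\<in>set ls'. a i $ 1 $ 1) * (\<Prod>i\<in>set ts'. a i $ 1 $ 1) = (\<Prod>i\<in>{1..m} - set rs'. a i $ 1 $ 1)"
      using prod.union_disjoint[OF _ _ l'(6), of "\<lambda>i. a i $ 1 $ 1"] l'(5) by simp
    ultimately have "(\<Prod>i\<in>set ls. a i $ 1 $ 1) * (\<Prod>i\<in>set ts. a i $ 1 $ 1) =
      (\<Prod>i\<in>set ls'. a i $ 1 $ 1) * (\<Prod>i\<in>set ts'. a i $ 1 $ 1)" using eqs(1) by simp
    then have "(\<Prod>i\<in>set ls. a i $ 1 $ 1) * x * y * z * (\<Prod>i\<in>set ts. a i $ 1 $ 1) =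
      (\<Prod>i\<in>set ls'. a i $ 1 $ 1) * x * y * z * (\<Prod>i\<in>set ts'. a i $ 1 $ 1)" for x y z by (simp add: mult_ac)
    then show ?thesis
      unfolding l(1) l'(1) eval_word_two_z[OF a b l(2,3,4)] eval_word_two_z[OF a b l'(2,3,4)] eqs by metis
  next
    case 4
    have "eval_word a b w = 0" "eval_word a b w' = 0"
      using 4 zseq_multilinear(3)[OF w] zseq_multilinear(3)[OF w'] by (intro eval_word_many_z[OF a b]; simp)+
    then show ?thesis by simp
  qed
qed

text \<open>
  The substitution attached to a pair \<open>(S, zl)\<close>: a multilinear word has a nonzero value at the entry
  considered in \<open>test_form\<close> only if its \<open>y\<close>'s at index 2 are those of \<open>S\<close> and its \<open>z\<close>'s come in the
  order \<open>zl\<close>.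
\<close>

definition test_a :: "nat set \<Rightarrow> nat \<Rightarrow> 'a::field^3^3" where
  "test_a S i = (if i \<in> S then matunit 2 2 else matunit 1 1 + matunit 3 3)"

definition test_b :: "nat list \<Rightarrow> nat \<Rightarrow> 'a::field^3^3" where
  "test_b zl j = (if zl \<noteq> [] \<and> j = hd zl then matunit 1 2
     else if 1 < length zl \<and> j = zl ! 1 then matunit 2 3 else 0)"

text \<open>
  Evaluation along the path that starts at index 1; each \<open>z\<close> leads to the next index, so the path ends
  at \<open>n + 1\<close>.
\<close>

definition test_form :: "nat \<Rightarrow> nat set \<times> nat list \<Rightarrow> 'a::field free_algebra \<Rightarrow> 'a" where
  "test_form n k f = eval_poly (test_a (fst k)) (test_b (snd k)) f $ 1 $ (if n = 0 then 1 else if n = 1 then 2 else 3)"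

lemma test_a_in: "test_a S i \<in> algA0"
  by (simp add: test_a_def algA0_iff matunit_def)

lemma test_b_in: "test_b zl j \<in> algA1"
  by (auto simp: test_b_def algA1_iff matunit_def)

lemma test_a_entries: "test_a S i $ 1 $ 1 = (if i \<in> S then 0 else 1)" "test_a S i $ 2 $ 2 = (if i \<in> S then 1 else 0)"
  by (simp_all add: test_a_def matunit_def)

lemma test_b_entries:
  "test_b zl j $ 1 $ 2 = (if zl \<noteq> [] \<and> j = hd zl then 1 else 0)"
  "test_b zl j $ 2 $ 3 = (if 1 < length zl \<and> j = zl ! 1 \<and> j \<noteq> hd zl then 1 else 0)"
  by (auto simp: test_b_def matunit_def)

lemma eval_poly_pscale: "eval_poly a b (pscale c f) = mscale c (eval_poly a b f)"
  by (subst eval_poly_superset[of "keys f"])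
     (auto simp: eval_poly_def mscale.scale_sum_right mscale.scale_scale dest: subsetD[OF keys_pscale])

lemma linear_test_form: "Vector_Spaces.linear pscale (*) (test_form n k)"
proof -
  have "vector_space ((*) :: 'a \<Rightarrow> 'a \<Rightarrow> 'a::field)" by unfold_locales (simp_all add: algebra_simps)
  then show ?thesis
    by (simp add: Vector_Spaces.linear_iff pscale.vector_space_axioms test_form_def eval_poly_add eval_poly_pscale mscale_def)
qed

text \<open>
  For \<open>n = 0\<close> no \<open>y\<close> follows a \<open>z\<close>, hence the only set is empty; for \<open>n > 2\<close> all words are identities.
\<close>

definition word_classes :: "nat \<Rightarrow> nat \<Rightarrow> (nat set \<times> nat list) set" where
  "word_classes m n = (if 2 < n then {} else
     (if n = 0 then {{}} else Pow {1..m}) \<times> {zl. distinct zl \<and> set zl = {1..n}})"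

lemma prod_indicator:
  assumes "finite A"
  shows "(\<Prod>i\<in>A. if P i then 1 else 0 :: 'a::field) = (if \<forall>i\<in>A. P i then 1 else 0)"
  using assms by (induction A) auto

lemma test_form_single:
  assumes k: "k \<in> word_classes m n" and w: "multilinear_word m n w"
  shows "test_form n k (single w c) = (if word_class w = k then c else 0 :: 'a::field)"
proof -
  obtain S zl where k': "k = (S, zl)" by (cases k)
  have zl: "distinct zl" "set zl = {1..n}" "length zl = n"
    using k distinct_card[of zl] by (auto simp: k' word_classes_def split: if_splits)
  have S: "S \<subseteq> {1..m}" "n = 0 \<Longrightarrow> S = {}" and n: "n \<le> 2"
    using k by (auto simp: k' word_classes_def split: if_splits)
  note a = test_a_in[of S, where 'a = 'a] and b = test_b_in[of zl, where 'a = 'a]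
  have p1: "(\<Prod>i\<in>set xs. test_a S i $ 1 $ 1) = (if set xs \<inter> S = {} then 1 else 0 :: 'a)" for xs
    using prod_indicator[of "set xs" "\<lambda>i. i \<notin> S", where 'a = 'a]
    by (simp add: test_a_entries if_not_P disjoint_iff) (metis (full_types))
  have p2: "(\<Prod>i\<in>set xs. test_a S i $ 2 $ 2) = (if set xs \<subseteq> S then 1 else 0 :: 'a)" for xs
    using prod_indicator[of "set xs" "\<lambda>i. i \<in> S", where 'a = 'a] by (simp add: test_a_entries subset_iff)
  consider "n = 0" | "n = 1" | "n = 2" using n by linarith
  then show ?thesis
  proof cases
    case 1
    obtain ls where ls: "w = map Yvar ls" "distinct ls" "set ls = {1..m}" "word_class w = ({}, [])"
      using multilinear_word_0 w unfolding 1 by metis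
    have "eval_word (test_a S) (test_b zl) w $ 1 $ 1 = (1 :: 'a)"
      unfolding ls(1) eval_word_map_Yvar(1)[OF a ls(2)] p1 using S(2) 1 by simp
    then show ?thesis using zl(3) S(2) ls(4) 1 by (simp add: test_form_def eval_poly_single k' mscale_def)
  next
    case 2
    obtain ls rs where l: "w = map Yvar ls @ Zvar 1 # map Yvar rs" "distinct ls" "distinct rs"
      "set rs \<subseteq> {1..m}" "set ls = {1..m} - set rs" "word_class w = (set rs, [1])"
      using multilinear_word_1 w unfolding 2 by metis
    obtain j where "zl = [j]" using zl(3) 2 by (cases zl) auto
    then have zl1: "zl = [1]" using zl(2) 2 by auto
    have "set ls \<inter> S = {} \<and> set rs \<subseteq> S \<longleftrightarrow> set rs = S" using S(1) l(4,5) by auto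
    then have "eval_word (test_a S) (test_b zl) w $ 1 $ 2 = (if set rs = S then 1 else 0 :: 'a)"
      unfolding l(1) eval_word_one_z[OF a b l(2,3)] p1 p2
      by (auto simp: mscale_def matunit_def test_b_entries zl1)
    then show ?thesis using l(6) 2 by (simp add: test_form_def eval_poly_single k' mscale_def zl1)
  next
    case 3
    obtain j k ls rs ts where l: "w = map Yvar ls @ Zvar j # map Yvar rs @ Zvar k # map Yvar ts"
      "distinct ls" "distinct rs" "distinct ts" "set rs \<subseteq> {1..m}" "set ls \<union> set ts = {1..m} - set rs" "set ls \<inter> set ts = {}"
      "word_class w = (set rs, [j, k])" "j \<noteq> k"
      using multilinear_word_2 w unfolding 3 by metis
    obtain j' k' where zl2: "zl = [j', k']" using zl(3) 3 by (auto simp: numeral_2_eq_2 length_Suc_conv)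
    have "set ls \<inter> S = {} \<and> set rs \<subseteq> S \<and> set ts \<inter> S = {} \<longleftrightarrow> set rs = S" using S(1) l(5,6) by auto
    moreover have "set (zseq w) = {1..2}" using zseq_multilinear(2)[OF w] 3 by simp
    then have "{j, k} = {1..2}" using l(8) by (simp add: word_class_def)
    then have "{j, k} = {j', k'}" using zl(2) 3 by (simp add: zl2)
    then have "j = j' \<longleftrightarrow> k = k'" using l(9) zl(1) zl2 by (auto simp: doubleton_eq_iff)
    ultimately have "eval_word (test_a S) (test_b zl) w $ 1 $ 3 = (if set rs = S \<and> [j, k] = zl then 1 else 0 :: 'a)"
      unfolding l(1) eval_word_two_z[OF a b l(2,3,4)] p1 p2 using l(9)
      by (auto simp: mscale_def matunit_def test_b_entries zl2)
    then show ?thesis using l(8) 3 by (simp add: test_form_def eval_poly_single k' mscale_def)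
  qed
qed

lemma word_class_in:
  assumes w: "multilinear_word m n w" and n: "n \<le> 2"
  shows "word_class w \<in> word_classes m n"
proof -
  consider "n = 0" | "n = 1" | "n = 2" using n by linarith
  then show ?thesis
  proof cases
    case 1
    have "word_class w = ({}, [])" using multilinear_word_0 w unfolding 1 by metis
    then show ?thesis using 1 by (simp add: word_classes_def)
  next
    case 2
    obtain rs where "set rs \<subseteq> {1..m}" "word_class w = (set rs, [1])"
      using multilinear_word_1 w unfolding 2 by metis
    then show ?thesis using 2 by (auto simp: word_classes_def)
  next
    case 3
    obtain j k rs where l: "set rs \<subseteq> {1..m}" "word_class w = (set rs, [j, k])"
      using multilinear_word_2 w unfolding 3 by metis
    then have "zseq w = [j, k]" by (simp add: word_class_def)
    then show ?thesis using l zseq_multilinear[OF w] 3 by (simp add: word_classes_def)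
  qed
qed

text \<open>
  The definition is uniform in the number of \<open>z\<close>'s, which is at most two: \<open>take 1\<close> and \<open>drop 1\<close> are the
  first and the second one, as far as they exist.
\<close>

definition standard_word :: "nat \<Rightarrow> nat set \<times> nat list \<Rightarrow> gvar list" where
  "standard_word m k = map Yvar (sorted_list_of_set ({1..m} - fst k)) @ map Zvar (take 1 (snd k)) @
     map Yvar (sorted_list_of_set (fst k)) @ map Zvar (drop 1 (snd k))"

lemma standard_word:
  assumes k: "k \<in> word_classes m n"
  shows "multilinear_word m n (standard_word m k)" "word_class (standard_word m k) = k"
proof -
  obtain S zl where k': "k = (S, zl)" by (cases k)
  have zl: "distinct zl" "set zl = {1..n}" "length zl = n"
    using k distinct_card[of zl] by (auto simp: k' word_classes_def split: if_splits)
  have S: "S \<subseteq> {1..m}" "n = 0 \<Longrightarrow> S = {}" and n: "n \<le> 2"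
    using k by (auto simp: k' word_classes_def split: if_splits)
  have fin: "finite S" using S(1) finite_subset by blast
  have td: "set (take 1 zl) \<union> set (drop 1 zl) = {1..n}" "set (take 1 zl) \<inter> set (drop 1 zl) = {}"
    using zl by (metis append_take_drop_id set_append, metis append_take_drop_id distinct_append)
  have "set (standard_word m k) = Yvar ` ({1..m} - S \<union> S) \<union> Zvar ` (set (take 1 zl) \<union> set (drop 1 zl))"
    using fin by (auto simp: standard_word_def k')
  also have "{1..m} - S \<union> S = {1..m}" using S(1) by blast
  finally have 1: "set (standard_word m k) = Yvar ` {1..m} \<union> Zvar ` {1..n}" unfolding td(1) .
  have "distinct (standard_word m k)"
    using fin td(2) zl(1) by (auto simp: standard_word_def k' distinct_map inj_on_def)
  with 1 show "multilinear_word m n (standard_word m k)" by blast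
  consider "zl = []" | j where "zl = [j]" | j l where "zl = [j, l]"
    using n zl(3) by (cases zl; cases "tl zl") auto
  then show "word_class (standard_word m k) = k"
    using S(2) zl(3) fin by cases (auto simp: standard_word_def k' word_class_def)
qed

lemma subspace_multilinear: "pscale.subspace (multilinear m n)"
  by (auto simp: pscale.subspace_def multilinear_def dest!: subsetD[OF Poly_Mapping.keys_add] subsetD[OF keys_pscale])

lemma subspace_graded_identities: "pscale.subspace graded_identities"
  by (auto simp: pscale.subspace_def graded_identities_def eval_poly_0 eval_poly_add eval_poly_pscale)

lemma single_in_multilinear: "multilinear_word m n w \<Longrightarrow> single w c \<in> multilinear m n"
  by (auto simp: multilinear_def)

lemma finite_word_classes: "finite (word_classes m n)"
proof -
  have "{zl. distinct zl \<and> set zl = {1..n}} \<subseteq> {zl. set zl \<subseteq> {1..n} \<and> length zl \<le> n}"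
    using distinct_card by fastforce
  then have "finite {zl. distinct zl \<and> set zl = {1..n}}"
    using finite_lists_length_le[of "{1..n}" n] finite_subset by auto
  then show ?thesis by (simp add: word_classes_def)
qed

lemma test_form_eq:
  assumes k: "k \<in> word_classes m n" and f: "f \<in> multilinear m n"
  shows "test_form n k f = (\<Sum>w\<in>{w \<in> keys f. word_class w = k}. lookup f w)"
proof -
  interpret l: Vector_Spaces.linear pscale "(*)" "test_form n k" by (rule linear_test_form)
  have "test_form n k f = test_form n k (\<Sum>w\<in>keys f. single w (lookup f w))"
    by (subst poly_mapping_eq_sum_single) (rule refl)
  also have "\<dots> = (\<Sum>w\<in>keys f. if word_class w = k then lookup f w else 0)"
    unfolding l.sum using f by (intro sum.cong refl test_form_single[OF k]) (simp add: multilinear_def)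
  also have "\<dots> = (\<Sum>w\<in>{w \<in> keys f. word_class w = k}. lookup f w)"
    by (rule sum.inter_filter[symmetric]) simp
  finally show ?thesis .
qed

text \<open>
  Grouping the words of a polynomial by their class, every evaluation is a combination of the test forms.
\<close>

lemma graded_identity_iff:
  assumes f: "f \<in> multilinear m n"
  shows "f \<in> graded_identities \<longleftrightarrow> (\<forall>k\<in>word_classes m n. test_form n k f = 0)"
proof
  assume "f \<in> graded_identities"
  then show "\<forall>k\<in>word_classes m n. test_form n k f = 0"
    by (simp add: graded_identities_def test_form_def test_a_in test_b_in)
next
  assume zero: "\<forall>k\<in>word_classes m n. test_form n k f = 0"
  let ?K = "keys f"
  have ml: "multilinear_word m n w" if "w \<in> ?K" for w using f that by (simp add: multilinear_def)
  have "eval_poly a b f = 0" if a: "\<And>i. a i \<in> algA0" and b: "\<And>j. b j \<in> algA1" for a b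
  proof (cases "n \<le> 2")
    case True
    have "eval_poly a b f = (\<Sum>k\<in>word_class ` ?K. \<Sum>w\<in>{w \<in> ?K. word_class w = k}.
        mscale (lookup f w) (eval_word a b w))"
      unfolding eval_poly_def by (rule sum.image_gen) simp
    also have "\<dots> = 0"
    proof (rule sum.neutral, rule ballI)
      fix k assume k: "k \<in> word_class ` ?K"
      then have kc: "k \<in> word_classes m n" using word_class_in ml True by blast
      have "(\<Sum>w\<in>{w \<in> ?K. word_class w = k}. mscale (lookup f w) (eval_word a b w)) =
        (\<Sum>w\<in>{w \<in> ?K. word_class w = k}. mscale (lookup f w) (eval_word a b (standard_word m k)))"
      proof (intro sum.cong refl)
        fix w assume "w \<in> {w \<in> ?K. word_class w = k}"
        then have "eval_word a b w = eval_word a b (standard_word m k)"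
          using ml standard_word[OF kc] by (intro eval_word_cong[OF a b]) auto
        then show "mscale (lookup f w) (eval_word a b w) =
          mscale (lookup f w) (eval_word a b (standard_word m k))" by simp
      qed
      also have "\<dots> = mscale (test_form n k f) (eval_word a b (standard_word m k))"
        by (simp add: test_form_eq[OF kc f] mscale.scale_sum_left)
      also have "\<dots> = 0" using zero kc by simp
      finally show "(\<Sum>w\<in>{w \<in> ?K. word_class w = k}. mscale (lookup f w) (eval_word a b w)) = 0" .
    qed
    finally show ?thesis .
  next
    case False
    have "eval_word a b w = 0" if "w \<in> ?K" for w
      using eval_word_many_z[OF a b] zseq_multilinear(3)[OF ml[OF that]] False by simp
    then show ?thesis by (simp add: eval_poly_def)
  qed
  then show "f \<in> graded_identities" by (simp add: graded_identities_def)
qed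

lemma perm_act_eq_convolve:
  "perm_act \<omega> \<tau> f = convolve (\<lambda>_ w. map (rename_var \<omega> \<tau>) w) (single () 1) f"
  by (simp add: perm_act_def convolve_def)

lemma perm_act_single: "perm_act \<omega> \<tau> (single w c) = single (map (rename_var \<omega> \<tau>) w) c"
  by (simp add: perm_act_eq_convolve convolve_single)

lemma linear_perm_act: "Vector_Spaces.linear pscale pscale (perm_act \<omega> \<tau>)"
  unfolding perm_act_eq_convolve[abs_def] by (rule linear_convolve_right)

lemma multilinear_word_rename:
  assumes "\<omega> permutes {1..m}" "\<tau> permutes {1..n}" "multilinear_word m n w"
  shows "multilinear_word m n (map (rename_var \<omega> \<tau>) w)"
proof -
  have inj: "x = y" if "rename_var \<omega> \<tau> x = rename_var \<omega> \<tau> y" for x y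
    using that permutes_inj[OF assms(1)] permutes_inj[OF assms(2)] by (cases x; cases y) (auto dest: injD)
  have "rename_var \<omega> \<tau> ` set w = Yvar ` (\<omega> ` {1..m}) \<union> Zvar ` (\<tau> ` {1..n})"
    using assms(3) by (auto simp: image_Un image_image)
  then show ?thesis
    using assms inj by (auto simp: distinct_map inj_on_def permutes_image)
qed

lemma perm_act_multilinear:
  assumes "\<omega> permutes {1..m}" "\<tau> permutes {1..n}" "f \<in> multilinear m n"
  shows "perm_act \<omega> \<tau> f \<in> multilinear m n"
  unfolding perm_act_def
proof (intro pscale.subspace_sum subspace_multilinear single_in_multilinear)
  fix w assume "w \<in> keys f"
  then show "multilinear_word m n (map (rename_var \<omega> \<tau>) w)"
    using assms by (intro multilinear_word_rename) (auto simp: multilinear_def)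
qed

lemma eval_perm_act: "eval_poly a b (perm_act \<omega> \<tau> f) = eval_poly (a \<circ> \<omega>) (b \<circ> \<tau>) f"
proof -
  have "eval_word a b (map (rename_var \<omega> \<tau>) w) = eval_word (a \<circ> \<omega>) (b \<circ> \<tau>) w" for w
  proof (induction w)
    case (Cons x w)
    have "subst_var a b (rename_var \<omega> \<tau> x) = subst_var (a \<circ> \<omega>) (b \<circ> \<tau>) x" by (cases x) auto
    then show ?case using Cons by (simp add: o_def)
  qed simp
  then show ?thesis unfolding perm_act_def eval_poly_sum eval_poly_single eval_poly_def[of "a \<circ> \<omega>"] by simp
qed

lemma dual_basis_multilinear:
  "dual_basis_mod pscale (multilinear m n) (multilinear m n \<inter> graded_identities :: 'a::field free_algebra set)
     (word_classes m n) (\<lambda>k. single (standard_word m k) 1) (test_form n)"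
proof (intro dual_basis_mod.intro dual_basis_mod_axioms.intro pscale.vector_space_axioms subspace_multilinear
    pscale.subspace_inter subspace_graded_identities finite_word_classes linear_test_form)
  fix k k' assume k: "k \<in> word_classes m n" and k': "k' \<in> word_classes m n"
  show "test_form n k (single (standard_word m k') 1 :: 'a free_algebra) = (if k = k' then 1 else 0)"
    using test_form_single[OF k standard_word(1)[OF k']] standard_word(2)[OF k'] by auto
  show "single (standard_word m k) 1 \<in> (multilinear m n :: 'a free_algebra set)"
    by (rule single_in_multilinear[OF standard_word(1)[OF k]])
qed (simp_all add: graded_identity_iff)

text \<open>
  Renaming variables permutes the word classes, so the trace counts fixed classes.
\<close>

theorem graded_cocharacter_eq:
  assumes \<omega>: "\<omega> permutes {1..m}" and \<tau>: "\<tau> permutes {1..n}"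
  shows "graded_cocharacter m n \<omega> \<tau> =
    of_nat (card {(S, zl) \<in> word_classes m n. \<omega> ` S = S \<and> map \<tau> zl = zl})"
proof -
  interpret D: dual_basis_mod pscale "multilinear m n" "multilinear m n \<inter> graded_identities"
    "word_classes m n" "\<lambda>k. single (standard_word m k) 1" "test_form n"
    by (rule dual_basis_multilinear)
  have "graded_cocharacter m n \<omega> \<tau> = (\<Sum>k\<in>word_classes m n. test_form n k (perm_act \<omega> \<tau> (single (standard_word m k) 1)))"
    unfolding graded_cocharacter_def
    by (intro D.trace_mod_eq linear_perm_act)
       (auto intro: perm_act_multilinear[OF \<omega> \<tau>] simp: graded_identities_def eval_perm_act)
  also have "\<dots> = (\<Sum>k\<in>word_classes m n. if \<omega> ` fst k = fst k \<and> map \<tau> (snd k) = snd k then 1 else 0)"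
  proof (intro sum.cong refl)
    fix k assume k: "k \<in> word_classes m n"
    show "test_form n k (perm_act \<omega> \<tau> (single (standard_word m k) 1)) =
      (if \<omega> ` fst k = fst k \<and> map \<tau> (snd k) = snd k then 1 else 0)"
      unfolding perm_act_single
      by (subst test_form_single[OF k multilinear_word_rename[OF \<omega> \<tau> standard_word(1)[OF k]]])
         (simp add: word_class_rename standard_word(2)[OF k] prod_eq_iff)
  qed
  also have "\<dots> = of_nat (card {k \<in> word_classes m n. \<omega> ` fst k = fst k \<and> map \<tau> (snd k) = snd k})"
    using finite_word_classes by (simp add: sum.If_cases Int_def)
  also have "{k \<in> word_classes m n. \<omega> ` fst k = fst k \<and> map \<tau> (snd k) = snd k} =
    {(S, zl) \<in> word_classes m n. \<omega> ` S = S \<and> map \<tau> zl = zl}" by auto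
  finally show ?thesis .
qed

section \<open>Young's rule for shapes with two rows\<close>

definition fixed_subsets :: "nat \<Rightarrow> nat \<Rightarrow> (nat \<Rightarrow> nat) \<Rightarrow> nat" where
  "fixed_subsets m k \<sigma> = card {S. S \<subseteq> {1..m} \<and> card S = k \<and> \<sigma> ` S = S}"

lemma class_function_fixed_subsets: "class_function m (\<lambda>\<sigma>. of_nat (fixed_subsets m k \<sigma>))"
  unfolding class_function_def
proof (intro allI impI arg_cong[where f = of_nat])
  fix \<sigma> \<tau> assume \<sigma>: "\<sigma> permutes {1..m}" and \<tau>: "\<tau> permutes {1..m}"
  have inv: "\<tau> ` inv \<tau> ` S = S" "inv \<tau> ` \<tau> ` S = S" for S
    using permutes_inv_o[OF \<tau>] by (simp_all add: image_comp)
  have sub: "\<tau> ` S \<subseteq> {1..m}" "inv \<tau> ` S \<subseteq> {1..m}" if "S \<subseteq> {1..m}" for S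
    using that permutes_image[OF \<tau>] permutes_image[OF permutes_inv[OF \<tau>]] by (metis image_mono)+
  have card: "card (\<tau> ` S) = card S" "card (inv \<tau> ` S) = card S" for S
    using permutes_inj[OF \<tau>] permutes_inj[OF permutes_inv[OF \<tau>]] by (auto intro: card_image inj_on_subset)
  have "bij_betw ((`) \<tau>) {S. S \<subseteq> {1..m} \<and> card S = k \<and> \<sigma> ` S = S}
      {S. S \<subseteq> {1..m} \<and> card S = k \<and> (\<tau> \<circ> \<sigma> \<circ> inv \<tau>) ` S = S}"
  proof (rule bij_betwI[where g = "(`) (inv \<tau>)"])
    show "(`) \<tau> \<in> {S. S \<subseteq> {1..m} \<and> card S = k \<and> \<sigma> ` S = S} \<rightarrow>
      {S. S \<subseteq> {1..m} \<and> card S = k \<and> (\<tau> \<circ> \<sigma> \<circ> inv \<tau>) ` S = S}"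
    proof (intro Pi_I CollectI conjI)
      fix S assume "S \<in> {S. S \<subseteq> {1..m} \<and> card S = k \<and> \<sigma> ` S = S}"
      then have S: "S \<subseteq> {1..m}" "card S = k" "\<sigma> ` S = S" by simp_all
      then show "\<tau> ` S \<subseteq> {1..m}" "card (\<tau> ` S) = k" using sub(1) card(1) by simp_all
      have "(\<tau> \<circ> \<sigma> \<circ> inv \<tau>) ` \<tau> ` S = \<tau> ` \<sigma> ` inv \<tau> ` \<tau> ` S" by (simp only: image_comp o_assoc)
      then show "(\<tau> \<circ> \<sigma> \<circ> inv \<tau>) ` \<tau> ` S = \<tau> ` S" using inv(2) S(3) by simp
    qed
    show "(`) (inv \<tau>) \<in> {S. S \<subseteq> {1..m} \<and> card S = k \<and> (\<tau> \<circ> \<sigma> \<circ> inv \<tau>) ` S = S} \<rightarrow>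
      {S. S \<subseteq> {1..m} \<and> card S = k \<and> \<sigma> ` S = S}"
    proof (intro Pi_I CollectI conjI)
      fix S assume "S \<in> {S. S \<subseteq> {1..m} \<and> card S = k \<and> (\<tau> \<circ> \<sigma> \<circ> inv \<tau>) ` S = S}"
      then have S: "S \<subseteq> {1..m}" "card S = k" "\<tau> ` \<sigma> ` inv \<tau> ` S = S"
        unfolding image_comp o_assoc by simp_all
      then show "inv \<tau> ` S \<subseteq> {1..m}" "card (inv \<tau> ` S) = k" using sub(2) card(2) by simp_all
      show "\<sigma> ` inv \<tau> ` S = inv \<tau> ` S" using inv(2) S(3) by metis
    qed
  qed (use inv in auto)
  then show "fixed_subsets m k (\<tau> \<circ> \<sigma> \<circ> inv \<tau>) = fixed_subsets m k \<sigma>"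
    unfolding fixed_subsets_def by (rule bij_betw_same_card[symmetric])
qed

abbreviation subset_act ::
    "((nat \<Rightarrow> nat) \<Rightarrow>\<^sub>0 'a::field) \<Rightarrow> (nat set \<Rightarrow>\<^sub>0 'a) \<Rightarrow> (nat set \<Rightarrow>\<^sub>0 'a)" (infixr "\<bullet>\<bullet>" 70) where
  "subset_act \<equiv> convolve (`)"

abbreviation subset_basis :: "nat set \<Rightarrow> (nat set \<Rightarrow>\<^sub>0 'a::field)" where
  "subset_basis S \<equiv> single S 1"

lemma subset_act_assoc: "x \<bullet>\<bullet> (y \<bullet>\<bullet> v) = (x \<star> y) \<bullet>\<bullet> v"
  unfolding ga_mult_eq_convolve by (rule convolve_assoc) (rule image_comp)

lemma subset_act_single: "single g c \<bullet>\<bullet> single S d = single (g ` S) (c * d)"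
  by (rule convolve_single)

text \<open>
  The number of fixed \<open>k\<close>-subsets is the trace on the span of the \<open>k\<close>-subsets; extended linearly it is
  the trace of the group algebra.
\<close>

lemma linear_extension_fixed_subsets:
  fixes x :: "_ \<Rightarrow>\<^sub>0 'a::field"
  assumes "x \<in> group_algebra m"
  shows "linear_extension (\<lambda>\<sigma>. of_nat (fixed_subsets m k \<sigma>)) x =
    (\<Sum>S | S \<subseteq> {1..m} \<and> card S = k. lookup (x \<bullet>\<bullet> subset_basis S) S)"
  using assms
proof (induction rule: group_algebra_induct)
  case (single g c)
  have fin: "finite {S. S \<subseteq> {1..m} \<and> card S = k}" by (rule finite_subset[of _ "Pow {1..m}"]) auto
  have "(\<Sum>S | S \<subseteq> {1..m} \<and> card S = k. lookup (single g c \<bullet>\<bullet> subset_basis S) S) =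
      (\<Sum>S | S \<subseteq> {1..m} \<and> card S = k. if g ` S = S then c else 0)"
    by (intro sum.cong refl) (simp add: subset_act_single lookup_single when_def)
  also have "\<dots> = (\<Sum>S\<in>{S \<in> {S. S \<subseteq> {1..m} \<and> card S = k}. g ` S = S}. c)"
    by (rule sum.inter_filter[OF fin, symmetric])
  also have "\<dots> = of_nat (fixed_subsets m k g) * c"
    by (simp add: fixed_subsets_def conj_assoc)
  finally show ?case by (simp add: linear_extension_single mult.commute)
next
  case (add x y)
  then show ?case by (simp add: linear_extension_add convolve_add_left lookup_add sum.distrib)
qed

text \<open>
  The transposition of \<open>x\<close> and \<open>y\<close> fixes \<open>S\<close> but is absorbed by the antisymmetrizer with sign \<open>-1\<close>.
\<close>

lemma antisymmetrizer_kills_subset: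
  fixes lam :: "nat list"
  assumes xy: "x \<in> {1..sum_list lam}" "y \<in> {1..sum_list lam}" "x \<noteq> y" "col_of lam x = col_of lam y"
    and S: "x \<in> S \<longleftrightarrow> y \<in> S"
  shows "col_antisymmetrizer lam \<bullet>\<bullet> subset_basis S = (0 :: _ \<Rightarrow>\<^sub>0 'a::field_char_0)"
proof -
  let ?b = "col_antisymmetrizer lam :: _ \<Rightarrow>\<^sub>0 'a"
  let ?t = "Transposition.transpose x y"
  have t: "?t \<in> col_stabilizer lam" "sign ?t = -1"
    using xy transpose_in_stabilizer(2)[of x lam y] by (auto simp: sign_swap_id)
  have "?t ` S = S" using S by (rule transpose_image_eq)
  then have "?b \<bullet>\<bullet> subset_basis S = ?b \<bullet>\<bullet> (perm_basis ?t \<bullet>\<bullet> subset_basis S)"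
    by (simp add: subset_act_single)
  also have "\<dots> = pscale (-1) (?b \<bullet>\<bullet> subset_basis S)"
    unfolding subset_act_assoc col_antisymmetrizer_absorb(2)[OF t(1)] t(2) convolve_pscale_left
    by (simp only: of_int_minus of_int_1)
  finally show ?thesis by (rule poly_mapping_eq_uminus_imp_0)
qed

lemma young_symmetrizer_act: "young_symmetrizer lam \<bullet>\<bullet> v = row_symmetrizer lam \<bullet>\<bullet> (col_antisymmetrizer lam \<bullet>\<bullet> v)"
  by (simp add: young_symmetrizer_eq subset_act_assoc)

text \<open>
  Of three entries in one column two are both inside or both outside a given subset.
\<close>

lemma fixed_subsets_three_rows:
  assumes lam: "lam \<turnstile> m" and len: "3 \<le> length lam"
  shows "linear_extension (\<lambda>\<sigma>. of_nat (fixed_subsets m k \<sigma>)) (young_symmetrizer lam) = (0 :: 'a::field_char_0)"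
proof -
  let ?e = "young_symmetrizer lam :: _ \<Rightarrow>\<^sub>0 'a"
  have m: "sum_list lam = m" using lam by (simp add: is_partition_def)
  have cell: "(i, 0) \<in> cells lam" if "i < 3" for i
    using lam len that by (auto simp: cells_def is_partition_def)
  define x where "x i = tab_entry lam i 0" for i
  have x: "x i \<in> {1..sum_list lam}" "row_of lam (x i) = i" "col_of lam (x i) = 0" if "i < 3" for i
    unfolding x_def by (rule row_col_tab_entry[OF cell[OF that]])+
  have "?e \<bullet>\<bullet> subset_basis S = 0" for S
  proof -
    have zero: "col_antisymmetrizer lam \<bullet>\<bullet> subset_basis S = (0 :: _ \<Rightarrow>\<^sub>0 'a)"
      if ij: "i < 3" "j < 3" "i \<noteq> j" "x i \<in> S \<longleftrightarrow> x j \<in> S" for i j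
    proof (rule antisymmetrizer_kills_subset[OF x(1)[OF ij(1)] x(1)[OF ij(2)] _ _ ij(4)])
      show "x i \<noteq> x j" using x(2)[OF ij(1)] x(2)[OF ij(2)] ij(3) by metis
      show "col_of lam (x i) = col_of lam (x j)" by (simp add: x(3) ij)
    qed
    consider "x 0 \<in> S \<longleftrightarrow> x 1 \<in> S" | "x 0 \<in> S \<longleftrightarrow> x 2 \<in> S" | "x 1 \<in> S \<longleftrightarrow> x 2 \<in> S" by blast
    then have "col_antisymmetrizer lam \<bullet>\<bullet> subset_basis S = (0 :: _ \<Rightarrow>\<^sub>0 'a)"
      using zero[of 0 1] zero[of 0 2] zero[of 1 2] by cases simp_all
    then show ?thesis by (simp add: young_symmetrizer_act)
  qed
  then show ?thesis
    by (simp add: linear_extension_fixed_subsets[OF symmetrizers_in_group_algebra(3)[OF lam]])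
qed

lemma ex_permutes_image:
  assumes "finite Y" "A \<subseteq> Y" "B \<subseteq> Y" "card A = card B"
  shows "\<exists>\<rho>. \<rho> permutes Y \<and> \<rho> ` A = B"
proof -
  have fin: "finite A" "finite B" using assms finite_subset by blast+
  obtain f where f: "bij_betw f A B" using finite_same_card_bij[OF fin assms(4)] by blast
  have "card (Y - A) = card (Y - B)" using assms fin by (simp add: card_Diff_subset)
  then obtain g where g: "bij_betw g (Y - A) (Y - B)" using finite_same_card_bij[of "Y - A" "Y - B"] assms(1) by auto
  define \<rho> where "\<rho> x = (if x \<in> A then f x else if x \<in> Y then g x else x)" for x
  have "bij_betw \<rho> A B" by (rule iffD1[OF bij_betw_cong f]) (simp add: \<rho>_def)
  moreover have "bij_betw \<rho> (Y - A) (Y - B)" by (rule iffD1[OF bij_betw_cong g]) (simp add: \<rho>_def)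
  ultimately have "bij_betw \<rho> (A \<union> (Y - A)) (B \<union> (Y - B))" by (rule bij_betw_combine) auto
  then have "bij_betw \<rho> Y Y" using assms(2,3) by (simp add: Un_absorb1)
  then have "\<rho> permutes Y" by (rule bij_imp_permutes) (use assms(2) in \<open>auto simp: \<rho>_def\<close>)
  moreover have "\<rho> ` A = B" using \<open>bij_betw \<rho> A B\<close> by (simp add: bij_betw_def)
  ultimately show ?thesis by blast
qed

lemma two_row_cells: "cells (drop_zeros [p + q, p]) = {0} \<times> {..<p + q} \<union> {1} \<times> {..<p}"
  by (auto simp: drop_zeros_def cells_def nth_Cons split: nat.splits)

lemma sum_list_two_row: "sum_list (drop_zeros [p + q, p]) = 2 * p + q"
  by (simp add: drop_zeros_def)

lemma partition_two_row: "drop_zeros [p + q, p] \<turnstile> 2 * p + q"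
  by (simp add: is_partition_def drop_zeros_def)

text \<open>
  The first row is \<open>1, \<dots>, p + q\<close>, the second one \<open>p + q + 1, \<dots>, 2 p + q\<close>. The columns with two
  entries consist of \<open>x\<close> and \<open>x + (p + q)\<close> for \<open>x \<le> p\<close>; the entries \<open>p + 1, \<dots>, p + q\<close> form columns of
  their own.
\<close>

lemma two_row_row_col:
  assumes "x \<in> {1..2 * p + q}"
  shows "row_of (drop_zeros [p + q, p]) x = (if x \<le> p + q then 0 else 1)"
    "col_of (drop_zeros [p + q, p]) x = (if x \<le> p + q then x - 1 else x - 1 - (p + q))"
proof -
  let ?lam = "drop_zeros [p + q, p]"
  have "row_of ?lam x = (if x \<le> p + q then 0 else 1) \<and>
    col_of ?lam x = (if x \<le> p + q then x - 1 else x - 1 - (p + q))"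
  proof (cases "x \<le> p + q")
    case True
    then have c: "(0, x - 1) \<in> cells ?lam" using assms by (auto simp: two_row_cells)
    have "tab_entry ?lam 0 (x - 1) = x" using assms by (simp add: tab_entry_def)
    then show ?thesis using row_col_tab_entry(2,3)[OF c] True by simp
  next
    case False
    then have c: "(1, x - 1 - (p + q)) \<in> cells ?lam" and p: "p > 0" using assms by (auto simp: two_row_cells)
    have "tab_entry ?lam 1 (x - 1 - (p + q)) = x" using assms False p by (simp add: tab_entry_def drop_zeros_def)
    then show ?thesis using row_col_tab_entry(2,3)[OF c] False by simp
  qed
  then show "row_of ?lam x = (if x \<le> p + q then 0 else 1)"
    "col_of ?lam x = (if x \<le> p + q then x - 1 else x - 1 - (p + q))" by blast+
qed

context
  fixes p q m :: nat and lam :: "nat list"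
  assumes lam_def: "lam = drop_zeros [p + q, p]" and m_def: "m = 2 * p + q"
begin

lemma two_row_partition: "lam \<turnstile> m"
  unfolding lam_def m_def by (rule partition_two_row)

lemma two_row_sum: "sum_list lam = m"
  unfolding lam_def m_def by (rule sum_list_two_row)

lemma col_stabilizer_tail:
  assumes c: "c \<in> col_stabilizer lam" and x: "p < x" "x \<le> p + q"
  shows "c x = x"
proof -
  have X: "x \<in> {1..m}" "c x \<in> {1..m}"
    using c x permutes_in_image[of c "{1..m}" x] by (auto simp: col_stabilizer_iff two_row_sum m_def)
  have "col_of lam (c x) = col_of lam x" using c X by (auto simp: col_stabilizer_iff two_row_sum)
  then show ?thesis
    using two_row_row_col(2)[of x p q] two_row_row_col(2)[of "c x" p q] X x
    unfolding lam_def m_def by (auto split: if_splits)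
qed

text \<open>
  A permutation of the entries with a column of their own preserves rows and commutes with all column
  permutations, so the Young symmetrizer absorbs it from the right.
\<close>

lemma young_symmetrizer_subset_tail:
  fixes \<rho> :: "nat \<Rightarrow> nat"
  assumes \<rho>: "\<rho> permutes {p + 1..p + q}"
  shows "young_symmetrizer lam \<bullet>\<bullet> subset_basis (\<rho> ` S) = (young_symmetrizer lam \<bullet>\<bullet> subset_basis S :: _ \<Rightarrow>\<^sub>0 'a::field)"
proof -
  have \<rho>m: "\<rho> permutes {1..m}" by (rule permutes_subset[OF \<rho>]) (auto simp: m_def)
  have R: "\<rho> \<in> row_stabilizer lam"
    unfolding row_stabilizer_iff two_row_sum
  proof (intro conjI \<rho>m ballI)
    fix x assume x: "x \<in> {1..m}"
    show "row_of lam (\<rho> x) = row_of lam x"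
    proof (cases "x \<in> {p + 1..p + q}")
      case True
      then have "\<rho> x \<in> {p + 1..p + q}" using permutes_in_image[OF \<rho>] by blast
      then show ?thesis using True two_row_row_col(1)[of x p q] two_row_row_col(1)[of "\<rho> x" p q]
        by (auto simp: lam_def)
    qed (use permutes_not_in[OF \<rho>] in simp)
  qed
  have comm: "c \<circ> \<rho> = \<rho> \<circ> c" if c: "c \<in> col_stabilizer lam" for c
  proof
    fix x
    have cp: "c permutes {1..m}" using c by (simp add: col_stabilizer_iff two_row_sum)
    show "(c \<circ> \<rho>) x = (\<rho> \<circ> c) x"
    proof (cases "x \<in> {p + 1..p + q}")
      case True
      then have "\<rho> x \<in> {p + 1..p + q}" using permutes_in_image[OF \<rho>] by blast
      then show ?thesis using True col_stabilizer_tail[OF c] by simp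
    next
      case False
      have "c x \<notin> {p + 1..p + q}"
      proof
        assume *: "c x \<in> {p + 1..p + q}"
        then have "c (c x) = c x" using col_stabilizer_tail[OF c] by simp
        then have "c x = x" using permutes_inj[OF cp] by (simp add: inj_eq)
        then show False using * False by simp
      qed
      then show ?thesis using False permutes_not_in[OF \<rho>] by simp
    qed
  qed
  have "col_antisymmetrizer lam \<star> perm_basis \<rho> = (perm_basis \<rho> \<star> col_antisymmetrizer lam :: _ \<Rightarrow>\<^sub>0 'a)"
    unfolding col_antisymmetrizer_def ga_mult_sum_left ga_mult_sum_right ga_mult_single
    by (intro sum.cong refl) (simp add: comm)
  then have "young_symmetrizer lam \<star> perm_basis \<rho> = row_symmetrizer lam \<star> (perm_basis \<rho> \<star> col_antisymmetrizer lam :: _ \<Rightarrow>\<^sub>0 'a)"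
    by (simp add: young_symmetrizer_eq ga_mult_assoc[symmetric])
  also have "\<dots> = young_symmetrizer lam"
    by (simp add: ga_mult_assoc row_symmetrizer_absorb(2)[OF R] young_symmetrizer_eq)
  finally have eq: "young_symmetrizer lam \<star> perm_basis \<rho> = (young_symmetrizer lam :: _ \<Rightarrow>\<^sub>0 'a)" .
  have "young_symmetrizer lam \<bullet>\<bullet> subset_basis (\<rho> ` S) = young_symmetrizer lam \<bullet>\<bullet> (perm_basis \<rho> \<bullet>\<bullet> (subset_basis S :: _ \<Rightarrow>\<^sub>0 'a))"
    by (simp add: subset_act_single)
  also have "\<dots> = young_symmetrizer lam \<bullet>\<bullet> subset_basis S" unfolding subset_act_assoc eq ..
  finally show ?thesis .
qed

lemma young_symmetrizer_subset_col:
  assumes c: "c \<in> col_stabilizer lam"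
  shows "young_symmetrizer lam \<bullet>\<bullet> subset_basis S = pscale (of_int (sign c)) (young_symmetrizer lam \<bullet>\<bullet> subset_basis (c ` S) :: _ \<Rightarrow>\<^sub>0 'a::field)"
proof -
  have "young_symmetrizer lam \<star> perm_basis c = pscale (of_int (sign c) :: 'a) (young_symmetrizer lam)"
    by (simp add: young_symmetrizer_eq ga_mult_assoc[symmetric] col_antisymmetrizer_absorb(2)[OF c] ga_mult_pscale)
  moreover have "young_symmetrizer lam \<bullet>\<bullet> subset_basis (c ` S) = young_symmetrizer lam \<bullet>\<bullet> (perm_basis c \<bullet>\<bullet> (subset_basis S :: _ \<Rightarrow>\<^sub>0 'a))"
    by (simp add: subset_act_single)
  ultimately have "young_symmetrizer lam \<bullet>\<bullet> subset_basis (c ` S) = pscale (of_int (sign c) :: 'a) (young_symmetrizer lam \<bullet>\<bullet> subset_basis S)"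
    unfolding subset_act_assoc by (simp add: convolve_pscale_left)
  then show ?thesis by (simp add: sign_def)
qed

text \<open>
  If every column of height two has exactly one entry in \<open>S\<close>, then exchanging the entries in some of
  these columns moves \<open>S\<close> into the first row.
\<close>

lemma subset_column_normal_form:
  assumes S: "S \<subseteq> {1..m}" and one: "\<And>x. x \<in> {1..p} \<Longrightarrow> x \<in> S \<longleftrightarrow> x + (p + q) \<notin> S"
  shows "\<exists>c\<in>col_stabilizer lam. {1..p} \<subseteq> c ` S \<and> c ` S \<subseteq> {1..p + q}"
proof -
  define c where "c x = (if x \<in> {1..p} \<and> x + (p + q) \<in> S then x + (p + q)
    else if x \<in> {p + q + 1..m} \<and> x \<in> S then x - (p + q) else x)" for x
  have m: "x - (p + q) \<in> {1..p}" "x - (p + q) + (p + q) = x" if "x \<in> {p + q + 1..m}" for x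
    using that by (auto simp: m_def)
  have cc: "c (c x) = x" for x
    by (auto simp: c_def m_def)
  have cX: "c x \<in> {1..m} \<longleftrightarrow> x \<in> {1..m}" for x
    by (auto simp: c_def m_def)
  have cp: "c permutes {1..m}"
  proof (rule bij_imp_permutes)
    show "bij_betw c {1..m} {1..m}"
      by (rule bij_betwI[where g = c]) (use cc cX in auto)
    show "c x = x" if "x \<notin> {1..m}" for x using that by (auto simp: c_def m_def)
  qed
  have "col_of lam (c x) = col_of lam x" if x: "x \<in> {1..m}" for x
    using x two_row_row_col(2)[of x p q] two_row_row_col(2)[of "c x" p q] cX[of x]
    unfolding lam_def m_def by (auto simp: c_def m_def)
  then have C: "c \<in> col_stabilizer lam" using cp by (simp add: col_stabilizer_iff two_row_sum)
  have "{1..p} \<subseteq> c ` S"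
  proof
    fix x assume x: "x \<in> {1..p}"
    have "c x \<in> S" using one[OF x] x by (auto simp: c_def)
    then show "x \<in> c ` S" using cc[of x] by (metis imageI)
  qed
  moreover have "c ` S \<subseteq> {1..p + q}"
  proof
    fix y assume "y \<in> c ` S"
    then obtain x where x: "x \<in> S" "y = c x" by blast
    then have X: "x \<in> {1..m}" using S by blast
    show "y \<in> {1..p + q}"
    proof (cases "x \<le> p + q")
      case True
      have "\<not> (x \<in> {1..p} \<and> x + (p + q) \<in> S)" using one x(1) by blast
      then show ?thesis using True X unfolding x(2) c_def by auto
    next
      case False
      then have "x \<in> {p + q + 1..m}" using X by auto
      then show ?thesis using x(1) m[of x] False unfolding x(2) c_def by auto
    qed
  qed
  ultimately show ?thesis using C by blast
qed

text \<open>
  If some column of height two lies inside or outside \<open>S\<close>, the antisymmetrizer kills \<open>S\<close>. Otherwise a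
  column permutation followed by a permutation of \<open>p + 1, \<dots>, p + q\<close> moves \<open>S\<close> to \<open>{1..k}\<close>, and both are
  absorbed up to sign. In that case \<open>S\<close> has one element in each of the \<open>p\<close> columns of height two and
  some of the remaining \<open>q\<close> entries, which bounds \<open>k\<close>.
\<close>

lemma young_symmetrizer_subset_multiple:
  fixes k :: nat
  defines "w \<equiv> young_symmetrizer lam \<bullet>\<bullet> subset_basis {1..k} :: _ \<Rightarrow>\<^sub>0 'a::field_char_0"
  assumes S: "S \<subseteq> {1..m}" "card S = k"
  shows "\<exists>d. young_symmetrizer lam \<bullet>\<bullet> subset_basis S = pscale d w"
    "\<not> (p \<le> k \<and> k \<le> p + q) \<Longrightarrow> young_symmetrizer lam \<bullet>\<bullet> subset_basis S = (0 :: _ \<Rightarrow>\<^sub>0 'a)"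
proof -
  let ?e = "young_symmetrizer lam :: _ \<Rightarrow>\<^sub>0 'a"
  have "(\<exists>d. ?e \<bullet>\<bullet> subset_basis S = pscale d w) \<and> (\<not> (p \<le> k \<and> k \<le> p + q) \<longrightarrow> ?e \<bullet>\<bullet> subset_basis S = 0)"
  proof (cases "\<exists>x\<in>{1..p}. x \<in> S \<longleftrightarrow> x + (p + q) \<in> S")
    case True
    then obtain x where x: "x \<in> {1..p}" "x \<in> S \<longleftrightarrow> x + (p + q) \<in> S" by blast
    have "col_antisymmetrizer lam \<bullet>\<bullet> subset_basis S = (0 :: _ \<Rightarrow>\<^sub>0 'a)"
    proof (rule antisymmetrizer_kills_subset[of x lam "x + (p + q)"])
      show "col_of lam x = col_of lam (x + (p + q))"
        using x two_row_row_col(2)[of x p q] two_row_row_col(2)[of "x + (p + q)" p q] by (auto simp: lam_def)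
    qed (use x in \<open>auto simp: two_row_sum m_def\<close>)
    then have "?e \<bullet>\<bullet> subset_basis S = 0" by (simp add: young_symmetrizer_act)
    then show ?thesis by (auto intro: exI[of _ 0])
  next
    case False
    then obtain c where c: "c \<in> col_stabilizer lam" "{1..p} \<subseteq> c ` S" "c ` S \<subseteq> {1..p + q}"
      using subset_column_normal_form[OF S(1)] by blast
    have inj: "inj c" using c(1) permutes_inj by (auto simp: col_stabilizer_iff)
    have card: "card (c ` S) = k" using S(2) inj by (simp add: card_image inj_on_subset)
    have k: "p \<le> k" "k \<le> p + q"
      using card_mono[OF finite_subset[OF c(3)] c(2)] card_mono[OF _ c(3)] card by auto
    let ?A = "c ` S - {1..p}"
    have "card ?A = k - p" using card c(2) by (simp add: card_Diff_subset)
    then have "\<exists>\<rho>. \<rho> permutes {p + 1..p + q} \<and> \<rho> ` ?A = {p + 1..k}"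
      using c(3) k by (intro ex_permutes_image) auto
    then obtain \<rho> where \<rho>: "\<rho> permutes {p + 1..p + q}" "\<rho> ` ?A = {p + 1..k}" by blast
    have "\<rho> ` {1..p} = {1..p}" using permutes_not_in[OF \<rho>(1)] by (force simp: image_iff)
    then have "\<rho> ` (c ` S) = {1..p} \<union> {p + 1..k}" using c(2) \<rho>(2) by (metis Diff_partition image_Un)
    also have "\<dots> = {1..k}" using k by auto
    finally have "w = ?e \<bullet>\<bullet> subset_basis (c ` S)"
      unfolding w_def using young_symmetrizer_subset_tail[OF \<rho>(1), of "c ` S", where 'a = 'a] by simp
    then have "?e \<bullet>\<bullet> subset_basis S = pscale (of_int (sign c)) w"
      using young_symmetrizer_subset_col[OF c(1), of S, where 'a = 'a] by simp
    then show ?thesis using k by blast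
  qed
  then show "\<exists>d. ?e \<bullet>\<bullet> subset_basis S = pscale d w"
    "\<not> (p \<le> k \<and> k \<le> p + q) \<Longrightarrow> ?e \<bullet>\<bullet> subset_basis S = 0" by blast+
qed

text \<open>
  If \<open>r c\<close> maps \<open>{1..k}\<close> to itself, then \<open>c\<close> keeps these points in the first row and hence fixes them;
  this fixes one entry of every column of height two, so \<open>c = id\<close>. The coefficient at \<open>{1..k}\<close> is
  therefore the number of row permutations that preserve \<open>{1..k}\<close>.
\<close>

lemma young_symmetrizer_subset_nonzero:
  assumes k: "p \<le> k" "k \<le> p + q"
  shows "young_symmetrizer lam \<bullet>\<bullet> subset_basis {1..k} \<noteq> (0 :: _ \<Rightarrow>\<^sub>0 'a::field_char_0)"
proof -
  let ?R = "row_stabilizer lam" and ?C = "col_stabilizer lam"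
  have c_id: "c = id" if r: "r \<in> ?R" and c: "c \<in> ?C" and eq: "r ` c ` {1..k} = {1..k}" for r c
  proof -
    have cp: "c permutes {1..m}" and rp: "r permutes {1..m}"
      using r c by (simp_all add: col_stabilizer_iff row_stabilizer_iff two_row_sum)
    have fix1: "c x = x" if x: "x \<in> {1..k}" for x
    proof -
      have X: "x \<in> {1..m}" "c x \<in> {1..m}" using x k permutes_in_image[OF cp, of x] by (auto simp: m_def)
      have "r (c x) \<in> {1..k}" using x eq by blast
      moreover from this have "r (c x) \<in> {1..m}" using k by (auto simp: m_def)
      ultimately have "row_of lam (r (c x)) = 0" using two_row_row_col(1)[of "r (c x)" p q] k by (simp add: lam_def m_def)
      moreover have "row_of lam (r (c x)) = row_of lam (c x)" using r X(2) by (simp add: row_stabilizer_iff two_row_sum)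
      moreover have "row_of lam x = 0" using two_row_row_col(1)[of x p q] x k X(1) by (simp add: lam_def m_def)
      moreover have "col_of lam (c x) = col_of lam x" using c X(1) by (simp add: col_stabilizer_iff two_row_sum)
      ultimately show ?thesis using row_col_inj[of "c x" lam x] X by (simp add: two_row_sum)
    qed
    have fix2: "c x = x" if x: "x \<in> {1..p + q}" for x
      using fix1[of x] col_stabilizer_tail[OF c, of x] x k by fastforce
    have "c x = x" if x: "x \<in> {p + q + 1..m}" for x
    proof -
      have X: "x \<in> {1..m}" "c x \<in> {1..m}" using x permutes_in_image[OF cp, of x] by auto
      have "c x \<notin> {1..p + q}"
      proof
        assume *: "c x \<in> {1..p + q}"
        then have "c (c x) = c x" by (rule fix2)
        then have "c x = x" using permutes_inj[OF cp] by (simp add: inj_eq)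
        then show False using * x by simp
      qed
      then have "row_of lam (c x) = row_of lam x"
        using X x two_row_row_col(1)[of x p q] two_row_row_col(1)[of "c x" p q] by (auto simp: lam_def m_def)
      moreover have "col_of lam (c x) = col_of lam x" using c X(1) by (simp add: col_stabilizer_iff two_row_sum)
      ultimately show ?thesis using row_col_inj[of "c x" lam x] X by (simp add: two_row_sum)
    qed
    then have "c x = x" for x using fix2[of x] permutes_not_in[OF cp, of x] by (cases "x \<in> {1..m}"; cases "x \<le> p + q") auto
    then show ?thesis by (simp add: fun_eq_iff)
  qed
  have "young_symmetrizer lam \<bullet>\<bullet> subset_basis {1..k} =
      (\<Sum>r\<in>?R. \<Sum>c\<in>?C. single (r ` c ` {1..k}) (of_int (sign c) :: 'a))"
    unfolding young_symmetrizer_expand convolve_sum_left convolve_single by (simp add: image_comp)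
  then have "lookup (young_symmetrizer lam \<bullet>\<bullet> subset_basis {1..k}) {1..k} =
      (\<Sum>r\<in>?R. \<Sum>c\<in>?C. if r ` c ` {1..k} = {1..k} then of_int (sign c) else (0 :: 'a))"
    by (simp add: lookup_sum lookup_single when_def)
  also have "\<dots> = (\<Sum>r\<in>?R. \<Sum>c\<in>?C. if c = id \<and> r ` {1..k} = {1..k} then 1 else 0)"
  proof (intro sum.cong refl)
    fix r c assume rc: "r \<in> ?R" "c \<in> ?C"
    show "(if r ` c ` {1..k} = {1..k} then of_int (sign c) else (0 :: 'a)) =
        (if c = id \<and> r ` {1..k} = {1..k} then 1 else 0)"
    proof (cases "c = id")
      case True
      then show ?thesis by (simp add: sign_id)
    next
      case False
      then have "r ` c ` {1..k} \<noteq> {1..k}" using c_id[OF rc] by blast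
      then show ?thesis using False by simp
    qed
  qed
  also have "\<dots> = (\<Sum>r\<in>?R. if r ` {1..k} = {1..k} then 1 else 0)"
    by (intro sum.cong refl) (simp add: finite_stabilizer id_in_stabilizer)
  also have "\<dots> = of_nat (card {r \<in> ?R. r ` {1..k} = {1..k}})"
    using finite_stabilizer by (simp add: sum.If_cases Int_def)
  also have "\<dots> \<noteq> 0"
  proof -
    have "id \<in> {r \<in> ?R. r ` {1..k} = {1..k}}" using id_in_stabilizer by simp
    then have "card {r \<in> ?R. r ` {1..k} = {1..k}} \<noteq> 0"
      using finite_stabilizer(1)[of lam] by (metis (no_types, lifting) card_0_eq empty_iff finite_Collect_conjI finite_subset mem_Collect_eq subsetI)
    then show ?thesis by simp
  qed
  finally show ?thesis by auto
qed

text \<open>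
  On the span of the \<open>k\<close>-subsets \<open>e\<close> maps \<open>S\<close> to \<open>d(S) w\<close> with a fixed vector \<open>w\<close>, so its trace is
  \<open>\<Sum>S. w(S) d(S)\<close>. This is also the scalar by which \<open>e\<close> acts on \<open>w\<close>, and as \<open>w\<close> lies in the image of
  \<open>e\<close> this scalar is \<open>c\<close> with \<open>e\<^sup>2 = c e\<close>.
\<close>

theorem fixed_subsets_two_row:
  "linear_extension (\<lambda>\<sigma>. of_nat (fixed_subsets m k \<sigma>)) (young_symmetrizer lam) =
    (if p \<le> k \<and> k \<le> p + q then symmetrizer_scalar lam else (0 :: 'a::field_char_0))"
proof -
  let ?e = "young_symmetrizer lam :: _ \<Rightarrow>\<^sub>0 'a"
  let ?V = "{S. S \<subseteq> {1..m} \<and> card S = k}"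
  have fin: "finite ?V" by (rule finite_subset[of _ "Pow {1..m}"]) auto
  have le: "linear_extension (\<lambda>\<sigma>. of_nat (fixed_subsets m k \<sigma>)) ?e = (\<Sum>S\<in>?V. lookup (?e \<bullet>\<bullet> subset_basis S) S)"
    by (rule linear_extension_fixed_subsets[OF symmetrizers_in_group_algebra(3)[OF two_row_partition]])
  show ?thesis
  proof (cases "p \<le> k \<and> k \<le> p + q")
    case False
    then have "lookup (?e \<bullet>\<bullet> subset_basis S) S = 0" if "S \<in> ?V" for S
      using young_symmetrizer_subset_multiple(2)[of S k, where 'a = 'a] that by simp
    then show ?thesis unfolding le if_not_P[OF False] by (intro sum.neutral) simp
  next
    case True
    define w where "w = ?e \<bullet>\<bullet> subset_basis {1..k}"
    have w0: "w \<noteq> 0" unfolding w_def using young_symmetrizer_subset_nonzero True by blast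
    have "\<forall>S\<in>?V. \<exists>d. ?e \<bullet>\<bullet> subset_basis S = pscale d w"
      unfolding w_def using young_symmetrizer_subset_multiple(1) by blast
    then obtain d where d: "\<And>S. S \<in> ?V \<Longrightarrow> ?e \<bullet>\<bullet> subset_basis S = pscale (d S) w" by metis
    have w_keys: "keys w \<subseteq> ?V"
    proof
      fix S assume "S \<in> keys w"
      moreover have "w = (\<Sum>r\<in>row_stabilizer lam. \<Sum>c\<in>col_stabilizer lam. single ((r \<circ> c) ` {1..k}) (of_int (sign c)))"
        unfolding w_def young_symmetrizer_expand convolve_sum_left convolve_single by simp
      ultimately have ne: "lookup (\<Sum>r\<in>row_stabilizer lam. \<Sum>c\<in>col_stabilizer lam. single ((r \<circ> c) ` {1..k}) (of_int (sign c) :: 'a)) S \<noteq> 0"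
        by (simp add: in_keys_iff)
      have "\<exists>r\<in>row_stabilizer lam. \<exists>c\<in>col_stabilizer lam. (r \<circ> c) ` {1..k} = S"
      proof (rule ccontr)
        assume no: "\<not> ?thesis"
        show False
          by (rule notE[OF ne]) (use no in \<open>auto simp: lookup_sum lookup_single when_def intro!: sum.neutral\<close>)
      qed
      then obtain r c where rc: "r \<in> row_stabilizer lam" "c \<in> col_stabilizer lam" "(r \<circ> c) ` {1..k} = S"
        by blast
      then have perm: "(r \<circ> c) permutes {1..m}"
        by (auto simp: row_stabilizer_iff col_stabilizer_iff two_row_sum intro: permutes_compose)
      have "{1..k} \<subseteq> {1..m}" using True by (auto simp: m_def)
      then have "S \<subseteq> {1..m}" using permutes_image[OF perm] rc(3) by (metis image_mono)
      moreover have "card S = k"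
        unfolding rc(3)[symmetric] using card_image[OF inj_on_subset[OF permutes_inj[OF perm] subset_UNIV], of "{1..k}"] by simp
      ultimately show "S \<in> ?V" by simp
    qed
    have w_expand: "w = (\<Sum>S\<in>?V. pscale (lookup w S) (subset_basis S))"
    proof -
      have "w = (\<Sum>S\<in>keys w. single S (lookup w S))"
        by (rule poly_mapping_eq_sum_single)
      also have "\<dots> = (\<Sum>S\<in>?V. single S (lookup w S))"
        using w_keys fin by (intro sum.mono_neutral_left) (auto simp: in_keys_iff)
      finally show ?thesis by (simp add: pscale_single)
    qed
    have "?e \<bullet>\<bullet> w = (\<Sum>S\<in>?V. pscale (lookup w S) (?e \<bullet>\<bullet> subset_basis S))"
      by (subst w_expand) (simp add: convolve_sum_right convolve_pscale_right)
    also have "\<dots> = pscale (\<Sum>S\<in>?V. lookup w S * d S) w"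
      by (simp add: d pscale.scale_sum_left)
    finally have "?e \<bullet>\<bullet> w = pscale (\<Sum>S\<in>?V. lookup w S * d S) w" .
    moreover have "?e \<bullet>\<bullet> w = pscale (symmetrizer_scalar lam) w"
      unfolding w_def subset_act_assoc young_symmetrizer_square(1)[OF two_row_partition] convolve_pscale_left ..
    ultimately have "(\<Sum>S\<in>?V. lookup w S * d S) = symmetrizer_scalar lam"
      using w0 pscale.scale_cancel_right by metis
    moreover have "(\<Sum>S\<in>?V. lookup (?e \<bullet>\<bullet> subset_basis S) S) = (\<Sum>S\<in>?V. lookup w S * d S)"
      by (intro sum.cong refl) (simp add: d)
    ultimately show ?thesis using le True by simp
  qed
qed

end

section \<open>Multiplicities in the graded cocharacter\<close>

definition two_row_multiplicity :: "nat list \<Rightarrow> nat" where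
  "two_row_multiplicity lam = (case lam of [] \<Rightarrow> 1 | [a] \<Rightarrow> a + 1 | [a, b] \<Rightarrow> a - b + 1 | _ \<Rightarrow> 0)"

lemma two_row_multiplicity_drop_zeros: "two_row_multiplicity (drop_zeros [p + q, p]) = q + 1"
  by (auto simp: two_row_multiplicity_def drop_zeros_def)

lemma partition_cases:
  assumes "lam \<turnstile> m"
  obtains p q where "lam = drop_zeros [p + q, p]" "m = 2 * p + q" | "3 \<le> length lam"
proof (cases "3 \<le> length lam")
  case False
  then consider "lam = []" | a where "lam = [a]" | a b where "lam = [a, b]"
    by (cases lam; cases "tl lam"; cases "tl (tl lam)") auto
  then have "\<exists>p q. lam = drop_zeros [p + q, p]"
  proof cases
    case 1
    then show ?thesis by (intro exI[of _ 0]) (simp add: drop_zeros_def)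
  next
    case (2 a)
    then show ?thesis using assms by (intro exI[of _ 0] exI[of _ a]) (simp add: drop_zeros_def is_partition_def)
  next
    case (3 a b)
    then show ?thesis using assms by (intro exI[of _ b] exI[of _ "a - b"]) (simp add: drop_zeros_def is_partition_def)
  qed
  then obtain p q where lam: "lam = drop_zeros [p + q, p]" by blast
  then have "m = 2 * p + q" using assms sum_list_two_row[of p q] by (simp add: is_partition_def)
  then show thesis using that(1) lam by blast
qed (use that in blast)

lemma two_row_multiplicity_three_rows: "3 \<le> length lam \<Longrightarrow> two_row_multiplicity lam = 0"
  by (auto simp: two_row_multiplicity_def split: list.splits)

lemma linear_extension_cong:
  assumes "x \<in> group_algebra n" "\<And>\<sigma>. \<sigma> permutes {1..n} \<Longrightarrow> f \<sigma> = g \<sigma>"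
  shows "linear_extension f x = linear_extension g x"
  using assms unfolding linear_extension_def group_algebra_def by (intro sum.cong) auto

definition invariant_subsets :: "nat \<Rightarrow> (nat \<Rightarrow> nat) \<Rightarrow> nat" where
  "invariant_subsets m \<sigma> = card {S. S \<subseteq> {1..m} \<and> \<sigma> ` S = S}"

lemma invariant_subsets_eq_sum: "invariant_subsets m \<sigma> = (\<Sum>k\<le>m. fixed_subsets m k \<sigma>)"
proof -
  let ?A = "{S. S \<subseteq> {1..m} \<and> \<sigma> ` S = S}"
  have fin: "finite ?A" by (rule finite_subset[of _ "Pow {1..m}"]) auto
  have "card S \<le> m" if "S \<in> ?A" for S
    using that card_mono[of "{1..m}" S] by simp
  then have "card ?A = (\<Sum>k\<le>m. card {S \<in> ?A. card S = k})"
    using sum.group[OF fin, of "{..m}" card "\<lambda>_. 1 :: nat"] by (simp add: image_subset_iff)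
  also have "\<dots> = (\<Sum>k\<le>m. fixed_subsets m k \<sigma>)"
    unfolding fixed_subsets_def by (intro sum.cong refl arg_cong[where f = card]) auto
  finally show ?thesis by (simp add: invariant_subsets_def)
qed

theorem character_invariant_subsets:
  assumes \<sigma>: "\<sigma> permutes {1..m}"
  shows "of_nat (invariant_subsets m \<sigma>) =
    (\<Sum>lam | lam \<turnstile> m. of_nat (two_row_multiplicity lam) * (irreducible_character lam \<sigma> :: 'a::field_char_0))"
proof -
  let ?f = "\<lambda>\<sigma>. of_nat (invariant_subsets m \<sigma>) :: 'a"
  have f_eq: "?f = (\<lambda>\<sigma>. \<Sum>k\<le>m. 1 * of_nat (fixed_subsets m k \<sigma>))"
    by (simp add: invariant_subsets_eq_sum fun_eq_iff)
  have "class_function m ?f"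
    unfolding f_eq using class_function_fixed_subsets[where 'a = 'a] unfolding class_function_def by simp
  moreover have "linear_extension ?f (young_symmetrizer lam) / symmetrizer_scalar lam = of_nat (two_row_multiplicity lam)"
    if lam: "lam \<turnstile> m" for lam
    using lam
  proof (cases rule: partition_cases)
    case (1 p q)
    have "linear_extension ?f (young_symmetrizer lam) = (\<Sum>k\<le>m. if p \<le> k \<and> k \<le> p + q then symmetrizer_scalar lam else 0)"
      unfolding f_eq linear_extension_sum_fun by (simp add: fixed_subsets_two_row[OF 1])
    also have "\<dots> = (\<Sum>k\<in>{p..p + q}. symmetrizer_scalar lam)"
      using 1(2) by (intro sum.mono_neutral_cong_right) auto
    also have "\<dots> = of_nat (q + 1) * symmetrizer_scalar lam" by simp
    finally show ?thesis
      using young_symmetrizer_square(2)[OF lam, where 'a = 'a] 1(1) two_row_multiplicity_drop_zeros[of p q] by simp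
  next
    case 2
    then show ?thesis
      unfolding f_eq linear_extension_sum_fun
      by (simp add: fixed_subsets_three_rows[OF lam] two_row_multiplicity_three_rows)
  qed
  ultimately show ?thesis using class_function_expansion[OF _ \<sigma>, of ?f] by simp
qed

text \<open>
  The trivial character is the case \<open>k = 0\<close> of Young's rule.
\<close>

theorem trivial_character:
  assumes \<sigma>: "\<sigma> permutes {1..m}"
  shows "1 = (\<Sum>lam | lam \<turnstile> m. of_nat (if lam = drop_zeros [m] then 1 else 0) * (irreducible_character lam \<sigma> :: 'a::field_char_0))"
proof -
  have fixed0: "fixed_subsets m 0 \<tau> = 1" for \<tau>
  proof -
    have "{S. S \<subseteq> {1..m} \<and> card S = 0 \<and> \<tau> ` S = S} = {{}}" by (auto dest: finite_subset)
    then show ?thesis by (simp add: fixed_subsets_def)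
  qed
  have "linear_extension (\<lambda>\<sigma>. of_nat (fixed_subsets m 0 \<sigma>) :: 'a) (young_symmetrizer lam) / symmetrizer_scalar lam =
      of_nat (if lam = drop_zeros [m] then 1 else 0)"
    if lam: "lam \<turnstile> m" for lam
    using lam
  proof (cases rule: partition_cases)
    case (1 p q)
    have "lam = drop_zeros [m] \<longleftrightarrow> p = 0"
      by (auto simp: 1 drop_zeros_def)
    then show ?thesis
      using young_symmetrizer_square(2)[OF lam, where 'a = 'a] by (simp add: fixed_subsets_two_row[OF 1])
  next
    case 2
    then have "lam \<noteq> drop_zeros [m]" by (auto simp: drop_zeros_def)
    then show ?thesis by (simp add: fixed_subsets_three_rows[OF lam 2])
  qed
  then show ?thesis
    using class_function_expansion[OF class_function_fixed_subsets[of m 0] \<sigma>, where 'a = 'a] by (simp add: fixed0)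
qed

text \<open>
  A partition of a number up to 2 has a single row or a single column, so one of the stabilizers is the
  whole group and the other one is trivial.
\<close>

lemma symmetrizer_scalar_small:
  assumes lam: "lam \<turnstile> n" and n: "n \<le> 2"
  shows "symmetrizer_scalar lam = (of_nat (fact n) :: 'a::field_char_0)"
proof -
  have sum: "sum_list lam = n" using lam by (simp add: is_partition_def)
  have card_perms: "card {\<sigma>. \<sigma> permutes {1..n}} = fact n" by (simp add: card_permutations)
  have "(\<forall>x\<in>{1..n}. row_of lam x = 0) \<or> (\<forall>x\<in>{1..n}. col_of lam x = 0)"
    using lam
  proof (cases rule: partition_cases)
    case (1 p q)
    then consider "p = 0" | "p = 1" "q = 0" using n by linarith
    then show ?thesis
    proof cases
      case 1
      then show ?thesis using \<open>lam = _\<close> \<open>n = _\<close> two_row_row_col(1)[of _ p q] by simp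
    next
      case 2
      then show ?thesis using \<open>lam = _\<close> \<open>n = _\<close> two_row_row_col(2)[of _ p q] by auto
    qed
  next
    case 2
    have "length xs \<le> sum_list xs" if "\<forall>x\<in>set xs. (0::nat) < x" for xs
      using that by (induction xs) auto
    then have "length lam \<le> n" using lam by (auto simp: is_partition_def)
    then show ?thesis using 2 n by simp
  qed
  then show ?thesis
  proof
    assume row: "\<forall>x\<in>{1..n}. row_of lam x = 0"
    have R: "row_stabilizer lam = {\<sigma>. \<sigma> permutes {1..n}}"
      using row by (auto simp: row_stabilizer_iff sum permutes_in_image simp del: atLeastAtMost_iff One_nat_def)
    have "col_stabilizer lam = {id}"
      using row_col_stabilizer_Int[of _ lam] id_in_stabilizer(2)[of lam] stabilizer_subset(2)[of lam] unfolding R sum by blast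
    then have "col_antisymmetrizer lam = (perm_basis id :: _ \<Rightarrow>\<^sub>0 'a)" by (simp add: col_antisymmetrizer_def sign_id)
    then have "young_symmetrizer lam = (row_symmetrizer lam :: _ \<Rightarrow>\<^sub>0 'a)" by (simp only: young_symmetrizer_eq ga_mult_id)
    then show ?thesis
      using row_symmetrizer_square[of lam, where 'a = 'a] R card_perms by (intro symmetrizer_scalar_eqI) simp
  next
    assume col: "\<forall>x\<in>{1..n}. col_of lam x = 0"
    have C: "col_stabilizer lam = {\<sigma>. \<sigma> permutes {1..n}}"
      using col by (auto simp: col_stabilizer_iff sum permutes_in_image simp del: atLeastAtMost_iff One_nat_def)
    have "row_stabilizer lam = {id}"
      using row_col_stabilizer_Int[of _ lam] id_in_stabilizer(1)[of lam] stabilizer_subset(1)[of lam] unfolding C sum by blast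
    then have "row_symmetrizer lam = (perm_basis id :: _ \<Rightarrow>\<^sub>0 'a)" by (simp add: row_symmetrizer_def)
    then have e: "young_symmetrizer lam = (col_antisymmetrizer lam :: _ \<Rightarrow>\<^sub>0 'a)" by (simp only: young_symmetrizer_eq ga_mult_id)
    have "col_antisymmetrizer lam \<star> col_antisymmetrizer lam =
        (\<Sum>c\<in>col_stabilizer lam. pscale (of_int (sign c)) (perm_basis c) \<star> (col_antisymmetrizer lam :: _ \<Rightarrow>\<^sub>0 'a))"
      by (subst (1) col_antisymmetrizer_def) (simp add: ga_mult_sum_left pscale_single)
    also have "\<dots> = (\<Sum>c\<in>col_stabilizer lam. col_antisymmetrizer lam)"
      by (intro sum.cong refl) (simp add: ga_mult_pscale col_antisymmetrizer_absorb(1) sign_def)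
    also have "\<dots> = pscale (of_nat (fact n)) (col_antisymmetrizer lam)"
      by (rule poly_mapping_eqI) (simp add: lookup_sum C card_permutations)
    finally show ?thesis using e by (intro symmetrizer_scalar_eqI) simp
  qed
qed

text \<open>
  The regular character takes the value \<open>n!\<close> at a Young symmetrizer, whose coefficient at the identity
  is 1; for \<open>n \<le> 2\<close> this is also the value of the irreducible character.
\<close>

theorem regular_character_small:
  assumes n: "n \<le> 2" and \<tau>: "\<tau> permutes {1..n}"
  shows "(if \<tau> = id then of_nat (fact n) else 0) = (\<Sum>mu | mu \<turnstile> n. irreducible_character mu \<tau> :: 'a::field_char_0)"
proof -
  let ?f = "\<lambda>\<tau>. if \<tau> = id then of_nat (fact n) else 0 :: 'a"
  have "class_function n ?f"
    unfolding class_function_def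
  proof (intro allI impI)
    fix \<sigma> \<tau> assume \<tau>: "\<tau> permutes {1..n}"
    have inv: "inv \<tau> \<circ> \<tau> = id" "\<tau> \<circ> inv \<tau> = id" using permutes_inv_o[OF \<tau>] by auto
    have "\<sigma> = id" if "\<tau> \<circ> \<sigma> \<circ> inv \<tau> = id"
    proof -
      have "\<sigma> = inv \<tau> \<circ> (\<tau> \<circ> \<sigma> \<circ> inv \<tau>) \<circ> \<tau>" by (metis inv(1) comp_id id_comp o_assoc)
      also have "\<dots> = id" by (simp only: that id_comp comp_id inv)
      finally show ?thesis .
    qed
    moreover have "\<tau> \<circ> id \<circ> inv \<tau> = id" by (simp only: comp_id inv)
    ultimately have "\<tau> \<circ> \<sigma> \<circ> inv \<tau> = id \<longleftrightarrow> \<sigma> = id" by blast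
    then show "?f (\<tau> \<circ> \<sigma> \<circ> inv \<tau>) = ?f \<sigma>" by simp
  qed
  moreover have "linear_extension ?f (young_symmetrizer mu) / symmetrizer_scalar mu = 1" if mu: "mu \<turnstile> n" for mu
  proof -
    let ?P = "{\<sigma>. \<sigma> permutes {1..n}}"
    have fin: "finite ?P" by (simp add: finite_permutations)
    have "linear_extension ?f (young_symmetrizer mu) = (\<Sum>\<sigma>\<in>?P. lookup (young_symmetrizer mu) \<sigma> * ?f \<sigma>)"
      using symmetrizers_in_group_algebra(3)[OF mu] by (intro linear_extension_superset fin) (simp add: group_algebra_def)
    also have "\<dots> = (\<Sum>\<sigma>\<in>?P. if \<sigma> = id then of_nat (fact n) else 0)"
      by (intro sum.cong refl) (use lookup_young_symmetrizer_id[of mu, where 'a = 'a] in auto)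
    also have "\<dots> = of_nat (fact n)" using fin by (simp add: permutes_id)
    finally show ?thesis by (simp add: symmetrizer_scalar_small[OF mu n])
  qed
  ultimately show ?thesis using class_function_expansion[OF _ \<tau>, of ?f] by simp
qed

lemma card_fixed_orderings:
  assumes \<tau>: "\<tau> permutes {1..n}"
  shows "card {zl. distinct zl \<and> set zl = {1..n} \<and> map \<tau> zl = zl} = (if \<tau> = id then fact n else 0)"
proof (cases "\<tau> = id")
  case True
  have "{zl. distinct zl \<and> set zl = {1..n} \<and> map \<tau> zl = zl} = permutations_of_set {1..n}"
    by (auto simp: True permutations_of_set_def)
  then show ?thesis by (simp add: True)
next
  case False
  then obtain x where x: "\<tau> x \<noteq> x" by (auto simp: fun_eq_iff)
  then have "x \<in> {1..n}" using permutes_not_in[OF \<tau>] by blast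
  have "map \<tau> zl \<noteq> zl" if "set zl = {1..n}" for zl
  proof
    assume "map \<tau> zl = zl"
    then have "map \<tau> zl = map (\<lambda>y. y) zl" by simp
    then have "\<tau> x = x" using \<open>x \<in> {1..n}\<close> that unfolding map_eq_conv by blast
    then show False using x by simp
  qed
  then have "{zl. distinct zl \<and> set zl = {1..n} \<and> map \<tau> zl = zl} = {}" by blast
  then show ?thesis using False by (metis card.empty)
qed

lemma graded_cocharacter_factor:
  assumes \<omega>: "\<omega> permutes {1..m}" and \<tau>: "\<tau> permutes {1..n}"
  shows "graded_cocharacter m n \<omega> \<tau> = (if 2 < n then 0 else
    (if n = 0 then 1 else of_nat (invariant_subsets m \<omega>)) * (if \<tau> = id then of_nat (fact n) else 0 :: 'a::field_char_0))"
proof (cases "2 < n")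
  case True
  then show ?thesis by (simp add: graded_cocharacter_eq[OF \<omega> \<tau>] word_classes_def)
next
  case False
  have "{(S, zl) \<in> word_classes m n. \<omega> ` S = S \<and> map \<tau> zl = zl} =
    {S. S \<in> (if n = 0 then {{}} else Pow {1..m}) \<and> \<omega> ` S = S} \<times> {zl. distinct zl \<and> set zl = {1..n} \<and> map \<tau> zl = zl}"
    using False by (auto simp: word_classes_def)
  moreover have "card {S. S \<in> (if n = 0 then {{}} else Pow {1..m}) \<and> \<omega> ` S = S} =
    (if n = 0 then 1 else invariant_subsets m \<omega>)"
  proof (cases "n = 0")
    case True
    have "{S. S \<in> {{}} \<and> \<omega> ` S = S} = {{}}" by auto
    then show ?thesis using True by simp
  qed (simp add: invariant_subsets_def)
  ultimately have "card {(S, zl) \<in> word_classes m n. \<omega> ` S = S \<and> map \<tau> zl = zl} =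
    (if n = 0 then 1 else invariant_subsets m \<omega>) * (if \<tau> = id then fact n else 0)"
    by (simp only: card_cartesian_product card_fixed_orderings[OF \<tau>])
  then show ?thesis using False by (simp add: graded_cocharacter_eq[OF \<omega> \<tau>])
qed

definition cocharacter_multiplicity :: "nat \<Rightarrow> nat \<Rightarrow> nat list \<Rightarrow> nat list \<Rightarrow> nat" where
  "cocharacter_multiplicity m n lam mu = (if 2 < n then 0
     else if n = 0 then (if lam = drop_zeros [m] then 1 else 0) else two_row_multiplicity lam)"

theorem has_multiplicities_graded_cocharacter:
  "has_multiplicities m n (graded_cocharacter m n :: _ \<Rightarrow> _ \<Rightarrow> 'a::field_char_0) (cocharacter_multiplicity m n)"
  unfolding has_multiplicities_def
proof (intro allI impI)
  fix \<omega> \<tau> assume "\<omega> permutes {1..m} \<and> \<tau> permutes {1..n}"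
  then have \<omega>: "\<omega> permutes {1..m}" and \<tau>: "\<tau> permutes {1..n}" by auto
  show "graded_cocharacter m n \<omega> \<tau> = (\<Sum>lam | lam \<turnstile> m. \<Sum>mu | mu \<turnstile> n.
    of_nat (cocharacter_multiplicity m n lam mu) * (irreducible_character lam \<omega> * irreducible_character mu \<tau> :: 'a))"
  proof (cases "2 < n")
    case True
    then show ?thesis by (simp add: graded_cocharacter_factor[OF \<omega> \<tau>] cocharacter_multiplicity_def)
  next
    case False
    define d where "d lam = (if n = 0 then (if lam = drop_zeros [m] then 1 else 0) else two_row_multiplicity lam)" for lam
    have mult: "cocharacter_multiplicity m n lam mu = d lam" for lam mu
      using False by (simp add: cocharacter_multiplicity_def d_def)
    have "graded_cocharacter m n \<omega> \<tau> = (if n = 0 then 1 else of_nat (invariant_subsets m \<omega>)) *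
        (if \<tau> = id then of_nat (fact n) else 0 :: 'a)"
      using graded_cocharacter_factor[OF \<omega> \<tau>, where 'a = 'a] False by simp
    also have "(if n = 0 then 1 else of_nat (invariant_subsets m \<omega>)) =
        (\<Sum>lam | lam \<turnstile> m. of_nat (d lam) * (irreducible_character lam \<omega> :: 'a))"
    proof (cases "n = 0")
      case True
      then show ?thesis using trivial_character[OF \<omega>, where 'a = 'a] by (simp add: d_def)
    next
      case False
      then show ?thesis using character_invariant_subsets[OF \<omega>, where 'a = 'a] by (simp add: d_def)
    qed
    also have "(if \<tau> = id then of_nat (fact n) else 0 :: 'a) = (\<Sum>mu | mu \<turnstile> n. irreducible_character mu \<tau>)"
      using False by (intro regular_character_small \<tau>) simp
    finally show ?thesis by (simp add: mult sum_product mult.assoc)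
  qed
qed

text \<open>
  Extending \<open>ch\<close> bilinearly and evaluating it at a pair of Young symmetrizers isolates one multiplicity.
\<close>

theorem has_multiplicities_unique:
  fixes ch :: "(nat \<Rightarrow> nat) \<Rightarrow> (nat \<Rightarrow> nat) \<Rightarrow> 'a::field_char_0"
  assumes mul: "has_multiplicities m n ch mul" and mul': "has_multiplicities m n ch mul'"
    and lam: "lam \<turnstile> m" and mu: "mu \<turnstile> n"
  shows "mul lam mu = mul' lam mu"
proof -
  let ?e = "young_symmetrizer lam :: _ \<Rightarrow>\<^sub>0 'a" and ?e' = "young_symmetrizer mu :: _ \<Rightarrow>\<^sub>0 'a"
  let ?c = "symmetrizer_scalar lam :: 'a" and ?c' = "symmetrizer_scalar mu :: 'a"
  have *: "linear_extension (\<lambda>\<omega>. linear_extension (ch \<omega>) ?e') ?e = of_nat (f lam mu) * ?c * ?c'"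
    if f: "has_multiplicities m n ch f" for f
  proof -
    have inner: "linear_extension (ch \<omega>) ?e' = (\<Sum>l | l \<turnstile> m. (of_nat (f l mu) * ?c') * irreducible_character l \<omega>)"
      if \<omega>: "\<omega> permutes {1..m}" for \<omega>
    proof -
      have "linear_extension (ch \<omega>) ?e' = linear_extension (\<lambda>\<tau>. \<Sum>u | u \<turnstile> n.
          (\<Sum>l | l \<turnstile> m. of_nat (f l u) * irreducible_character l \<omega>) * irreducible_character u \<tau>) ?e'"
      proof (rule linear_extension_cong[OF symmetrizers_in_group_algebra(3)[OF mu]])
        fix \<tau> assume "\<tau> permutes {1..n}"
        then have "ch \<omega> \<tau> = (\<Sum>l | l \<turnstile> m. \<Sum>u | u \<turnstile> n. of_nat (f l u) * (irreducible_character l \<omega> * irreducible_character u \<tau>))"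
          using f \<omega> by (simp add: has_multiplicities_def)
        also have "\<dots> = (\<Sum>u | u \<turnstile> n. \<Sum>l | l \<turnstile> m. of_nat (f l u) * (irreducible_character l \<omega> * irreducible_character u \<tau>))"
          by (rule sum.swap)
        finally show "ch \<omega> \<tau> = (\<Sum>u | u \<turnstile> n.
            (\<Sum>l | l \<turnstile> m. of_nat (f l u) * irreducible_character l \<omega>) * irreducible_character u \<tau>)"
          by (simp add: sum_distrib_right mult.assoc)
      qed
      also have "\<dots> = (\<Sum>u | u \<turnstile> n. if u = mu then (\<Sum>l | l \<turnstile> m. of_nat (f l u) * irreducible_character l \<omega>) * ?c' else 0)"
        unfolding linear_extension_sum_fun using mu
        by (intro sum.cong refl) (auto simp: character_young_symmetrizer)
      also have "\<dots> = (\<Sum>l | l \<turnstile> m. of_nat (f l mu) * irreducible_character l \<omega>) * ?c'"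
        using mu finite_partitions by simp
      finally show ?thesis by (simp add: sum_distrib_left mult_ac)
    qed
    have "linear_extension (\<lambda>\<omega>. linear_extension (ch \<omega>) ?e') ?e =
        linear_extension (\<lambda>\<omega>. \<Sum>l | l \<turnstile> m. (of_nat (f l mu) * ?c') * irreducible_character l \<omega>) ?e"
      by (rule linear_extension_cong[OF symmetrizers_in_group_algebra(3)[OF lam] inner])
    also have "\<dots> = (\<Sum>l | l \<turnstile> m. if l = lam then of_nat (f l mu) * ?c' * ?c else 0)"
      unfolding linear_extension_sum_fun using lam
      by (intro sum.cong refl) (auto simp: character_young_symmetrizer)
    also have "\<dots> = of_nat (f lam mu) * ?c * ?c'"
      using lam finite_partitions by simp
    finally show ?thesis .
  qed
  have "of_nat (mul lam mu) * ?c * ?c' = of_nat (mul' lam mu) * ?c * ?c'"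
    using *[OF mul] *[OF mul'] by (rule trans[OF sym])
  then show ?thesis
    using young_symmetrizer_square(2)[OF lam, where 'a = 'a] young_symmetrizer_square(2)[OF mu, where 'a = 'a] by simp
qed

theorem theorem5:
  fixes m n :: nat
    and ch :: "(nat \<Rightarrow> nat) \<Rightarrow> (nat \<Rightarrow> nat) \<Rightarrow> 'a::field_char_0"
  assumes "ch = graded_cocharacter m n"
  shows "(\<exists>mul. has_multiplicities m n ch mul) \<and>
    (\<forall>mul. has_multiplicities m n ch mul \<longrightarrow>
      (\<forall>lam mu. lam \<turnstile> m \<and> mu \<turnstile> n \<longrightarrow>
        (lam = drop_zeros [m] \<and> mu = [] \<longrightarrow> mul lam mu = 1) \<and>
        (\<forall>p q. lam = drop_zeros [p + q, p] \<and> mu = [1] \<longrightarrow> mul lam mu = q + 1) \<and>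
        (\<forall>p q. lam = drop_zeros [p + q, p] \<and> mu \<turnstile> 2 \<longrightarrow> mul lam mu = q + 1) \<and>
        (\<not> (lam = drop_zeros [m] \<and> mu = []) \<and>
         \<not> (\<exists>p q. lam = drop_zeros [p + q, p] \<and> (mu = [1] \<or> mu \<turnstile> 2))
           \<longrightarrow> mul lam mu = 0)))"
proof (intro conjI allI impI)
  have ex: "has_multiplicities m n ch (cocharacter_multiplicity m n)"
    unfolding assms by (rule has_multiplicities_graded_cocharacter)
  then show "\<exists>mul. has_multiplicities m n ch mul" by blast
  fix mul lam mu
  assume mul: "has_multiplicities m n ch mul" and "lam \<turnstile> m \<and> mu \<turnstile> n"
  then have lam: "lam \<turnstile> m" and mu: "mu \<turnstile> n" by auto
  have eq: "mul lam mu = cocharacter_multiplicity m n lam mu"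
    by (rule has_multiplicities_unique[OF mul ex lam mu])
  have sum: "sum_list mu = n" using mu by (simp add: is_partition_def)
  show "mul lam mu = 1" if "lam = drop_zeros [m] \<and> mu = []"
    unfolding eq using that sum by (auto simp: cocharacter_multiplicity_def)
  show "mul lam mu = q + 1" if "lam = drop_zeros [p + q, p] \<and> mu = [1]" for p q
  proof -
    have "n = 1" using that sum by simp
    then show ?thesis
      unfolding eq using that two_row_multiplicity_drop_zeros[of p q] by (simp add: cocharacter_multiplicity_def)
  qed
  show "mul lam mu = q + 1" if "lam = drop_zeros [p + q, p] \<and> mu \<turnstile> 2" for p q
  proof -
    have "n = 2" using that sum by (simp add: is_partition_def)
    then show ?thesis
      unfolding eq using that two_row_multiplicity_drop_zeros[of p q] by (simp add: cocharacter_multiplicity_def)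
  qed
  show "mul lam mu = 0"
    if *: "\<not> (lam = drop_zeros [m] \<and> mu = []) \<and> \<not> (\<exists>p q. lam = drop_zeros [p + q, p] \<and> (mu = [1] \<or> mu \<turnstile> 2))"
  proof (cases "n = 0 \<or> 2 < n")
    case True
    have "mu = []" if "n = 0" using mu that by (cases mu) (auto simp: is_partition_def)
    then show ?thesis using True * by (auto simp: eq cocharacter_multiplicity_def)
  next
    case False
    have "mu = [1]" if n1: "n = 1"
    proof -
      obtain a mu' where a: "mu = a # mu'" using sum n1 by (cases mu) auto
      then have "0 < a" "\<forall>x\<in>set mu'. 0 < x" "a + sum_list mu' = 1" using mu n1 by (auto simp: is_partition_def)
      then have "a = 1 \<and> mu' = []" by (cases mu') auto
      then show ?thesis using a by simp
    qed
    moreover have "n = 1 \<or> n = 2" using False by linarith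
    ultimately have "mu = [1] \<or> mu \<turnstile> 2" using mu by blast
    with * have no: "lam \<noteq> drop_zeros [p + q, p]" for p q by blast
    from lam have "3 \<le> length lam"
    proof (cases rule: partition_cases)
      case (1 p q)
      then show ?thesis using no[of p q] by simp
    qed
    then show ?thesis using False by (simp add: eq cocharacter_multiplicity_def two_row_multiplicity_three_rows)
  qed
qed

end
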